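(* Let $f$ be twice differentiable and either convex ($f''>0$) or concave ($f''<0$) on the range of function values, and consider $u_t+(f(u))_x=0$. Let $P(t)=\{(x_1,u_1^-,u_1^+),\dots,(x_n,u_n^-,u_n^+)\}$ be shock particles with $x_1<\dots<x_n$, each satisfying the Oleinik condition $f'(u_i^-)\ge f'(u_i^+)$, evolving in time according to \[ \dot x_i = s(u_i^-,u_i^+),\quad \dot u_i^- = \bigl(s(u_i^-,u_i^+)-f'(u_i^-)\bigr)\frac{f'(u_{i-1}^+)-f'(u_i^-)}{x_{i-1}-x_i}\frac{1}{f''(u_i^-)},\quad \dot u_i^+ = \bigl(s(u_i^-,u_i^+)-f'(u_i^+)\bigr)\frac{f'(u_{i+1}^-)-f'(u_i^+)}{x_{i+1}-x_i}\frac{1}{f''(u_i^+)}, \] where $s(u,v)=\frac{f(u)-f(v)}{u-v}$ for $u\neq v$ and $s(u,u)=f'(u)$. If this time evolution is solved exactly, then for sufficiently short times $t$, the interpolant $U_{P(t)}$ is the unique weak entropy solution of $u_t+(f(u))_x=0$ with initial condition $u_0=U_{P(0)}$, on the domain of definition $[x_1(t),x_n(t)]$.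
   Context: A shock particle is a triple $(x_i,u_i^-,u_i^+)$ (position, left state, right state); it is characteristic if $u_i^-=u_i^+$. For shock particles with $x_1\le\dots\le x_n$, the interpolant $U_P$ on $[x_1,x_n]$ is defined piecewise: on $[x_i,x_{i+1}]$ it is constant equal to $u_i^+$ if $u_i^+=u_{i+1}^-$, and otherwise $U_P(x)$ is the unique value (well-defined since $f'$ is strictly monotone) satisfying \[ \frac{x-x_i}{x_{i+1}-x_i}=\frac{f'(U_P(x))-f'(u_i^+)}{f'(u_{i+1}^-)-f'(u_i^+)}. \] At a particle with $u_i^-\neq u_i^+$ the interpolant has a jump from $u_i^-$ to $u_i^+$.
   Formalization: The outer states u_1^- and u_n^+, whose equations refer to missing particles, are taken constant in time; U_P is extended by u_1^- left of x_1 and u_n^+ right of x_n, and uniqueness on [x_1(t),x_n(t)] is among entropy solutions on the whole line with this extended initial data. *)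

theory Defs
  imports "HOL-Analysis.Analysis"
begin

definition shock_speed :: "(real \<Rightarrow> real) \<Rightarrow> (real \<Rightarrow> real) \<Rightarrow> real \<Rightarrow> real \<Rightarrow> real" where
  "shock_speed f df u v = (if u \<noteq> v then (f u - f v) / (u - v) else df u)"

text \<open>Interpolant of the shock particles (X i, Um i, Up i), i = 1..n, on [X 1, X n].
  df is f'. At a particle position shared by two intervals the left interval is used
  (a measure-zero choice). Outside [X 1, X n] the value is unspecified.\<close>
definition interpolant ::
  "(real \<Rightarrow> real) \<Rightarrow> nat \<Rightarrow> (nat \<Rightarrow> real) \<Rightarrow> (nat \<Rightarrow> real) \<Rightarrow> (nat \<Rightarrow> real) \<Rightarrow> real \<Rightarrow> real" where
  "interpolant df n X Um Up x =
     (if \<exists>i. 1 \<le> i \<and> i < n \<and> X i \<le> x \<and> x \<le> X (Suc i) then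
        (let i = (LEAST i. 1 \<le> i \<and> i < n \<and> X i \<le> x \<and> x \<le> X (Suc i)) in
           if Up i = Um (Suc i) then Up i
           else (THE v. min (Up i) (Um (Suc i)) \<le> v \<and> v \<le> max (Up i) (Um (Suc i)) \<and>
                   (x - X i) / (X (Suc i) - X i) = (df v - df (Up i)) / (df (Um (Suc i)) - df (Up i))))
      else undefined)"

definition test_fun ::
  "real \<Rightarrow> (real \<Rightarrow> real \<Rightarrow> real) \<Rightarrow> (real \<Rightarrow> real \<Rightarrow> real) \<Rightarrow> (real \<Rightarrow> real \<Rightarrow> real) \<Rightarrow> bool" where
  "test_fun T phi phit phix \<longleftrightarrow>
     (\<forall>t x. ((\<lambda>s. phi s x) has_real_derivative phit t x) (at t) \<and>
            ((\<lambda>y. phi t y) has_real_derivative phix t x) (at x)) \<and>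
     continuous_on UNIV (\<lambda>z. phit (fst z) (snd z)) \<and>
     continuous_on UNIV (\<lambda>z. phix (fst z) (snd z)) \<and>
     (\<exists>R e. e > 0 \<and> (\<forall>t x. (t \<ge> T - e \<or> t \<le> -R \<or> \<bar>x\<bar> \<ge> R) \<longrightarrow> phi t x = 0))"

definition entropy_solution ::
  "(real \<Rightarrow> real) \<Rightarrow> real \<Rightarrow> (real \<Rightarrow> real) \<Rightarrow> (real \<Rightarrow> real \<Rightarrow> real) \<Rightarrow> bool" where
  "entropy_solution f T u0 u \<longleftrightarrow>
     set_borel_measurable lborel ({0<..<T} \<times> UNIV) (\<lambda>z. u (fst z) (snd z)) \<and>
     (\<exists>M. \<forall>t x. 0 < t \<and> t < T \<longrightarrow> \<bar>u t x\<bar> \<le> M) \<and>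
     (\<forall>phi phit phix. test_fun T phi phit phix \<longrightarrow>
        (LINT z:{0<..<T} \<times> UNIV|lborel.
            u (fst z) (snd z) * phit (fst z) (snd z) + f (u (fst z) (snd z)) * phix (fst z) (snd z))
        + (LINT x|lborel. u0 x * phi 0 x) = 0) \<and>
     (\<forall>phi phit phix k. test_fun T phi phit phix \<and> (\<forall>t x. phi t x \<ge> 0) \<longrightarrow>
        (LINT z:{0<..<T} \<times> UNIV|lborel.
            \<bar>u (fst z) (snd z) - k\<bar> * phit (fst z) (snd z)
            + sgn (u (fst z) (snd z) - k) * (f (u (fst z) (snd z)) - f k) * phix (fst z) (snd z))
        + (LINT x|lborel. \<bar>u0 x - k\<bar> * phi 0 x) \<ge> 0)"

end

theory Submission
  imports Defs
begin

text \<open>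
  Between two particles \<open>W = f'(u)\<close> is affine in \<open>x\<close>, and the evolution equations of the particles say exactly
  that \<open>W\<close> solves Burgers' equation there. For an entropy pair \<open>(\<eta>, q)\<close> let \<open>H\<close> be a primitive of
  \<open>\<eta> \<circ> (f')\<^sup>-\<^sup>1\<close>; then \<open>\<Phi> = H(W) / W\<^sub>x\<close> is a \<open>C\<^sup>1\<close> potential with \<open>\<Phi>\<^sub>x = \<eta>(u)\<close> and \<open>\<Phi>\<^sub>t = - q(u)\<close>. No
  regularity of \<open>f''\<close> is needed for this. Green's formula on both sides of each particle path reduces the weak
  formulation to the Rankine-Hugoniot defect on the path, which vanishes for \<open>\<eta>(u) = u\<close> and has the right
  sign for the Kruzkov entropies because Oleinik's condition is preserved: the jump of \<open>f'(u)\<close> across a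
  particle obeys a linear differential inequality.

  Uniqueness is Kruzkov's doubling of variables. The solution built from the particles is continuous off
  finitely many curves, so its regularity alone suffices to pass to the limit, and nothing beyond boundedness is
  used of the competitor.
\<close>

section \<open>Bounded functions and test functions\<close>

text \<open>With \<open>f''\<close> given only pointwise, the inverse of \<open>f'\<close> is
  continuous but perhaps not C^1, so the solution may fail to be C^1 even between particles;
  potentials avoid differentiating it. The affine profile of each interval is continued over the
  whole plane and composed with a continuous inverse of \<open>f'\<close> extended to all reals. The
  solution is then the leftmost state plus one jump for every particle already passed, each jump
  living on the half plane to the right of one path; a single half-plane formula serves all strips.

  The solution notion lives on the whole line, whereas the particles describe only
  \<open>[X 1, X n]\<close>: constant outer states are attached, and the outermost particles become
  ordinary fronts. Shortness of time keeps the particles in strict order on a compact time interval.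

  On the paths, the interpolant and the strips may disagree. Integrals ignore such null sets, but
  Borel measurability and pointwise bounds do not, so the values there have to be
  identified.\<close>

lemma bounded_range_real_intros:
  fixes f g :: "'a \<Rightarrow> real"
  shows "bounded (range f) \<Longrightarrow> bounded (range g) \<Longrightarrow> bounded (range (\<lambda>x. f x * g x))"
    and "bounded (range f) \<Longrightarrow> bounded (range g) \<Longrightarrow> bounded (range (\<lambda>x. f x + g x))"
    and "bounded (range f) \<Longrightarrow> bounded (range g) \<Longrightarrow> bounded (range (\<lambda>x. f x - g x))"
    and "bounded (range f) \<Longrightarrow> bounded (range (\<lambda>x. \<bar>f x\<bar>))"
    and "bounded (range (indicator A :: 'a \<Rightarrow> real))"
    and "bounded (range (\<lambda>x::'a. c::real))"
proof -
  show "bounded (range (\<lambda>x. f x * g x))" if "bounded (range f)" "bounded (range g)"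
  proof -
    from that obtain a b where "\<forall>y\<in>range f. norm y \<le> a" "\<forall>y\<in>range g. norm y \<le> b"
      unfolding bounded_iff by blast
    then have ab: "\<And>x. \<bar>f x\<bar> \<le> a" "\<And>x. \<bar>g x\<bar> \<le> b" by simp_all
    have "\<bar>f x * g x\<bar> \<le> a * b" for x
      unfolding abs_mult
      using ab by (meson abs_ge_zero mult_mono order_trans)
    then show ?thesis unfolding bounded_iff by (intro exI[of _ "a * b"]) simp
  qed
  show "bounded (range (\<lambda>x. f x + g x))" "bounded (range (\<lambda>x. f x - g x))"
    if "bounded (range f)" "bounded (range g)"
    using bounded_plus_comp[OF that] bounded_minus_comp[OF that] by simp_all
  show "bounded (range (\<lambda>x. \<bar>f x\<bar>))" if "bounded (range f)"
    using that by (simp add: bounded_iff)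
  show "bounded (range (indicator A :: 'a \<Rightarrow> real))"
    unfolding bounded_iff by (rule exI[of _ 1]) (auto simp: indicator_def)
  show "bounded (range (\<lambda>x::'a. c::real))"
    by (simp add: bounded_iff) blast
qed

lemma bounded_range_comp: "bounded (range f) \<Longrightarrow> bounded (range (\<lambda>x. f (g x)))"
  by (erule bounded_subset) auto

lemma bounded_range_absE:
  fixes f :: "'a \<Rightarrow> real"
  assumes "bounded (range f)"
  obtains C where "C \<ge> 0" "\<And>x. \<bar>f x\<bar> \<le> C"
proof -
  obtain a where "\<forall>y\<in>range f. norm y \<le> a" using assms unfolding bounded_iff by blast
  then show thesis using that[of "max 0 a"] by (simp add: le_max_iff_disj)
qed

lemma continuous_bounded_support_bounded_range:
  fixes g :: "'a::euclidean_space \<Rightarrow> real"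
  assumes "continuous_on UNIV g" "bounded B" "\<And>x. x \<notin> B \<Longrightarrow> g x = 0"
  shows "bounded (range g)"
proof -
  have "compact (closure B)" using assms(2) by (simp add: compact_closure)
  then have "bounded (g ` closure B)"
    by (intro compact_imp_bounded compact_continuous_image continuous_on_subset[OF assms(1)]) auto
  then have "bounded (insert 0 (g ` closure B))" by simp
  moreover have "range g \<subseteq> insert 0 (g ` closure B)"
    using assms(3) closure_subset[of B] by blast
  ultimately show ?thesis by (rule bounded_subset)
qed

section \<open>Integrability, Fubini and differentiation in two variables\<close>

lemma integrable_bounded_support:
  fixes g :: "'a::euclidean_space \<Rightarrow> real"
  assumes g: "g \<in> borel_measurable borel" "bounded (range g)"
    and B: "bounded B" "\<And>x. x \<notin> B \<Longrightarrow> g x = 0"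
  shows "integrable lborel g"
proof -
  obtain C where C: "\<And>x. \<bar>g x\<bar> \<le> C" using bounded_range_absE[OF g(2)] by blast
  obtain r where r: "B \<subseteq> cball 0 r" using B(1) bounded_subset_ballD[of B 0] ball_subset_cball by (metis order_trans)
  show ?thesis
  proof (rule integrableI_bounded_set[where A = "cball 0 r" and B = C])
    show "emeasure lborel (cball (0::'a) r) < \<infinity>" by (intro emeasure_bounded_finite) simp
    show "AE x in lborel. x \<in> cball 0 r \<longrightarrow> norm (g x) \<le> C" using C by simp
    show "AE x in lborel. x \<notin> cball 0 r \<longrightarrow> g x = 0" using B(2) r by (intro AE_I2) blast
    show "cball (0::'a) r \<in> sets lborel" by (simp add: borel_closed)
    show "g \<in> borel_measurable lborel" using g(1) by simp
  qed
qed

lemma lborel_Fubini: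
  fixes g :: "'a::euclidean_space \<times> 'b::euclidean_space \<Rightarrow> real"
  assumes "integrable lborel g"
  shows "(LINT x|lborel. LINT y|lborel. g (x, y)) = integral\<^sup>L lborel g"
    and "(LINT y|lborel. LINT x|lborel. g (x, y)) = integral\<^sup>L lborel g"
    and "integrable lborel (\<lambda>x. LINT y|lborel. g (x, y))"
    and "integrable lborel (\<lambda>y. LINT x|lborel. g (x, y))"
proof -
  have g: "integrable (lborel \<Otimes>\<^sub>M lborel) (case_prod (\<lambda>x y. g (x, y)))"
    using assms by (simp add: lborel_prod)
  show "(LINT x|lborel. LINT y|lborel. g (x, y)) = integral\<^sup>L lborel g"
    using lborel_pair.integral_fst[OF g] by (simp add: lborel_prod)
  show "(LINT y|lborel. LINT x|lborel. g (x, y)) = integral\<^sup>L lborel g"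
    using lborel_pair.integral_snd[OF g] by (simp add: lborel_prod)
  show "integrable lborel (\<lambda>x. LINT y|lborel. g (x, y))"
    using lborel_pair.integrable_fst[OF g] by simp
  show "integrable lborel (\<lambda>y. LINT x|lborel. g (x, y))"
    using lborel_pair.integrable_snd[OF g] by simp
qed

text \<open>An increment splits into a move in time at fixed \<open>b\<close> and a move in space,
  and continuity of \<open>Fx\<close> controls the latter uniformly near \<open>(a, b)\<close>.
  Derivatives are taken within \<open>A\<close> and \<open>B\<close> because the time interval is
  closed and its endpoints matter.\<close>

lemma C1_partials_has_derivative:
  fixes F Ft Fx :: "real \<Rightarrow> real \<Rightarrow> real"
  assumes t: "\<And>t x. t \<in> A \<Longrightarrow> x \<in> B \<Longrightarrow> ((\<lambda>s. F s x) has_real_derivative Ft t x) (at t within A)"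
    and x: "\<And>t x. t \<in> A \<Longrightarrow> x \<in> B \<Longrightarrow> (F t has_real_derivative Fx t x) (at x within B)"
    and cont: "continuous_on (A \<times> B) (\<lambda>z. Fx (fst z) (snd z))"
    and ab: "a \<in> A" "b \<in> B" and B: "convex B"
  shows "((\<lambda>z. F (fst z) (snd z)) has_derivative (\<lambda>h. Ft a b * fst h + Fx a b * snd h))
    (at (a, b) within A \<times> B)"
proof -
  have "((\<lambda>(x, y). F x y) has_derivative
      (\<lambda>(tx, ty). Ft a b * tx + blinfun_apply (blinfun_mult_right (Fx a b)) ty))
    (at (a, b) within A \<times> B)"
  proof (rule has_derivative_partialsI)
    show "((\<lambda>s. F s b) has_derivative (*) (Ft a b)) (at a within A)"
      using t[OF ab] by (simp add: has_field_derivative_def)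
    show "((\<lambda>y. F t y) has_derivative blinfun_apply (blinfun_mult_right (Fx t y))) (at y within B)"
      if "t \<in> A" "y \<in> B" for t y
      using x[OF that] by (simp add: has_field_derivative_def)
    have "continuous_on (A \<times> B) (\<lambda>z. blinfun_mult_right (Fx (fst z) (snd z)))"
      by (intro bounded_linear.continuous_on[OF bounded_linear_blinfun_mult_right] cont)
    then show "continuous (at (a, b) within A \<times> B) (\<lambda>(x, y). blinfun_mult_right (Fx x y))"
      using ab by (simp add: continuous_on_eq_continuous_within case_prod_beta')
  qed (use ab B in auto)
  then show ?thesis by (simp add: case_prod_beta')
qed

text \<open>Besides functions along particle paths, this covers functions of two times on the
  diagonal: take \<open>c\<close> to be the identity of the time interval.\<close>

lemma has_real_derivative_along_curve:
  fixes F Ft Fx :: "real \<Rightarrow> real \<Rightarrow> real"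
  assumes t: "\<And>t x. t \<in> A \<Longrightarrow> x \<in> B \<Longrightarrow> ((\<lambda>s. F s x) has_real_derivative Ft t x) (at t within A)"
    and x: "\<And>t x. t \<in> A \<Longrightarrow> x \<in> B \<Longrightarrow> (F t has_real_derivative Fx t x) (at x within B)"
    and cont: "continuous_on (A \<times> B) (\<lambda>z. Fx (fst z) (snd z))"
    and B: "convex B" and c: "\<And>s. s \<in> A \<Longrightarrow> c s \<in> B" "(c has_real_derivative c') (at s within A)" "s \<in> A"
  shows "((\<lambda>s. F s (c s)) has_real_derivative Ft s (c s) + c' * Fx s (c s)) (at s within A)"
proof -
  have F: "((\<lambda>z. F (fst z) (snd z)) has_derivative (\<lambda>h. Ft (fst z) (snd z) * fst h + Fx (fst z) (snd z) * snd h))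
      (at z within A \<times> B)" if "z \<in> A \<times> B" for z
    using C1_partials_has_derivative[OF t x cont _ _ B, of "fst z" "snd z"] that by (simp add: mem_Times_iff)
  have "((\<lambda>s. (s, c s)) has_derivative (\<lambda>h. (h, c' * h))) (at s within A)"
    using c(2) by (intro has_derivative_Pair has_derivative_ident) (simp add: has_field_derivative_def)
  from has_derivative_in_compose2[OF F _ c(3) this]
  have "((\<lambda>s. F s (c s)) has_derivative (\<lambda>h. Ft s (c s) * h + Fx s (c s) * (c' * h))) (at s within A)"
    using c(1) by (simp add: image_subset_iff)
  moreover have "(\<lambda>h. Ft s (c s) * h + Fx s (c s) * (c' * h)) = (*) (Ft s (c s) + c' * Fx s (c s))"
    by (rule ext) (simp add: algebra_simps)
  ultimately show ?thesis by (simp add: has_field_derivative_def)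
qed

text \<open>Test functions have to be C^1 only, so squared positive parts of explicit functions
  serve as cutoffs, both for the mollifier and for the cone.\<close>

lemma max_0_square_has_derivative:
  "((\<lambda>x::real. (max 0 x)\<^sup>2) has_real_derivative 2 * max 0 x) (at x)"
proof -
  consider "x > 0" | "x < 0" | "x = 0" by linarith
  then show ?thesis
  proof cases
    case 1
    have "((\<lambda>x::real. x\<^sup>2) has_real_derivative 2 * max 0 x) (at x)"
      using 1 by (auto intro!: derivative_eq_intros)
    then show ?thesis
      by (rule has_field_derivative_transform_within_open[where S = "{0<..}"]) (use 1 in auto)
  next
    case 2
    have "((\<lambda>x::real. 0) has_real_derivative 2 * max 0 x) (at x)"
      using 2 by (auto intro!: derivative_eq_intros)
    then show ?thesis
      by (rule has_field_derivative_transform_within_open[where S = "{..<0}"]) (use 2 in auto)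
  next
    case 3
    have "(\<lambda>h::real. (max 0 h)\<^sup>2 / h) \<midarrow>0\<rightarrow> 0"
    proof (rule Lim_null_comparison[where g = "\<lambda>h. \<bar>h\<bar>"])
      show "\<forall>\<^sub>F h::real in at 0. norm ((max 0 h)\<^sup>2 / h) \<le> \<bar>h\<bar>"
        by (rule always_eventually) (auto simp: max_def power2_eq_square)
      show "(abs \<longlongrightarrow> (0::real)) (at 0)"
        using tendsto_rabs_zero[OF tendsto_ident_at] by simp
    qed
    then show ?thesis using 3 by (simp add: DERIV_def)
  qed
qed

text \<open>The derivatives of \<open>\<phi>\<close> vanish in the interior of the region where
  \<open>\<phi>\<close> does. Enlarging \<open>R0\<close> by 1 and halving \<open>e0\<close> moves
  from the closed region of the definition into that interior; the maximum with 1 makes the radius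
  positive.\<close>

lemma test_fun_vanishes:
  assumes "test_fun T \<phi> \<phi>t \<phi>x"
  obtains R e where "R > 0" "e > 0"
    "\<And>t x. t \<ge> T - e \<or> t \<le> - R \<or> \<bar>x\<bar> \<ge> R \<Longrightarrow> \<phi> t x = 0 \<and> \<phi>t t x = 0 \<and> \<phi>x t x = 0"
proof -
  obtain R0 e0 where e0: "e0 > 0"
    and z: "\<And>t x. t \<ge> T - e0 \<or> t \<le> - R0 \<or> \<bar>x\<bar> \<ge> R0 \<Longrightarrow> \<phi> t x = 0"
    using assms unfolding test_fun_def by blast
  have D: "((\<lambda>s. \<phi> s x) has_real_derivative \<phi>t t x) (at t)" "(\<phi> t has_real_derivative \<phi>x t x) (at x)" for t x
    using assms unfolding test_fun_def by blast+
  have open_set: "open {y::real. R0 < \<bar>y\<bar>}"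
    by (intro open_Collect_less continuous_intros)
  have "\<phi> t x = 0 \<and> \<phi>t t x = 0 \<and> \<phi>x t x = 0" if "t > T - e0 \<or> t < - R0 \<or> \<bar>x\<bar> > R0" for t x
  proof -
    have t0: "\<phi>t t x = 0"
    proof (cases "\<bar>x\<bar> > R0")
      case True
      then show ?thesis using D(1)[of x t] z by (auto intro: DERIV_unique)
    next
      case False
      have "((\<lambda>s. 0) has_real_derivative \<phi>t t x) (at t)"
        by (rule has_field_derivative_transform_within_open[OF D(1), where S = "if t > T - e0 then {T - e0<..} else {..< - R0}"])
          (use that False z in \<open>auto split: if_splits\<close>)
      then show ?thesis by (auto intro: DERIV_unique)
    qed
    moreover have "\<phi>x t x = 0"
    proof (cases "\<bar>x\<bar> > R0")
      case False
      then have "\<phi> t = (\<lambda>y. 0)" using z that by fastforce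
      then show ?thesis using D(2)[of t x] by (auto intro: DERIV_unique)
    next
      case True
      have "((\<lambda>s. 0) has_real_derivative \<phi>x t x) (at x)"
        by (rule has_field_derivative_transform_within_open[OF D(2) open_set]) (use True z in auto)
      then show ?thesis by (auto intro: DERIV_unique)
    qed
    ultimately show ?thesis using z that by auto
  qed
  then show thesis
    using that[of "max 1 (R0 + 1)" "e0 / 2"] e0 by fastforce
qed

lemma test_fun_deriv:
  assumes "test_fun T \<phi> \<phi>t \<phi>x"
  shows "((\<lambda>s. \<phi> s x) has_real_derivative \<phi>t t x) (at t)"
    "(\<phi> t has_real_derivative \<phi>x t x) (at x)"
    "continuous_on UNIV (\<lambda>z. \<phi>t (fst z) (snd z))"
    "continuous_on UNIV (\<lambda>z. \<phi>x (fst z) (snd z))"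
  using assms unfolding test_fun_def by blast+

lemma test_fun_has_derivative:
  assumes "test_fun T \<phi> \<phi>t \<phi>x"
  shows "((\<lambda>z. \<phi> (fst z) (snd z)) has_derivative (\<lambda>h. \<phi>t t x * fst h + \<phi>x t x * snd h)) (at (t, x))"
  using C1_partials_has_derivative[of UNIV UNIV \<phi> \<phi>t \<phi>x t x] test_fun_deriv[OF assms] by simp

lemma test_fun_continuous:
  assumes "test_fun T \<phi> \<phi>t \<phi>x"
  shows "continuous_on UNIV (\<lambda>z. \<phi> (fst z) (snd z))"
proof (intro continuous_at_imp_continuous_on ballI)
  show "isCont (\<lambda>z. \<phi> (fst z) (snd z)) z" for z
    using has_derivative_continuous[OF test_fun_has_derivative[OF assms, of "fst z" "snd z"]] by simp
qed

lemma test_fun_support_bounded: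
  assumes "test_fun T \<phi> \<phi>t \<phi>x"
  obtains B where "bounded B"
    "\<And>z. z \<notin> B \<Longrightarrow> \<phi> (fst z) (snd z) = 0 \<and> \<phi>t (fst z) (snd z) = 0 \<and> \<phi>x (fst z) (snd z) = 0"
proof -
  obtain R e where R: "R > 0" "e > 0"
    "\<And>t x. t \<ge> T - e \<or> t \<le> - R \<or> \<bar>x\<bar> \<ge> R \<Longrightarrow> \<phi> t x = 0 \<and> \<phi>t t x = 0 \<and> \<phi>x t x = 0"
    using test_fun_vanishes[OF assms] by blast
  show thesis
  proof
    show "bounded ({-R..T} \<times> {-R..R})" by (intro bounded_Times) auto
    fix z :: "real \<times> real" assume "z \<notin> {-R..T} \<times> {-R..R}"
    then have "fst z \<ge> T - e \<or> fst z \<le> - R \<or> \<bar>snd z\<bar> \<ge> R"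
      using R(2) by (cases z) auto
    then show "\<phi> (fst z) (snd z) = 0 \<and> \<phi>t (fst z) (snd z) = 0 \<and> \<phi>x (fst z) (snd z) = 0"
      using R(3) by blast
  qed
qed

lemma test_fun_bounded:
  assumes "test_fun T \<phi> \<phi>t \<phi>x"
  shows "bounded (range (\<lambda>z. \<phi> (fst z) (snd z)))" "bounded (range (\<lambda>z. \<phi>t (fst z) (snd z)))"
    "bounded (range (\<lambda>z. \<phi>x (fst z) (snd z)))"
proof -
  obtain B where B: "bounded B"
    "\<And>z. z \<notin> B \<Longrightarrow> \<phi> (fst z) (snd z) = 0 \<and> \<phi>t (fst z) (snd z) = 0 \<and> \<phi>x (fst z) (snd z) = 0"
    using test_fun_support_bounded[OF assms] by blast
  show "bounded (range (\<lambda>z. \<phi> (fst z) (snd z)))"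
    by (rule continuous_bounded_support_bounded_range[OF test_fun_continuous[OF assms] B(1)]) (use B in auto)
  show "bounded (range (\<lambda>z. \<phi>t (fst z) (snd z)))"
    by (rule continuous_bounded_support_bounded_range[OF test_fun_deriv(3)[OF assms] B(1)]) (use B in auto)
  show "bounded (range (\<lambda>z. \<phi>x (fst z) (snd z)))"
    by (rule continuous_bounded_support_bounded_range[OF test_fun_deriv(4)[OF assms] B(1)]) (use B in auto)
qed

lemma test_fun_measurable:
  assumes "test_fun T \<phi> \<phi>t \<phi>x"
  shows "(\<lambda>z. \<phi> (fst z) (snd z)) \<in> borel_measurable borel"
    "(\<lambda>z. \<phi>t (fst z) (snd z)) \<in> borel_measurable borel"
    "(\<lambda>z. \<phi>x (fst z) (snd z)) \<in> borel_measurable borel"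
  by (rule borel_measurable_continuous_onI[OF test_fun_continuous[OF assms]]
      borel_measurable_continuous_onI[OF test_fun_deriv(3)[OF assms]]
      borel_measurable_continuous_onI[OF test_fun_deriv(4)[OF assms]])+

text \<open>Turns the set integrals over the open strip into integrals over the plane with an extra
  factor, so that restricting two points to the strip at once is a product of two factors.\<close>

definition time_strip :: "real \<Rightarrow> real \<times> real \<Rightarrow> real" where
  "time_strip T = indicator ({0<..<T} \<times> UNIV)"

lemma time_strip_measurable [measurable]: "time_strip T \<in> borel_measurable borel"
  unfolding time_strip_def
  by (intro borel_measurable_indicator borel_open open_Times) auto

section \<open>Potentials, entropies and shocks\<close>

text \<open>Gronwall in both time directions: as \<open>2 * \<bar>d * d'\<bar>\<close> is at most
  \<open>2 * C * d\<^sup>2\<close>, the function \<open>d\<^sup>2 * exp (2 * C * t)\<close> is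
  nondecreasing and \<open>d\<^sup>2 * exp (- 2 * C * t)\<close> nonincreasing. The factor
  \<open>sgn c\<close> turns both into one monotonicity claim.\<close>

lemma linear_growth_zero_persists:
  fixes d d' :: "real \<Rightarrow> real"
  assumes der: "\<And>t. t \<in> {0..T} \<Longrightarrow> (d has_real_derivative d' t) (at t within {0..T})"
    and growth: "\<And>t. t \<in> {0..T} \<Longrightarrow> \<bar>d' t\<bar> \<le> C * \<bar>d t\<bar>"
    and s: "s \<in> {0..T}" "d s = 0" and t: "t \<in> {0..T}"
  shows "d t = 0"
proof -
  have cont: "continuous_on {0..T} d"
    using der by (meson DERIV_continuous continuous_on_eq_continuous_within)
  have mono: "(d a)\<^sup>2 * exp (c * a) * sgn c \<le> (d b)\<^sup>2 * exp (c * b) * sgn c"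
    if ab: "a \<in> {0..T}" "b \<in> {0..T}" "a \<le> b" and c: "c = 2 * C \<or> c = - 2 * C" and C: "C > 0" for a b c
  proof (rule DERIV_nonneg_imp_increasing_open[OF \<open>a \<le> b\<close>])
    fix x assume x: "a < x" "x < b"
    have "0 < x" "x < T" using x ab by simp_all
    then have x': "x \<in> {0..T}" and D: "(d has_real_derivative d' x) (at x)"
      using der[of x] by (simp_all add: at_within_Icc_at)
    have "\<bar>d x * d' x\<bar> \<le> C * (d x)\<^sup>2"
      using mult_left_mono[OF growth[OF x'], of "\<bar>d x\<bar>"]
      by (simp add: abs_mult power2_eq_square mult.left_commute)
    then have "0 \<le> (2 * (d x * d' x) + c * (d x)\<^sup>2) * sgn c"
      using c C by (auto simp: abs_le_iff)
    then have "0 \<le> ((2 * (d x * d' x) + c * (d x)\<^sup>2) * sgn c) * exp (c * x)"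
      by (rule mult_nonneg_nonneg) simp
    moreover have "((\<lambda>x. (d x)\<^sup>2 * exp (c * x) * sgn c) has_real_derivative
        ((2 * (d x * d' x) + c * (d x)\<^sup>2) * sgn c) * exp (c * x)) (at x)"
      by (auto intro!: derivative_eq_intros D simp: algebra_simps)
    ultimately show "\<exists>y. ((\<lambda>x. (d x)\<^sup>2 * exp (c * x) * sgn c) has_real_derivative y) (at x) \<and> 0 \<le> y"
      by blast
  next
    show "continuous_on {a..b} (\<lambda>x. (d x)\<^sup>2 * exp (c * x) * sgn c)"
      using ab by (intro continuous_intros continuous_on_subset[OF cont]) auto
  qed
  show ?thesis
  proof (cases "C > 0")
    case True
    show ?thesis
    proof (cases "s \<le> t")
      case le: True
      have "(d t)\<^sup>2 * exp (- 2 * C * t) \<le> 0"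
        using mono[OF s(1) t le, of "- 2 * C"] s(2) True by simp
      then show ?thesis by (simp add: mult_le_0_iff)
    next
      case False
      have "(d t)\<^sup>2 * exp (2 * C * t) \<le> 0"
        using mono[OF t s(1), of "2 * C"] s(2) True False by simp
      then show ?thesis by (simp add: mult_le_0_iff)
    qed
  next
    \<comment> \<open>For \<open>C \<le> 0\<close> the bound forces \<open>d' = 0\<close>, so
      \<open>d\<close> is constant.\<close>
    case False
    have "d' t = 0" if "t \<in> {0..T}" for t
      using growth[OF that] mult_nonpos_nonneg[of C "\<bar>d t\<bar>"] False by simp
    then have "(d has_real_derivative 0) (at t within {0..T})" if "t \<in> {0..T}" for t
      using der that by metis
    then obtain c where "\<forall>t\<in>{0..T}. d t = c"
      using has_field_derivative_zero_constant[of "{0..T}" d] by (auto simp: convex_closed_interval)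
    then show ?thesis using s t by metis
  qed
qed

lemma stepwise_increasing_less:
  fixes a :: "nat \<Rightarrow> real"
  assumes step: "\<And>i. 1 \<le> i \<Longrightarrow> i < n \<Longrightarrow> a i < a (Suc i)" and i: "1 \<le> i" "i < j" and j: "j \<le> n"
  shows "a i < a j"
  using i(2) j
proof (induction j)
  case (Suc j)
  then show ?case using step[of j] i(1) by (cases "i = j") (auto intro: less_trans)
qed simp

lemma continuous_has_antiderivative:
  fixes h :: "real \<Rightarrow> real"
  assumes "continuous_on UNIV h"
  obtains H where "\<And>z. (H has_real_derivative h z) (at z)"
proof
  define H where "H z = (if 0 \<le> z then integral {0..z} h else - integral {z..0} h)" for z
  have int: "h integrable_on {a..b}" for a b
    using assms by (auto intro!: integrable_continuous_interval intro: continuous_on_subset)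
  \<comment> \<open>With a base point \<open>a\<close> to the left of both 0 and \<open>z\<close>,
    one formula holds on both sides of 0, where the definition of \<open>H\<close> switches.\<close>
  have H: "H y = integral {a..y} h - integral {a..0} h" if "a < 0" "a < y" for a y
    using that Henstock_Kurzweil_Integration.integral_combine[OF _ _ int, of a 0 y]
      Henstock_Kurzweil_Integration.integral_combine[OF _ _ int, of a y 0]
    by (auto simp: H_def)
  show "(H has_real_derivative h z) (at z)" for z
  proof -
    define a b where "a = - \<bar>z\<bar> - 1" and "b = \<bar>z\<bar> + 1"
    have z: "z \<in> {a<..<b}" "a < 0" by (auto simp: a_def b_def)
    have "((\<lambda>y. integral {a..y} h) has_vector_derivative h z) (at z within {a..b})"
      using z by (intro integral_has_vector_derivative continuous_on_subset[OF assms]) auto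
    then have "((\<lambda>y. integral {a..y} h) has_real_derivative h z) (at z)"
      using z by (simp add: has_real_derivative_iff_has_vector_derivative at_within_Icc_at)
    then have "((\<lambda>y. integral {a..y} h - integral {a..0} h) has_real_derivative h z) (at z)"
      by (auto intro!: derivative_eq_intros)
    then show ?thesis
      by (rule has_field_derivative_transform_within_open[where S = "{a<..<b}"])
        (use z H in auto)
  qed
qed

text \<open>Where the slope \<open>\<beta>\<close> vanishes it vanishes for all times; otherwise \<open>H(W)/\<beta>\<close> is a potential.\<close>

lemma affine_burgers_potential:
  fixes \<alpha> \<beta> h H :: "real \<Rightarrow> real"
  assumes \<alpha>: "\<And>t. t \<in> {0..T} \<Longrightarrow> (\<alpha> has_real_derivative - \<alpha> t * \<beta> t) (at t within {0..T})"
    and \<beta>: "\<And>t. t \<in> {0..T} \<Longrightarrow> (\<beta> has_real_derivative - (\<beta> t)\<^sup>2) (at t within {0..T})"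
    and H: "\<And>z. (H has_real_derivative h z) (at z)"
  obtains \<Phi> where
    "\<And>t x. t \<in> {0..T} \<Longrightarrow> ((\<lambda>s. \<Phi> s x) has_real_derivative
        H (\<alpha> t + \<beta> t * x) - (\<alpha> t + \<beta> t * x) * h (\<alpha> t + \<beta> t * x)) (at t within {0..T})"
    "\<And>t x. t \<in> {0..T} \<Longrightarrow> (\<Phi> t has_real_derivative h (\<alpha> t + \<beta> t * x)) (at x)"
proof (cases "\<exists>s\<in>{0..T}. \<beta> s = 0")
  case True
  then obtain s where s: "s \<in> {0..T}" "\<beta> s = 0" by blast
  have "continuous_on {0..T} \<beta>"
    using \<beta> by (meson DERIV_continuous continuous_on_eq_continuous_within)
  then have "bounded (\<beta> ` {0..T})"
    by (intro compact_imp_bounded compact_continuous_image) auto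
  then obtain C where "\<forall>y\<in>\<beta> ` {0..T}. norm y \<le> C"
    unfolding bounded_iff by blast
  then have C: "\<bar>\<beta> t\<bar> \<le> C" if "t \<in> {0..T}" for t
    using that by auto
  \<comment> \<open>The Riccati equation is read as a linear equation for \<open>\<beta>\<close>
    with the bounded coefficient \<open>- \<beta>\<close>; this makes a zero of the slope
    persist.\<close>
  have "\<bar>- (\<beta> t)\<^sup>2\<bar> \<le> C * \<bar>\<beta> t\<bar>" if "t \<in> {0..T}" for t
  proof -
    have "\<bar>- (\<beta> t)\<^sup>2\<bar> = \<bar>\<beta> t\<bar> * \<bar>\<beta> t\<bar>" by (simp add: power2_eq_square)
    also have "\<dots> \<le> C * \<bar>\<beta> t\<bar>" using C[OF that] by (intro mult_right_mono) auto
    finally show ?thesis .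
  qed
  from linear_growth_zero_persists[OF \<beta> this s]
  have \<beta>0: "\<beta> t = 0" if "t \<in> {0..T}" for t using that by blast
  then have "(\<alpha> has_real_derivative 0) (at t within {0..T})" if "t \<in> {0..T}" for t
    using \<alpha>[OF that] that by simp
  then obtain a where a: "\<alpha> t = a" if "t \<in> {0..T}" for t
    using has_field_derivative_zero_constant[of "{0..T}" \<alpha>] by (auto simp: convex_closed_interval)
  \<comment> \<open>The state is a constant \<open>a\<close>, so a potential affine in both
    variables has the required derivatives.\<close>
  show ?thesis
    by (rule that[of "\<lambda>t x. h a * x + (H a - a * h a) * t"])
      (auto intro!: derivative_eq_intros simp: \<beta>0 a)
next
  case False
  show ?thesis
  proof (rule that[of "\<lambda>t x. H (\<alpha> t + \<beta> t * x) / \<beta> t"])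
    fix t x assume t: "t \<in> {0..T}"
    then have nz: "\<beta> t \<noteq> 0" using False by blast
    have "((\<lambda>s. \<alpha> s + \<beta> s * x) has_real_derivative - \<alpha> t * \<beta> t - (\<beta> t)\<^sup>2 * x) (at t within {0..T})"
      by (auto intro!: derivative_eq_intros \<alpha>[OF t] \<beta>[OF t])
    then have "((\<lambda>s. H (\<alpha> s + \<beta> s * x)) has_real_derivative
        h (\<alpha> t + \<beta> t * x) * (- \<alpha> t * \<beta> t - (\<beta> t)\<^sup>2 * x)) (at t within {0..T})"
      by (rule DERIV_chain2[OF H])
    then show "((\<lambda>s. H (\<alpha> s + \<beta> s * x) / \<beta> s) has_real_derivative
        H (\<alpha> t + \<beta> t * x) - (\<alpha> t + \<beta> t * x) * h (\<alpha> t + \<beta> t * x)) (at t within {0..T})"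
      using nz
      by (auto intro!: derivative_eq_intros \<beta>[OF t] simp: field_simps power2_eq_square)
    show "((\<lambda>y. H (\<alpha> t + \<beta> t * y) / \<beta> t) has_real_derivative h (\<alpha> t + \<beta> t * x)) (at x)"
      using nz by (auto intro!: derivative_eq_intros DERIV_chain2[OF H] simp: field_simps)
  qed
qed

text \<open>\<open>H\<close> is the Legendre-type primitive: differentiating \<open>H(f'(w)) - (f'(w) \<eta>(w) - q(w))\<close> with
  \<open>q' = \<eta>' f'\<close> gives \<open>0\<close>, so that no regularity of the inverse of \<open>f'\<close> is needed.\<close>

lemma entropy_flux_legendre:
  fixes df ddf \<eta> \<eta>' q h :: "real \<Rightarrow> real"
  assumes df: "\<And>u. (df has_real_derivative ddf u) (at u)"
    and \<eta>: "\<And>w. w \<noteq> k \<Longrightarrow> (\<eta> has_real_derivative \<eta>' w) (at w)" "continuous_on UNIV \<eta>"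
    and q: "\<And>w. w \<noteq> k \<Longrightarrow> (q has_real_derivative \<eta>' w * df w) (at w)" "continuous_on UNIV q"
    and h: "continuous_on UNIV h" "\<And>w. w \<in> {c..d} \<Longrightarrow> h (df w) = \<eta> w"
    and cd: "c \<le> d"
  obtains H where "\<And>z. (H has_real_derivative h z) (at z)"
    "\<And>w. w \<in> {c..d} \<Longrightarrow> df w * h (df w) - H (df w) = q w"
proof -
  obtain H0 where H0: "\<And>z. (H0 has_real_derivative h z) (at z)"
    using continuous_has_antiderivative[OF h(1)] by blast
  define G where "G w = H0 (df w) - (df w * \<eta> w - q w)" for w
  have cdf: "continuous_on UNIV df" and cH0: "continuous_on UNIV H0"
    using df H0 by (meson DERIV_continuous_on has_field_derivative_at_within)+
  \<comment> \<open>The entropy may have a kink at \<open>k\<close>; a continuous function whose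
    derivative vanishes off a finite set is still constant.\<close>
  have "G w = G c" if "w \<in> {c..d}" for w
  proof (rule has_derivative_zero_unique_strong_interval[where k = "{k}", OF _ _ refl _ that])
    show "continuous_on {c..d} G"
      unfolding G_def
      by (intro continuous_intros continuous_on_subset[OF cdf] continuous_on_subset[OF \<eta>(2)]
          continuous_on_subset[OF q(2)] continuous_on_compose2[OF cH0]) auto
    fix x assume x: "x \<in> {c..d} - {k}"
    then have k: "x \<noteq> k" by auto
    have "(G has_real_derivative h (df x) * ddf x - (ddf x * \<eta> x + df x * \<eta>' x - \<eta>' x * df x)) (at x)"
      unfolding G_def
      by (auto intro!: derivative_eq_intros DERIV_chain2[OF H0 df] df \<eta>(1)[OF k] q(1)[OF k])
    moreover have "h (df x) = \<eta> x" using x h(2) by auto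
    ultimately have "(G has_real_derivative 0) (at x)" by simp
    then show "(G has_derivative (\<lambda>h. 0)) (at x within {c..d})"
      by (auto simp: has_field_derivative_def lambda_zero intro: has_derivative_at_withinI)
  qed simp
  then have "df w * h (df w) - (H0 (df w) - G c) = q w" if "w \<in> {c..d}" for w
    using that h(2)[OF that] by (simp add: G_def algebra_simps)
  moreover have "((\<lambda>z. H0 z - G c) has_real_derivative h z) (at z)" for z
    by (auto intro!: derivative_eq_intros H0)
  ultimately show thesis using that[of "\<lambda>z. H0 z - G c"] by blast
qed

section \<open>Kruzkov entropy pairs and entropy production at a shock\<close>

definition kruzkov_flux :: "(real \<Rightarrow> real) \<Rightarrow> real \<Rightarrow> real \<Rightarrow> real" where
  "kruzkov_flux f u k = sgn (u - k) * (f u - f k)"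

lemma kruzkov_flux_has_derivative:
  fixes f df :: "real \<Rightarrow> real"
  assumes f: "\<And>u. (f has_real_derivative df u) (at u)" and w: "w \<noteq> k"
  shows "((\<lambda>w. kruzkov_flux f w k) has_real_derivative sgn (w - k) * df w) (at w)"
proof -
  have "((\<lambda>x. sgn (w - k) * (f x - f k)) has_real_derivative sgn (w - k) * df w) (at w)"
    by (auto intro!: derivative_eq_intros f)
  moreover have "open (if w > k then {k<..} else {..<k})" by auto
  ultimately show ?thesis
    by (rule has_field_derivative_transform_within_open) (use w in \<open>auto simp: kruzkov_flux_def sgn_if\<close>)
qed

lemma kruzkov_flux_continuous:
  fixes f :: "real \<Rightarrow> real"
  assumes f: "continuous_on UNIV f"
  shows "continuous_on UNIV (\<lambda>w. kruzkov_flux f w k)"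
proof -
  have "kruzkov_flux f w k = (if w \<le> k then f k - f w else f w - f k)" for w
    by (auto simp: kruzkov_flux_def sgn_if)
  moreover have "continuous_on ({..k} \<union> {k..}) (\<lambda>w. if w \<le> k then f k - f w else f w - f k)"
    by (intro continuous_on_If continuous_intros continuous_on_subset[OF f]) auto
  moreover have "{..k} \<union> {k..} = UNIV" by auto
  ultimately show ?thesis by simp
qed

lemma secant_slope_eq_deriv:
  fixes f df :: "real \<Rightarrow> real"
  assumes f: "\<And>u. (f has_real_derivative df u) (at u)"
  obtains \<xi> where "min p r \<le> \<xi>" "\<xi> \<le> max p r" "shock_speed f df p r = df \<xi>"
proof (cases "p = r")
  case True
  then show ?thesis using that[of p] by (simp add: shock_speed_def)
next
  case False
  define a b where "a = min p r" and "b = max p r"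
  have "a < b" using False by (auto simp: a_def b_def)
  then obtain z where z: "z > a" "z < b" "f b - f a = (b - a) * df z"
    using MVT2[of a b f df] f by blast
  have "shock_speed f df p r = (f b - f a) / (b - a)"
    using False by (auto simp: shock_speed_def a_def b_def min_def max_def field_simps)
  also have "\<dots> = df z" using z by simp
  finally show ?thesis using that[of z] z by (auto simp: a_def b_def)
qed

lemma shock_speed_commute: "shock_speed f df p r = shock_speed f df r p"
  by (auto simp: shock_speed_def field_simps)

lemma strict_antimono_on_imp_antimono_on:
  "antimono_on A f" if "strict_antimono_on A f" for f :: "'a::order \<Rightarrow> 'b::order"
  using that unfolding monotone_on_def by (metis order_le_less)

text \<open>The secant slope is a value of \<open>df\<close> between the two states, so by
  monotonicity it lies between \<open>df p\<close> and \<open>df r\<close>. In this form it bounds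
  the relative speed at a particle by the jump of the characteristic speed.\<close>

lemma shock_speed_between:
  fixes f df :: "real \<Rightarrow> real"
  assumes f: "\<And>u. (f has_real_derivative df u) (at u)"
    and I: "is_interval I" "p \<in> I" "r \<in> I"
    and mono: "strict_mono_on I df \<or> strict_antimono_on I df"
  shows "\<bar>shock_speed f df p r - df p\<bar> \<le> \<bar>df p - df r\<bar>"
proof -
  obtain \<xi> where \<xi>: "min p r \<le> \<xi>" "\<xi> \<le> max p r" "shock_speed f df p r = df \<xi>"
    using secant_slope_eq_deriv[OF f] by blast
  have \<xi>I: "\<xi> \<in> I"
    using I \<xi> unfolding is_interval_1 by (smt (verit) max_def min_def)
  have "mono_on I df \<or> antimono_on I df"
    using mono strict_mono_on_imp_mono_on strict_antimono_on_imp_antimono_on by blast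
  then have "min (df p) (df r) \<le> df \<xi> \<and> df \<xi> \<le> max (df p) (df r)"
    using \<xi> \<xi>I I(2,3) unfolding monotone_on_def by (smt (verit))
  then show ?thesis using \<xi>(3) by auto
qed

text \<open>The mean slopes of \<open>f\<close> on the two sides of \<open>k\<close> are values of
  the nondecreasing \<open>df\<close>, hence ordered; cross-multiplication gives the convexity
  inequality for the chord.\<close>

lemma chord_above:
  fixes f df :: "real \<Rightarrow> real"
  assumes f: "\<And>u. (f has_real_derivative df u) (at u)"
    and mono: "mono_on {p..r} df" and k: "p < k" "k < r"
  shows "f k - f p \<le> shock_speed f df p r * (k - p)"
proof -
  obtain a where a: "a > p" "a < k" "f k - f p = (k - p) * df a" using MVT2[OF k(1), of f df] f by blast
  obtain b where b: "b > k" "b < r" "f r - f k = (r - k) * df b" using MVT2[OF k(2), of f df] f by blast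
  have "df a \<le> df b" using mono a b by (auto simp: monotone_on_def)
  then have "(k - p) * (r - k) * df a \<le> (k - p) * (r - k) * df b"
    using k by (intro mult_left_mono) auto
  moreover have "(f k - f p) * (r - k) = (k - p) * (r - k) * df a" using a(3) by simp
  moreover have "(f r - f k) * (k - p) = (k - p) * (r - k) * df b" using b(3) by simp
  ultimately have "(f k - f p) * (r - k) \<le> (f r - f k) * (k - p)" by argo
  then have "(f k - f p) * (r - p) \<le> (f r - f p) * (k - p)" by (simp add: algebra_simps)
  then have "f k - f p \<le> (f r - f p) / (r - p) * (k - p)"
    using k by (simp add: field_simps)
  moreover have "shock_speed f df p r = (f r - f p) / (r - p)"
    using k by (auto simp: shock_speed_def field_simps)
  ultimately show ?thesis by simp
qed

lemma chord_below:
  fixes f df :: "real \<Rightarrow> real"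
  assumes f: "\<And>u. (f has_real_derivative df u) (at u)"
    and mono: "antimono_on {p..r} df" and k: "p < k" "k < r"
  shows "shock_speed f df p r * (k - p) \<le> f k - f p"
proof -
  have "(-f k) - (-f p) \<le> shock_speed (\<lambda>u. - f u) (\<lambda>u. - df u) p r * (k - p)"
    by (rule chord_above) (use f mono k in \<open>auto intro!: derivative_eq_intros simp: monotone_on_def\<close>)
  moreover have "shock_speed (\<lambda>u. - f u) (\<lambda>u. - df u) p r = - shock_speed f df p r"
    using k by (simp add: shock_speed_def field_simps)
  ultimately show ?thesis by simp
qed

text \<open>Here \<open>p\<close> is the left and \<open>r\<close> the right state. If
  \<open>k\<close> does not separate them, the entropy differs from \<open>u\<close> or
  \<open>- u\<close> by a constant and Rankine-Hugoniot gives 0. If \<open>k\<close> separates them,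
  Oleinik's condition forces \<open>r < p\<close> in the convex and \<open>p < r\<close> in the
  concave case, and the expression is twice the gap between \<open>f\<close> and its chord at
  \<open>k\<close>.\<close>

lemma shock_entropy_production_nonneg:
  fixes f df :: "real \<Rightarrow> real"
  assumes f: "\<And>u. (f has_real_derivative df u) (at u)"
    and I: "is_interval I" "p \<in> I" "r \<in> I"
    and mono: "strict_mono_on I df \<or> strict_antimono_on I df"
    and oleinik: "df r \<le> df p"
  shows "0 \<le> shock_speed f df p r * (\<bar>r - k\<bar> - \<bar>p - k\<bar>) - (kruzkov_flux f r k - kruzkov_flux f p k)"
proof -
  define S where "S = shock_speed f df p r"
  have RH: "S * (r - p) = f r - f p"
    by (simp add: S_def shock_speed_def divide_simps) (simp add: algebra_simps)
  have sub: "{a..b} \<subseteq> I" if "a \<in> I" "b \<in> I" for a b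
    using I(1) that unfolding is_interval_1 by (meson atLeastAtMost_iff subsetI)
  consider "min p r < k" "k < max p r" | "k \<le> min p r" | "max p r \<le> k" by linarith
  then show ?thesis
  proof cases
    case 1
    from mono show ?thesis
    proof
      assume m: "strict_mono_on I df"
      then have "r < p"
        using oleinik I(2,3) 1 strict_mono_onD[OF m, of p r] by (smt (verit))
      then have k: "r < k" "k < p" using 1 by auto
      have "mono_on {r..p} df"
        using strict_mono_on_imp_mono_on[OF m] sub[OF I(3,2)] monotone_on_subset by blast
      from chord_above[OF f this k] have "f k - f r \<le> S * (k - r)"
        by (simp add: S_def shock_speed_commute)
      then show ?thesis unfolding S_def[symmetric] using k RH
        by (simp add: kruzkov_flux_def algebra_simps)
    next
      assume m: "strict_antimono_on I df"
      then have "p < r"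
        using oleinik I(2,3) 1 monotone_onD[OF m, of r p] by (smt (verit))
      then have k: "p < k" "k < r" using 1 by auto
      have "antimono_on {p..r} df"
        using strict_antimono_on_imp_antimono_on[OF m] sub[OF I(2,3)] monotone_on_subset by blast
      from chord_below[OF f this k] have "S * (k - p) \<le> f k - f p"
        by (simp add: S_def)
      then show ?thesis unfolding S_def[symmetric] using k RH
        by (simp add: kruzkov_flux_def algebra_simps)
    qed
  next
    case 2
    then have "\<bar>r - k\<bar> - \<bar>p - k\<bar> = r - p" "kruzkov_flux f r k - kruzkov_flux f p k = f r - f p"
      by (auto simp: kruzkov_flux_def sgn_if)
    then show ?thesis unfolding S_def[symmetric] using RH by simp
  next
    case 3
    then have "\<bar>r - k\<bar> - \<bar>p - k\<bar> = p - r" "kruzkov_flux f r k - kruzkov_flux f p k = f p - f r"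
      by (auto simp: kruzkov_flux_def sgn_if)
    then show ?thesis unfolding S_def[symmetric] using RH
      by (metis (no_types, opaque_lifting) diff_self eq_refl minus_diff_eq mult_minus_right)
  qed
qed

section \<open>Uniqueness by doubling of variables\<close>

text \<open>The integral of \<open>x\<^sup>2 * (\<epsilon> - x)\<^sup>2\<close> over
  \<open>[0, \<epsilon>]\<close> is \<open>\<epsilon> ^ 5 / 30\<close>, whence the factor. The
  support lies on the positive side of 0, which makes the mollifier one-sided.\<close>

definition bump :: "real \<Rightarrow> real \<Rightarrow> real" where
  "bump \<epsilon> x = 30 / \<epsilon> ^ 5 * (max 0 (x * (\<epsilon> - x)))\<^sup>2"

definition bump' :: "real \<Rightarrow> real \<Rightarrow> real" where
  "bump' \<epsilon> x = 60 / \<epsilon> ^ 5 * max 0 (x * (\<epsilon> - x)) * (\<epsilon> - 2 * x)"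

lemma bump_has_derivative: "(bump \<epsilon> has_real_derivative bump' \<epsilon> x) (at x)"
proof -
  have "((\<lambda>x. x * (\<epsilon> - x)) has_real_derivative \<epsilon> - 2 * x) (at x)"
    by (auto intro!: derivative_eq_intros)
  from DERIV_chain2[OF max_0_square_has_derivative this]
  have "((\<lambda>x. (max 0 (x * (\<epsilon> - x)))\<^sup>2) has_real_derivative 2 * max 0 (x * (\<epsilon> - x)) * (\<epsilon> - 2 * x)) (at x)" .
  from DERIV_cmult[OF this, of "30 / \<epsilon> ^ 5"] show ?thesis
    by (simp add: bump_def[abs_def] bump'_def mult.assoc)
qed

lemma bump_continuous: "continuous_on UNIV (bump \<epsilon>)" "continuous_on UNIV (bump' \<epsilon>)"
  unfolding bump_def[abs_def] bump'_def[abs_def] by (intro continuous_intros)+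

lemma bump_nonneg: "0 < \<epsilon> \<Longrightarrow> 0 \<le> bump \<epsilon> x"
  by (simp add: bump_def)

lemma bump_eq_0:
  assumes "0 < \<epsilon>" "x \<le> 0 \<or> \<epsilon> \<le> x"
  shows "bump \<epsilon> x = 0" "bump' \<epsilon> x = 0"
proof -
  have "x * (\<epsilon> - x) \<le> 0"
    using assms by (auto intro: mult_nonpos_nonneg mult_nonneg_nonpos)
  then show "bump \<epsilon> x = 0" "bump' \<epsilon> x = 0" by (simp_all add: bump_def bump'_def max_def)
qed

lemma bump_bounded:
  assumes "0 < \<epsilon>"
  shows "bounded (range (bump \<epsilon>))" "bounded (range (bump' \<epsilon>))"
proof -
  show "bounded (range (bump \<epsilon>))"
    by (rule continuous_bounded_support_bounded_range[where B = "{0..\<epsilon>}", OF bump_continuous(1)])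
      (auto intro: bump_eq_0[OF assms])
  show "bounded (range (bump' \<epsilon>))"
    by (rule continuous_bounded_support_bounded_range[where B = "{0..\<epsilon>}", OF bump_continuous(2)])
      (auto intro: bump_eq_0[OF assms])
qed

lemma bump_measurable [measurable]: "bump \<epsilon> \<in> borel_measurable borel" "bump' \<epsilon> \<in> borel_measurable borel"
  by (rule borel_measurable_continuous_onI[OF bump_continuous(1)]
      borel_measurable_continuous_onI[OF bump_continuous(2)])+

lemma bump_integral:
  assumes \<epsilon>: "0 < \<epsilon>"
  shows "(LINT x|lborel. bump \<epsilon> x) = 1"
proof -
  define F where "F x = 30 / \<epsilon> ^ 5 * (\<epsilon>\<^sup>2 * x ^ 3 / 3 - \<epsilon> * x ^ 4 / 2 + x ^ 5 / 5)" for x :: real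
  have "(LINT x|lborel. bump \<epsilon> x * indicator {0..\<epsilon>} x) = F \<epsilon> - F 0"
  proof (rule integral_FTC_Icc_real)
    fix x assume x: "0 \<le> x" "x \<le> \<epsilon>"
    have "((\<lambda>x. \<epsilon>\<^sup>2 * x ^ 3 / 3 - \<epsilon> * x ^ 4 / 2 + x ^ 5 / 5) has_real_derivative (x * (\<epsilon> - x))\<^sup>2) (at x)"
      by (auto intro!: derivative_eq_intros simp: eval_nat_numeral algebra_simps)
    then have "(F has_real_derivative 30 / \<epsilon> ^ 5 * (x * (\<epsilon> - x))\<^sup>2) (at x)"
      unfolding F_def by (rule DERIV_cmult)
    then show "(F has_real_derivative bump \<epsilon> x) (at x)"
      using x by (simp add: bump_def max_def)
    show "isCont (bump \<epsilon>) x"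
      using bump_continuous(1) by (simp add: continuous_on_eq_continuous_at)
  qed (use \<epsilon> in simp)
  moreover have "bump \<epsilon> x * indicator {0..\<epsilon>} x = bump \<epsilon> x" for x
    using bump_eq_0(1)[OF \<epsilon>, of x]
    by (cases "x \<le> 0 \<or> \<epsilon> \<le> x") (auto simp: indicator_def not_le)
  moreover have "F \<epsilon> - F 0 = 1"
    using \<epsilon> by (simp add: F_def field_simps eval_nat_numeral)
  ultimately show ?thesis by simp
qed

text \<open>The kernel lives in the open quadrant to the upper right of \<open>z\<close>: as a function of \<open>w\<close> it
  vanishes at time \<open>0\<close>, so only one of the two entropy inequalities contributes an initial term.\<close>

definition quadrant_kernel :: "real \<Rightarrow> real \<times> real \<Rightarrow> real \<times> real \<Rightarrow> real" where
  "quadrant_kernel \<epsilon> z w = bump \<epsilon> (fst w - fst z) * bump \<epsilon> (snd w - snd z)"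

lemma quadrant_kernel_nonneg: "0 < \<epsilon> \<Longrightarrow> 0 \<le> quadrant_kernel \<epsilon> z w"
  by (simp add: quadrant_kernel_def bump_nonneg)

lemma quadrant_kernel_eq_0:
  assumes "0 < \<epsilon>" "\<not> (fst z < fst w \<and> fst w < fst z + \<epsilon> \<and> snd z < snd w \<and> snd w < snd z + \<epsilon>)"
  shows "quadrant_kernel \<epsilon> z w = 0"
  using assms bump_eq_0(1)[OF assms(1)] by (force simp: quadrant_kernel_def not_less)

lemma quadrant_kernel_integrable:
  assumes \<epsilon>: "0 < \<epsilon>" and p: "p \<in> borel_measurable borel" "bounded (range p)"
  shows "integrable lborel (\<lambda>w. p w * quadrant_kernel \<epsilon> z w)"
proof (rule integrable_bounded_support[where B = "{fst z..fst z + \<epsilon>} \<times> {snd z..snd z + \<epsilon>}"])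
  have "(\<lambda>w. bump \<epsilon> (fst w - fst z) * bump \<epsilon> (snd w - snd z)) \<in> borel_measurable (borel \<Otimes>\<^sub>M borel)"
    by measurable
  then show "(\<lambda>w. p w * quadrant_kernel \<epsilon> z w) \<in> borel_measurable borel"
    using p(1) by (auto simp: quadrant_kernel_def borel_prod intro!: borel_measurable_times)
  show "bounded (range (\<lambda>w. p w * quadrant_kernel \<epsilon> z w))"
    unfolding quadrant_kernel_def
    by (intro bounded_range_real_intros p(2) bounded_range_comp[OF bump_bounded(1)[OF \<epsilon>]])
  show "bounded ({fst z..fst z + \<epsilon>} \<times> {snd z..snd z + \<epsilon>})" by (intro bounded_Times) auto
  show "p w * quadrant_kernel \<epsilon> z w = 0" if "w \<notin> {fst z..fst z + \<epsilon>} \<times> {snd z..snd z + \<epsilon>}" for w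
    using quadrant_kernel_eq_0[OF \<epsilon>, of z w] that by (auto simp: mem_Times_iff)
qed

lemma quadrant_kernel_integral:
  assumes \<epsilon>: "0 < \<epsilon>"
  shows "(LINT w|lborel. quadrant_kernel \<epsilon> z w) = 1"
proof -
  have int: "integrable lborel (quadrant_kernel \<epsilon> z)"
    using quadrant_kernel_integrable[OF \<epsilon>, of "\<lambda>_. 1" z] by (simp add: bounded_range_real_intros(6))
  have b: "(LINT y|lborel. bump \<epsilon> (y - c)) = 1" for c
    using lborel_integral_real_affine[of 1 "bump \<epsilon>" "- c"] bump_integral[OF \<epsilon>] by simp
  have "(LINT w|lborel. quadrant_kernel \<epsilon> z w)
      = (LINT s|lborel. LINT y|lborel. bump \<epsilon> (s - fst z) * bump \<epsilon> (y - snd z))"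
    using lborel_Fubini(1)[OF int] by (simp only: quadrant_kernel_def[abs_def] fst_conv snd_conv)
  then show ?thesis by (simp add: b)
qed

text \<open>The kernel is a probability density, so an average deviates from \<open>c\<close> no
  more than \<open>p\<close> does on the open support. With \<open>c = 0\<close> the same estimate
  supplies the bound for dominated convergence.\<close>

lemma quadrant_kernel_average:
  assumes \<epsilon>: "0 < \<epsilon>" and p: "p \<in> borel_measurable borel" "bounded (range p)"
    and near: "\<And>s y. fst z < s \<Longrightarrow> s < fst z + \<epsilon> \<Longrightarrow> snd z < y \<Longrightarrow> y < snd z + \<epsilon> \<Longrightarrow> \<bar>p (s, y) - c\<bar> \<le> \<eta>"
  shows "\<bar>(LINT w|lborel. p w * quadrant_kernel \<epsilon> z w) - c\<bar> \<le> \<eta>"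
proof -
  have c: "integrable lborel (\<lambda>w. a * quadrant_kernel \<epsilon> z w)" for a
    by (rule quadrant_kernel_integrable[OF \<epsilon>]) (auto simp: bounded_range_real_intros(6))
  have pk: "integrable lborel (\<lambda>w. p w * quadrant_kernel \<epsilon> z w)"
    by (rule quadrant_kernel_integrable[OF \<epsilon> p])
  have k1: "(LINT w|lborel. a * quadrant_kernel \<epsilon> z w) = a" for a
    by (simp add: quadrant_kernel_integral[OF \<epsilon>])
  have le: "\<bar>p w * quadrant_kernel \<epsilon> z w - c * quadrant_kernel \<epsilon> z w\<bar> \<le> \<eta> * quadrant_kernel \<epsilon> z w" for w
  proof (cases "fst z < fst w \<and> fst w < fst z + \<epsilon> \<and> snd z < snd w \<and> snd w < snd z + \<epsilon>")
    case True
    then have "\<bar>p w - c\<bar> \<le> \<eta>" using near[of "fst w" "snd w"] by simp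
    then have "\<bar>p w - c\<bar> * quadrant_kernel \<epsilon> z w \<le> \<eta> * quadrant_kernel \<epsilon> z w"
      by (intro mult_right_mono quadrant_kernel_nonneg \<epsilon>)
    then show ?thesis
      using quadrant_kernel_nonneg[OF \<epsilon>, of z w] by (simp add: abs_mult flip: left_diff_distrib)
  qed (simp add: quadrant_kernel_eq_0[OF \<epsilon>])
  have "\<bar>(LINT w|lborel. p w * quadrant_kernel \<epsilon> z w) - c\<bar>
      = \<bar>LINT w|lborel. p w * quadrant_kernel \<epsilon> z w - c * quadrant_kernel \<epsilon> z w\<bar>"
    by (simp only: Bochner_Integration.integral_diff[OF pk c] k1)
  also have "\<dots> \<le> (LINT w|lborel. \<bar>p w * quadrant_kernel \<epsilon> z w - c * quadrant_kernel \<epsilon> z w\<bar>)"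
    by (rule integral_abs_bound)
  also have "\<dots> \<le> (LINT w|lborel. \<eta> * quadrant_kernel \<epsilon> z w)"
    using le by (intro integral_mono integrable_abs Bochner_Integration.integrable_diff pk c)
  also have "\<dots> = \<eta>" by (rule k1)
  finally show ?thesis .
qed

section \<open>Doubling the variables and the Kato inequality\<close>

lemma borel_measurable_fst_snd [measurable (raw)]:
  fixes g :: "'a \<Rightarrow> 'b::second_countable_topology \<times> 'c::second_countable_topology"
  assumes "g \<in> borel_measurable M"
  shows "(\<lambda>x. fst (g x)) \<in> borel_measurable M" "(\<lambda>x. snd (g x)) \<in> borel_measurable M"
proof -
  have "g \<in> M \<rightarrow>\<^sub>M (borel \<Otimes>\<^sub>M borel)" using assms by (simp add: borel_prod)
  from measurable_compose[OF this measurable_fst] measurable_compose[OF this measurable_snd]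
  show "(\<lambda>x. fst (g x)) \<in> borel_measurable M" "(\<lambda>x. snd (g x)) \<in> borel_measurable M"
    by blast+
qed

lemma bounded_range_continuous_comp:
  fixes f g :: "_ \<Rightarrow> real"
  assumes "continuous_on UNIV f" "bounded (range g)"
  shows "bounded (range (\<lambda>x. f (g x)))"
proof -
  have "bounded (f ` closure (range g))"
    by (intro compact_imp_bounded compact_continuous_image continuous_on_subset[OF assms(1)])
      (use assms(2) in \<open>simp_all add: compact_closure\<close>)
  then show ?thesis
    by (rule bounded_subset) (use closure_subset[of "range g"] in blast)
qed

lemma kruzkov_flux_bounded:
  assumes f: "continuous_on UNIV f" and g: "bounded (range g)" "bounded (range h)"
  shows "bounded (range (\<lambda>x. kruzkov_flux f (g x) (h x)))"
proof -
  have "bounded (range (\<lambda>x. sgn (g x - h x)))"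
    unfolding bounded_iff by (rule exI[of _ 1]) (auto simp: sgn_if)
  then show ?thesis
    unfolding kruzkov_flux_def
    by (intro bounded_range_real_intros bounded_range_continuous_comp[OF f] g)
qed

lemma kruzkov_flux_commute: "kruzkov_flux f a b = kruzkov_flux f b a"
  by (auto simp: kruzkov_flux_def sgn_if)

lemma continuous_on_bump [continuous_intros]:
  assumes "continuous_on S g"
  shows "continuous_on S (\<lambda>x. bump \<epsilon> (g x))" "continuous_on S (\<lambda>x. bump' \<epsilon> (g x))"
  by (rule continuous_on_compose2[OF bump_continuous(1) assms] continuous_on_compose2[OF bump_continuous(2) assms]; simp)+

text \<open>The doubled test function in its first variable, the point \<open>(s, y)\<close> being
  frozen. The support is inherited from \<open>\<psi>\<close>, and the kernel derivatives carry a
  minus sign since the variable enters the kernel as \<open>s - t\<close> and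
  \<open>y - x\<close>.\<close>

lemma test_fun_times_kernel_source:
  assumes \<psi>: "test_fun T \<psi> \<psi>t \<psi>x"
  shows "test_fun T (\<lambda>t x. \<psi> t x * (bump \<epsilon> (s - t) * bump \<epsilon> (y - x)))
    (\<lambda>t x. \<psi>t t x * (bump \<epsilon> (s - t) * bump \<epsilon> (y - x)) - \<psi> t x * (bump' \<epsilon> (s - t) * bump \<epsilon> (y - x)))
    (\<lambda>t x. \<psi>x t x * (bump \<epsilon> (s - t) * bump \<epsilon> (y - x)) - \<psi> t x * (bump \<epsilon> (s - t) * bump' \<epsilon> (y - x)))"
  unfolding test_fun_def
proof (intro conjI allI)
  fix t x
  have b: "((\<lambda>t. bump \<epsilon> (c - t)) has_real_derivative - bump' \<epsilon> (c - t)) (at t)" for c t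
  proof -
    have "((\<lambda>t. c - t) has_real_derivative -1) (at t)" by (auto intro!: derivative_eq_intros)
    from DERIV_chain2[OF bump_has_derivative this] show ?thesis by simp
  qed
  show "((\<lambda>t. \<psi> t x * (bump \<epsilon> (s - t) * bump \<epsilon> (y - x))) has_real_derivative
      \<psi>t t x * (bump \<epsilon> (s - t) * bump \<epsilon> (y - x)) - \<psi> t x * (bump' \<epsilon> (s - t) * bump \<epsilon> (y - x))) (at t)"
    by (auto intro!: derivative_eq_intros test_fun_deriv(1)[OF \<psi>] b)
  show "((\<lambda>x. \<psi> t x * (bump \<epsilon> (s - t) * bump \<epsilon> (y - x))) has_real_derivative
      \<psi>x t x * (bump \<epsilon> (s - t) * bump \<epsilon> (y - x)) - \<psi> t x * (bump \<epsilon> (s - t) * bump' \<epsilon> (y - x))) (at x)"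
    by (auto intro!: derivative_eq_intros test_fun_deriv(2)[OF \<psi>] b)
next
  note c = test_fun_continuous[OF \<psi>] test_fun_deriv(3,4)[OF \<psi>]
  show "continuous_on UNIV (\<lambda>z. \<psi>t (fst z) (snd z) * (bump \<epsilon> (s - fst z) * bump \<epsilon> (y - snd z))
      - \<psi> (fst z) (snd z) * (bump' \<epsilon> (s - fst z) * bump \<epsilon> (y - snd z)))"
    by (intro continuous_intros c)
  show "continuous_on UNIV (\<lambda>z. \<psi>x (fst z) (snd z) * (bump \<epsilon> (s - fst z) * bump \<epsilon> (y - snd z))
      - \<psi> (fst z) (snd z) * (bump \<epsilon> (s - fst z) * bump' \<epsilon> (y - snd z)))"
    by (intro continuous_intros c)
  obtain R e where "e > 0" "\<And>t x. t \<ge> T - e \<or> t \<le> - R \<or> \<bar>x\<bar> \<ge> R \<Longrightarrow> \<psi> t x = 0"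
    using test_fun_vanishes[OF \<psi>] by metis
  then show "\<exists>R e. e > 0 \<and> (\<forall>t x. t \<ge> T - e \<or> t \<le> - R \<or> \<bar>x\<bar> \<ge> R \<longrightarrow>
      \<psi> t x * (bump \<epsilon> (s - t) * bump \<epsilon> (y - x)) = 0)"
    by (intro exI[of _ R] exI[of _ e]) simp
qed

text \<open>The doubled test function in its second variable. Here the kernel alone provides the
  support, which in time is contained in \<open>[t, t + \<epsilon>]\<close>; the bound on
  \<open>t\<close> keeps it a distance \<open>\<epsilon>\<close> away from the final time.\<close>

lemma test_fun_kernel_target:
  assumes \<epsilon>: "0 < \<epsilon>" and t: "0 < t" "t < T - 2 * \<epsilon>"
  shows "test_fun T (\<lambda>s y. c * (bump \<epsilon> (s - t) * bump \<epsilon> (y - x)))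
    (\<lambda>s y. c * (bump' \<epsilon> (s - t) * bump \<epsilon> (y - x)))
    (\<lambda>s y. c * (bump \<epsilon> (s - t) * bump' \<epsilon> (y - x)))"
  unfolding test_fun_def
proof (intro conjI allI)
  fix s y
  have b: "((\<lambda>t. bump \<epsilon> (t - c)) has_real_derivative bump' \<epsilon> (t - c)) (at t)" for c t
  proof -
    have "((\<lambda>t. t - c) has_real_derivative 1) (at t)" by (auto intro!: derivative_eq_intros)
    from DERIV_chain2[OF bump_has_derivative this] show ?thesis by simp
  qed
  show "((\<lambda>s. c * (bump \<epsilon> (s - t) * bump \<epsilon> (y - x))) has_real_derivative
      c * (bump' \<epsilon> (s - t) * bump \<epsilon> (y - x))) (at s)"
    by (auto intro!: derivative_eq_intros b)
  show "((\<lambda>y. c * (bump \<epsilon> (s - t) * bump \<epsilon> (y - x))) has_real_derivative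
      c * (bump \<epsilon> (s - t) * bump' \<epsilon> (y - x))) (at y)"
    by (auto intro!: derivative_eq_intros b)
next
  show "continuous_on UNIV (\<lambda>z. c * (bump' \<epsilon> (fst z - t) * bump \<epsilon> (snd z - x)))"
    "continuous_on UNIV (\<lambda>z. c * (bump \<epsilon> (fst z - t) * bump' \<epsilon> (snd z - x)))"
    by (intro continuous_intros)+
  show "\<exists>R e. e > 0 \<and> (\<forall>s y. s \<ge> T - e \<or> s \<le> - R \<or> \<bar>y\<bar> \<ge> R \<longrightarrow>
      c * (bump \<epsilon> (s - t) * bump \<epsilon> (y - x)) = 0)"
  proof (intro exI conjI allI impI)
    fix s y assume "s \<ge> T - \<epsilon> \<or> s \<le> - (\<bar>x\<bar> + \<epsilon>) \<or> \<bar>y\<bar> \<ge> \<bar>x\<bar> + \<epsilon>"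
    then have "(s - t \<le> 0 \<or> \<epsilon> \<le> s - t) \<or> (y - x \<le> 0 \<or> \<epsilon> \<le> y - x)"
      using \<epsilon> t by linarith
    then show "c * (bump \<epsilon> (s - t) * bump \<epsilon> (y - x)) = 0"
      using bump_eq_0(1)[OF \<epsilon>] by fastforce
  qed (rule \<epsilon>)
qed

text \<open>The Kruzkov half of \<open>entropy_solution\<close>, with the strip as a factor, so that
  \<open>u\<close> may be a bounded Borel function on the whole plane.\<close>

definition kruzkov_inequality :: "(real \<Rightarrow> real) \<Rightarrow> real \<Rightarrow> (real \<Rightarrow> real) \<Rightarrow> (real \<times> real \<Rightarrow> real) \<Rightarrow> bool" where
  "kruzkov_inequality f T u0 u \<longleftrightarrow> (\<forall>\<phi> \<phi>t \<phi>x k. test_fun T \<phi> \<phi>t \<phi>x \<and> (\<forall>t x. \<phi> t x \<ge> 0) \<longrightarrow>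
     0 \<le> (LINT z|lborel. time_strip T z * (\<bar>u z - k\<bar> * \<phi>t (fst z) (snd z)
        + kruzkov_flux f (u z) k * \<phi>x (fst z) (snd z))) + (LINT x|lborel. \<bar>u0 x - k\<bar> * \<phi> 0 x))"

lemma kruzkov_inequalityD:
  assumes "kruzkov_inequality f T u0 u" "test_fun T \<phi> \<phi>t \<phi>x" "\<And>t x. \<phi> t x \<ge> 0"
  shows "0 \<le> (LINT z|lborel. time_strip T z * (\<bar>u z - k\<bar> * \<phi>t (fst z) (snd z)
        + kruzkov_flux f (u z) k * \<phi>x (fst z) (snd z))) + (LINT x|lborel. \<bar>u0 x - k\<bar> * \<phi> 0 x)"
  using assms unfolding kruzkov_inequality_def by blast

text \<open>For fixed \<open>w\<close> the inequality of \<open>v\<close> is used with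
  \<open>k = u w\<close>, for fixed \<open>z\<close> that of \<open>u\<close> with
  \<open>k = v z\<close>, both with the test function \<open>\<psi> z\<close> times the kernel.
  After integration and addition the kernel derivatives cancel. Attaching \<open>\<psi>\<close> to
  \<open>z\<close> alone keeps \<open>v\<close> at the unshifted point, so that in the limit only
  shifts of \<open>u\<close> have to be controlled.\<close>

lemma kruzkov_doubling:
  fixes f u0 :: "real \<Rightarrow> real" and u v :: "real \<times> real \<Rightarrow> real"
  assumes f: "continuous_on UNIV f"
    and u [measurable]: "u \<in> borel_measurable borel" and ub: "bounded (range u)"
    and v [measurable]: "v \<in> borel_measurable borel" and vb: "bounded (range v)"
    and u0 [measurable]: "u0 \<in> borel_measurable borel" and u0b: "bounded (range u0)"
    and u_entropy: "kruzkov_inequality f T u0 u"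
    and v_entropy: "kruzkov_inequality f T u0 v"
    and \<psi>: "test_fun T \<psi> \<psi>t \<psi>x" "\<And>t x. \<psi> t x \<ge> 0"
    and \<epsilon>: "\<epsilon> > 0" and vanish: "\<And>t x. t \<ge> T - 2 * \<epsilon> \<Longrightarrow> \<psi> t x = 0"
  shows "integrable lborel (\<lambda>z. LINT w|lborel. (time_strip T z * time_strip T w
      * (\<bar>v z - u w\<bar> * \<psi>t (fst z) (snd z) + kruzkov_flux f (v z) (u w) * \<psi>x (fst z) (snd z)))
      * quadrant_kernel \<epsilon> z w)"
    and "integrable lborel (\<lambda>x. LINT w|lborel. (time_strip T w * \<bar>u0 x - u w\<bar> * \<psi> 0 x)
      * quadrant_kernel \<epsilon> (0, x) w)"
    and "0 \<le> (LINT z|lborel. LINT w|lborel. (time_strip T z * time_strip T w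
      * (\<bar>v z - u w\<bar> * \<psi>t (fst z) (snd z) + kruzkov_flux f (v z) (u w) * \<psi>x (fst z) (snd z)))
      * quadrant_kernel \<epsilon> z w)
    + (LINT x|lborel. LINT w|lborel. (time_strip T w * \<bar>u0 x - u w\<bar> * \<psi> 0 x)
      * quadrant_kernel \<epsilon> (0, x) w)"
proof -
  have fm [measurable]: "f \<in> borel_measurable borel"
    by (rule borel_measurable_continuous_onI[OF f])
  define \<psi>\<psi> \<psi>\<psi>t \<psi>\<psi>x where "\<psi>\<psi> z = \<psi> (fst z) (snd z)" and "\<psi>\<psi>t z = \<psi>t (fst z) (snd z)"
    and "\<psi>\<psi>x z = \<psi>x (fst z) (snd z)" for z
  have m\<psi> [measurable]: "\<psi>\<psi> \<in> borel_measurable borel" "\<psi>\<psi>t \<in> borel_measurable borel"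
    "\<psi>\<psi>x \<in> borel_measurable borel"
    using test_fun_measurable[OF \<psi>(1)] by (simp_all add: \<psi>\<psi>_def[abs_def] \<psi>\<psi>t_def[abs_def] \<psi>\<psi>x_def[abs_def])
  have b\<psi>: "bounded (range \<psi>\<psi>)" "bounded (range \<psi>\<psi>t)" "bounded (range \<psi>\<psi>x)"
    using test_fun_bounded[OF \<psi>(1)] by (simp_all add: \<psi>\<psi>_def[abs_def] \<psi>\<psi>t_def[abs_def] \<psi>\<psi>x_def[abs_def])
  obtain S where S: "bounded S" "\<And>z. z \<notin> S \<Longrightarrow> \<psi>\<psi> z = 0 \<and> \<psi>\<psi>t z = 0 \<and> \<psi>\<psi>x z = 0"
    using test_fun_support_bounded[OF \<psi>(1)] unfolding \<psi>\<psi>_def \<psi>\<psi>t_def \<psi>\<psi>x_def by blast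
  obtain R where R: "\<And>z. z \<in> S \<Longrightarrow> norm z \<le> R" using S(1) unfolding bounded_iff by blast
  \<comment> \<open>All \<open>w\<close> that the kernel reaches from a \<open>z\<close> in the
    support of \<open>\<psi>\<close>; the kernel points up and right, so only the upper ends grow by
    \<open>\<epsilon>\<close>.\<close>
  define S' where "S' = {-R..R + \<epsilon>} \<times> {-R..R + \<epsilon>}"
  have supp: "\<psi>\<psi> z = 0 \<and> \<psi>\<psi>t z = 0 \<and> \<psi>\<psi>x z = 0 \<or>
      (w \<in> S' \<or> (bump \<epsilon> (fst w - fst z) = 0 \<and> bump' \<epsilon> (fst w - fst z) = 0)
        \<or> (bump \<epsilon> (snd w - snd z) = 0 \<and> bump' \<epsilon> (snd w - snd z) = 0))" for z w
  proof (cases "z \<in> S")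
    case True
    have "\<bar>fst z\<bar> \<le> R" "\<bar>snd z\<bar> \<le> R"
      using R[OF True] norm_fst_le[of "fst z" "snd z"] norm_snd_le[of "snd z" "fst z"] by auto
    then have "w \<in> S' \<or> (fst w - fst z \<le> 0 \<or> \<epsilon> \<le> fst w - fst z) \<or> (snd w - snd z \<le> 0 \<or> \<epsilon> \<le> snd w - snd z)"
      by (auto simp: S'_def mem_Times_iff)
    then show ?thesis using bump_eq_0[OF \<epsilon>] by blast
  qed (use S(2) in blast)
  have bS: "bounded (S \<times> S')" unfolding S'_def using S(1) by (intro bounded_Times) auto
  let ?\<Omega> = "time_strip T"
  define K Ks Ky where "K z w = bump \<epsilon> (fst w - fst z) * bump \<epsilon> (snd w - snd z)"
    and "Ks z w = bump' \<epsilon> (fst w - fst z) * bump \<epsilon> (snd w - snd z)"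
    and "Ky z w = bump \<epsilon> (fst w - fst z) * bump' \<epsilon> (snd w - snd z)" for z w :: "real \<times> real"
  \<comment> \<open>\<open>A\<close> is the doubled integrand from the inequality of
    \<open>v\<close>, \<open>B\<close> the one from that of \<open>u\<close>, and \<open>C\<close>
    the initial term of the former.\<close>
  define A where "A p = (case p of (z, w) \<Rightarrow> ?\<Omega> z * ?\<Omega> w * (\<bar>v z - u w\<bar> * (\<psi>\<psi>t z * K z w - \<psi>\<psi> z * Ks z w)
      + kruzkov_flux f (v z) (u w) * (\<psi>\<psi>x z * K z w - \<psi>\<psi> z * Ky z w)))" for p
  define B where "B p = (case p of (z, w) \<Rightarrow> ?\<Omega> z * ?\<Omega> w * (\<bar>v z - u w\<bar> * (\<psi>\<psi> z * Ks z w)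
      + kruzkov_flux f (v z) (u w) * (\<psi>\<psi> z * Ky z w)))" for p
  define C where "C p = (case p of (w, x) \<Rightarrow> ?\<Omega> w * \<bar>u0 x - u w\<bar> * (\<psi>\<psi> (0, x) * K (0, x) w))" for p
  have b\<Omega>: "bounded (range ?\<Omega>)" unfolding time_strip_def by (rule bounded_range_real_intros)
  note bnd = bounded_range_real_intros bounded_range_comp[OF ub] bounded_range_comp[OF vb]
    bounded_range_comp[OF u0b] bounded_range_comp[OF b\<Omega>] b\<psi>[THEN bounded_range_comp]
    bump_bounded[OF \<epsilon>, THEN bounded_range_comp] kruzkov_flux_bounded[OF f]
  have Aint: "integrable lborel A"
  proof (rule integrable_bounded_support[OF _ _ bS])
    show "A \<in> borel_measurable borel"
      unfolding A_def kruzkov_flux_def K_def Ks_def Ky_def case_prod_beta by measurable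
    show "bounded (range A)"
      unfolding A_def case_prod_beta K_def Ks_def Ky_def by (intro bnd)
    show "A p = 0" if "p \<notin> S \<times> S'" for p
      using that supp[of "fst p" "snd p"] S(2)[of "fst p"]
      by (cases p) (auto simp: A_def K_def Ks_def Ky_def mem_Times_iff)
  qed
  have Bint: "integrable lborel B"
  proof (rule integrable_bounded_support[OF _ _ bS])
    show "B \<in> borel_measurable borel"
      unfolding B_def kruzkov_flux_def K_def Ks_def Ky_def case_prod_beta by measurable
    show "bounded (range B)"
      unfolding B_def case_prod_beta K_def Ks_def Ky_def by (intro bnd)
    show "B p = 0" if "p \<notin> S \<times> S'" for p
      using that supp[of "fst p" "snd p"] S(2)[of "fst p"]
      by (cases p) (auto simp: B_def K_def Ks_def Ky_def mem_Times_iff)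
  qed
  have Cint: "integrable lborel C"
  proof (rule integrable_bounded_support[where B = "S' \<times> {-R..R}"])
    show "C \<in> borel_measurable borel"
      unfolding C_def K_def case_prod_beta by measurable
    show "bounded (range C)"
      unfolding C_def case_prod_beta K_def by (intro bnd)
    show "bounded (S' \<times> {-R..R})" unfolding S'_def by (intro bounded_Times) auto
    show "C p = 0" if "p \<notin> S' \<times> {-R..R}" for p
    proof -
      obtain w x where p: "p = (w, x)" by (cases p)
      have "\<bar>x\<bar> \<le> R" if "(0, x) \<in> S" using R[OF that] norm_snd_le[of x "0 :: real"] by simp
      then show ?thesis
        using that supp[of "(0, x)" w] S(2)[of "(0, x)"]
        by (cases "(0, x) \<in> S") (auto simp: C_def K_def p mem_Times_iff abs_le_iff)
    qed
  qed
  have v_ineq: "0 \<le> (LINT z|lborel. A (z, w)) + (LINT x|lborel. C (w, x))" for w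
  proof -
    obtain s y where w: "w = (s, y)" by (cases w)
    have "0 \<le> (LINT z|lborel. ?\<Omega> z * (\<bar>v z - u w\<bar> * (\<psi>\<psi>t z * K z w - \<psi>\<psi> z * Ks z w)
        + kruzkov_flux f (v z) (u w) * (\<psi>\<psi>x z * K z w - \<psi>\<psi> z * Ky z w)))
        + (LINT x|lborel. \<bar>u0 x - u w\<bar> * (\<psi>\<psi> (0, x) * K (0, x) w))"
      using kruzkov_inequalityD[OF v_entropy test_fun_times_kernel_source[OF \<psi>(1), of \<epsilon> s y], where k = "u w"] \<psi>(2)
      by (simp add: \<psi>\<psi>_def \<psi>\<psi>t_def \<psi>\<psi>x_def K_def Ks_def Ky_def w bump_nonneg[OF \<epsilon>])
    \<comment> \<open>The inequality of \<open>v\<close> holds for every constant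
      \<open>u w\<close>; the nonnegative factor restricts it to those \<open>w\<close> in the strip
      before integrating.\<close>
    then have "0 \<le> ?\<Omega> w * ((LINT z|lborel. ?\<Omega> z * (\<bar>v z - u w\<bar> * (\<psi>\<psi>t z * K z w - \<psi>\<psi> z * Ks z w)
        + kruzkov_flux f (v z) (u w) * (\<psi>\<psi>x z * K z w - \<psi>\<psi> z * Ky z w)))
        + (LINT x|lborel. \<bar>u0 x - u w\<bar> * (\<psi>\<psi> (0, x) * K (0, x) w)))"
      by (intro mult_nonneg_nonneg) (simp add: time_strip_def)
    then show ?thesis
      by (simp add: A_def C_def distrib_left mult_ac flip: Bochner_Integration.integral_mult_right_zero)
  qed
  have u_ineq: "0 \<le> (LINT w|lborel. B (z, w))" for z
  \<comment> \<open>The kernel is an admissible test function in \<open>w\<close> only for times of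
    \<open>z\<close> between 0 and \<open>T - 2 * \<epsilon>\<close>. Everywhere else
    \<open>\<psi>\<close> or the strip factor annihilates \<open>B\<close>.\<close>
  proof (cases "z \<in> {0<..<T} \<times> UNIV \<and> \<psi>\<psi> z \<noteq> 0")
    case True
    obtain t x where z: "z = (t, x)" by (cases z)
    have t: "0 < t" "t < T - 2 * \<epsilon>"
      using True vanish[of t x] by (auto simp: z \<psi>\<psi>_def intro: ccontr)
    have "0 \<le> (LINT w|lborel. ?\<Omega> w * (\<bar>u w - v z\<bar> * (\<psi>\<psi> z * Ks z w)
        + kruzkov_flux f (u w) (v z) * (\<psi>\<psi> z * Ky z w)))
      + (LINT y|lborel. \<bar>u0 y - v z\<bar> * (\<psi>\<psi> z * (bump \<epsilon> (0 - t) * bump \<epsilon> (y - x))))"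
      using kruzkov_inequalityD[OF u_entropy test_fun_kernel_target[OF \<epsilon> t, of "\<psi>\<psi> z" x], where k = "v z"] \<psi>(2)
      by (simp add: \<psi>\<psi>_def K_def Ks_def Ky_def z bump_nonneg[OF \<epsilon>])
    \<comment> \<open>The one-sided kernel removes the initial term of \<open>u\<close>: the initial
      time is not later than the time of \<open>z\<close>.\<close>
    also have "bump \<epsilon> (0 - t) = 0" using bump_eq_0(1)[OF \<epsilon>] t by simp
    finally have "0 \<le> (LINT w|lborel. ?\<Omega> w * (\<bar>u w - v z\<bar> * (\<psi>\<psi> z * Ks z w)
        + kruzkov_flux f (u w) (v z) * (\<psi>\<psi> z * Ky z w)))" by simp
    moreover have "?\<Omega> z = 1" using True by (simp add: time_strip_def)
    ultimately show ?thesis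
      by (simp add: B_def abs_minus_commute kruzkov_flux_commute[of f "v z"])
  next
    case False
    then have "B (z, w) = 0" for w
      by (auto simp: B_def time_strip_def)
    then show ?thesis by simp
  qed
  define G where "G p = (case p of (z, w) \<Rightarrow> (?\<Omega> z * ?\<Omega> w
      * (\<bar>v z - u w\<bar> * \<psi>\<psi>t z + kruzkov_flux f (v z) (u w) * \<psi>\<psi>x z)) * quadrant_kernel \<epsilon> z w)" for p
  \<comment> \<open>The terms with \<open>Ks\<close> and \<open>Ky\<close> occur in \<open>A\<close>
    and \<open>B\<close> with opposite signs.\<close>
  have G: "G p = A p + B p" for p
    by (cases p) (simp add: G_def A_def B_def K_def quadrant_kernel_def algebra_simps)
  have Gint: "integrable lborel G"
    using Bochner_Integration.integrable_add[OF Aint Bint] by (simp add: G[abs_def])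
  have C: "C (w, x) = (?\<Omega> w * \<bar>u0 x - u w\<bar> * \<psi> 0 x) * quadrant_kernel \<epsilon> (0, x) w" for w x
    by (simp add: C_def K_def quadrant_kernel_def \<psi>\<psi>_def)
  have G': "(?\<Omega> z * ?\<Omega> w * (\<bar>v z - u w\<bar> * \<psi>t (fst z) (snd z)
      + kruzkov_flux f (v z) (u w) * \<psi>x (fst z) (snd z))) * quadrant_kernel \<epsilon> z w = G (z, w)" for z w
    by (simp add: G_def \<psi>\<psi>t_def \<psi>\<psi>x_def)
  have "0 \<le> (LINT w|lborel. (LINT z|lborel. A (z, w)) + (LINT x|lborel. C (w, x)))"
    by (rule Bochner_Integration.integral_nonneg) (rule v_ineq)
  also have "\<dots> = integral\<^sup>L lborel A + integral\<^sup>L lborel C"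
    using lborel_Fubini[OF Aint] lborel_Fubini[OF Cint] by simp
  finally have 1: "0 \<le> integral\<^sup>L lborel A + integral\<^sup>L lborel C" .
  have "0 \<le> (LINT z|lborel. LINT w|lborel. B (z, w))"
    by (rule Bochner_Integration.integral_nonneg) (rule u_ineq)
  then have "0 \<le> integral\<^sup>L lborel B" by (simp add: lborel_Fubini(1)[OF Bint])
  moreover have "integral\<^sup>L lborel G = integral\<^sup>L lborel A + integral\<^sup>L lborel B"
    using Bochner_Integration.integral_add[OF Aint Bint] by (simp add: G[abs_def])
  ultimately have 2: "0 \<le> integral\<^sup>L lborel G + integral\<^sup>L lborel C" using 1 by simp
  show "integrable lborel (\<lambda>z. LINT w|lborel. (?\<Omega> z * ?\<Omega> w
      * (\<bar>v z - u w\<bar> * \<psi>t (fst z) (snd z) + kruzkov_flux f (v z) (u w) * \<psi>x (fst z) (snd z)))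
      * quadrant_kernel \<epsilon> z w)"
    unfolding G' by (rule lborel_Fubini(3)[OF Gint])
  show "integrable lborel (\<lambda>x. LINT w|lborel. (?\<Omega> w * \<bar>u0 x - u w\<bar> * \<psi> 0 x)
      * quadrant_kernel \<epsilon> (0, x) w)"
    unfolding C[symmetric] by (rule lborel_Fubini(4)[OF Cint])
  show "0 \<le> (LINT z|lborel. LINT w|lborel. (?\<Omega> z * ?\<Omega> w
      * (\<bar>v z - u w\<bar> * \<psi>t (fst z) (snd z) + kruzkov_flux f (v z) (u w) * \<psi>x (fst z) (snd z)))
      * quadrant_kernel \<epsilon> z w)
    + (LINT x|lborel. LINT w|lborel. (?\<Omega> w * \<bar>u0 x - u w\<bar> * \<psi> 0 x)
      * quadrant_kernel \<epsilon> (0, x) w)"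
    unfolding G' C[symmetric] lborel_Fubini(1)[OF Gint] lborel_Fubini(2)[OF Cint] by (rule 2)
qed

text \<open>If \<open>b\<close> and \<open>b'\<close> lie on one side of \<open>a\<close>, the
  difference is that of \<open>f b\<close> and \<open>f b'\<close> up to sign. Otherwise
  \<open>a\<close> separates them, and the distances to \<open>a\<close> add up to
  \<open>\<bar>b - b'\<bar>\<close>.\<close>

lemma kruzkov_flux_lipschitz:
  fixes f :: "real \<Rightarrow> real"
  assumes lip: "\<And>a b. \<bar>a\<bar> \<le> M \<Longrightarrow> \<bar>b\<bar> \<le> M \<Longrightarrow> \<bar>f a - f b\<bar> \<le> L * \<bar>a - b\<bar>"
    and M: "\<bar>a\<bar> \<le> M" "\<bar>b\<bar> \<le> M" "\<bar>b'\<bar> \<le> M"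
  shows "\<bar>kruzkov_flux f a b - kruzkov_flux f a b'\<bar> \<le> L * \<bar>b - b'\<bar>"
proof -
  note l = lip[OF M(1,2)] lip[OF M(1,3)] lip[OF M(2,3)]
  consider "b \<le> a" "b' \<le> a" | "a \<le> b" "a \<le> b'" | "b < a" "a < b'" | "b' < a" "a < b" by linarith
  then show ?thesis
  proof cases
    case 1
    then have "kruzkov_flux f a b - kruzkov_flux f a b' = f b' - f b" by (auto simp: kruzkov_flux_def sgn_if)
    then show ?thesis using l(3) by simp
  next
    case 2
    then have "kruzkov_flux f a b - kruzkov_flux f a b' = f b - f b'" by (auto simp: kruzkov_flux_def sgn_if)
    then show ?thesis using l(3) by simp
  next
    case 3
    then have "kruzkov_flux f a b - kruzkov_flux f a b' = (f a - f b) + (f a - f b')" by (auto simp: kruzkov_flux_def sgn_if)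
    moreover have "L * \<bar>b - b'\<bar> = L * \<bar>a - b\<bar> + L * \<bar>a - b'\<bar>" using 3 by (simp add: algebra_simps)
    ultimately show ?thesis using l by linarith
  next
    case 4
    then have "kruzkov_flux f a b - kruzkov_flux f a b' = - ((f a - f b) + (f a - f b'))" by (auto simp: kruzkov_flux_def sgn_if)
    moreover have "L * \<bar>b - b'\<bar> = L * \<bar>a - b\<bar> + L * \<bar>a - b'\<bar>" using 4 by (simp add: algebra_simps)
    ultimately show ?thesis using l by linarith
  qed
qed

text \<open>The kernel shrinks to the point \<open>z\<close> from its upper right quadrant, where
  \<open>u\<close> is continuous for almost every \<open>z\<close>, and everything is dominated on
  the bounded support of \<open>\<psi>\<close>. The initial integral tends to 0 because it averages
  \<open>\<bar>u0 x - u w\<bar>\<close> over \<open>w\<close> near \<open>(0, x)\<close>, where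
  \<open>u\<close> is close to \<open>u0 x\<close>.\<close>

lemma kruzkov_kato:
  fixes f u0 :: "real \<Rightarrow> real" and u v :: "real \<times> real \<Rightarrow> real"
  assumes f: "continuous_on UNIV f"
    and u [measurable]: "u \<in> borel_measurable borel" and ub: "\<And>z. \<bar>u z\<bar> \<le> M"
    and v [measurable]: "v \<in> borel_measurable borel" and vb: "\<And>z. \<bar>v z\<bar> \<le> M"
    and u0 [measurable]: "u0 \<in> borel_measurable borel" and u0b: "bounded (range u0)"
    and lip: "\<And>a b. \<bar>a\<bar> \<le> M \<Longrightarrow> \<bar>b\<bar> \<le> M \<Longrightarrow> \<bar>f a - f b\<bar> \<le> L * \<bar>a - b\<bar>" and L: "L \<ge> 0"
    and u_entropy: "kruzkov_inequality f T u0 u"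
    and v_entropy: "kruzkov_inequality f T u0 v"
    and cont: "AE z in lborel. 0 < fst z \<and> fst z < T \<longrightarrow> (\<forall>\<eta>>0. \<exists>d>0. \<forall>s y.
      fst z < s \<and> s < fst z + d \<and> snd z < y \<and> y < snd z + d \<longrightarrow> \<bar>u (s, y) - u z\<bar> \<le> \<eta>)"
    and cont0: "AE x in lborel. \<forall>\<eta>>0. \<exists>d>0. \<forall>s y.
      0 < s \<and> s < d \<and> x < y \<and> y < x + d \<longrightarrow> \<bar>u (s, y) - u0 x\<bar> \<le> \<eta>"
    and \<psi>: "test_fun T \<psi> \<psi>t \<psi>x" "\<And>t x. \<psi> t x \<ge> 0"
  shows "0 \<le> (LINT z|lborel. time_strip T z * (\<bar>v z - u z\<bar> * \<psi>t (fst z) (snd z)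
      + kruzkov_flux f (v z) (u z) * \<psi>x (fst z) (snd z)))"
proof -
  have fm [measurable]: "f \<in> borel_measurable borel"
    by (rule borel_measurable_continuous_onI[OF f])
  note m\<psi> [measurable] = test_fun_measurable[OF \<psi>(1)]
  have bu: "bounded (range u)" "bounded (range v)"
    using ub vb unfolding bounded_iff by auto
  obtain R e where R: "R > 0" "e > 0"
    and van: "\<And>t x. t \<ge> T - e \<or> t \<le> - R \<or> \<bar>x\<bar> \<ge> R \<Longrightarrow> \<psi> t x = 0 \<and> \<psi>t t x = 0 \<and> \<psi>x t x = 0"
    using test_fun_vanishes[OF \<psi>(1)] by blast
  \<comment> \<open>The factor \<open>e / 2\<close> ensures \<open>2 * \<epsilon> n \<le> e\<close>,
    so that \<open>\<psi>\<close> vanishes after time \<open>T - 2 * \<epsilon> n\<close>, as the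
    doubling requires.\<close>
  define \<epsilon> where "\<epsilon> n = e / 2 * inverse (real (Suc n))" for n
  have \<epsilon>: "0 < \<epsilon> n" "2 * \<epsilon> n \<le> e" for n
    using R(2) by (simp_all add: \<epsilon>_def field_simps)
  have \<epsilon>0: "\<epsilon> \<longlonglongrightarrow> 0"
    unfolding \<epsilon>_def using tendsto_mult_right_zero[OF LIMSEQ_inverse_real_of_nat] by blast
  have small: "\<exists>N. \<forall>n\<ge>N. \<epsilon> n < d" if "d > 0" for d
    using order_tendstoD(2)[OF \<epsilon>0 that] by (simp add: eventually_sequentially)
  let ?\<Omega> = "time_strip T"
  have b\<Omega>: "bounded (range ?\<Omega>)" unfolding time_strip_def by (rule bounded_range_real_intros)
  have \<Omega>1: "?\<Omega> z = 1" if "0 < fst z" "fst z < T" for z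
    using that by (cases z) (simp add: time_strip_def)
  note bnd = bounded_range_real_intros bounded_range_comp[OF bu(1)] bounded_range_comp[OF bu(2)]
    bounded_range_comp[OF u0b] bounded_range_comp[OF b\<Omega>] test_fun_bounded[OF \<psi>(1), THEN bounded_range_comp]
    kruzkov_flux_bounded[OF f]
  define p where "p z w = ?\<Omega> z * ?\<Omega> w * (\<bar>v z - u w\<bar> * \<psi>t (fst z) (snd z)
      + kruzkov_flux f (v z) (u w) * \<psi>x (fst z) (snd z))" for z w
  define p0 where "p0 x w = ?\<Omega> w * \<bar>u0 x - u w\<bar> * \<psi> 0 x" for x w
  define g where "g n z = (LINT w|lborel. p z w * quadrant_kernel (\<epsilon> n) z w)" for n z
  define h where "h n x = (LINT w|lborel. p0 x w * quadrant_kernel (\<epsilon> n) (0, x) w)" for n x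
  define G where "G z = ?\<Omega> z * (\<bar>v z - u z\<bar> * \<psi>t (fst z) (snd z)
      + kruzkov_flux f (v z) (u z) * \<psi>x (fst z) (snd z))" for z
  have gh: "integrable lborel (g n)" "integrable lborel (h n)"
    "0 \<le> integral\<^sup>L lborel (g n) + integral\<^sup>L lborel (h n)" for n
  proof -
    have "\<psi> t x = 0" if "t \<ge> T - 2 * \<epsilon> n" for t x
      using van[of t x] that \<epsilon>(2)[of n] by simp
    note * = kruzkov_doubling[OF f u bu(1) v bu(2) u0 u0b u_entropy v_entropy \<psi> \<epsilon>(1)[of n] this]
    show "integrable lborel (g n)" "integrable lborel (h n)"
      "0 \<le> integral\<^sup>L lborel (g n) + integral\<^sup>L lborel (h n)"
      using * unfolding g_def[abs_def] h_def[abs_def] p_def p0_def by simp_all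
  qed
  have bp: "bounded (range (\<lambda>q. p (fst q) (snd q)))" "bounded (range (\<lambda>q. p0 (fst q) (snd q)))"
    unfolding p_def p0_def using bounded_range_comp[OF test_fun_bounded(1)[OF \<psi>(1)], of "\<lambda>q. (0, fst q)"]
    by (intro bnd; simp)+
  obtain C where C: "C \<ge> 0" "\<And>z w. \<bar>p z w\<bar> \<le> C"
    using bounded_range_absE[OF bp(1)] by (metis fst_conv snd_conv)
  obtain C0 where C0: "C0 \<ge> 0" "\<And>x w. \<bar>p0 x w\<bar> \<le> C0"
    using bounded_range_absE[OF bp(2)] by (metis fst_conv snd_conv)
  have bp1: "bounded (range (p z))" "bounded (range (p0 x))" for z x
    using bounded_range_comp[OF bp(1), of "Pair z"] bounded_range_comp[OF bp(2), of "Pair x"] by simp_all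
  have mp [measurable]: "p z \<in> borel_measurable borel" "p0 x \<in> borel_measurable borel" for z x
    unfolding p_def[abs_def] p0_def[abs_def] kruzkov_flux_def by measurable
  have "(\<lambda>n. integral\<^sup>L lborel (g n)) \<longlonglongrightarrow> integral\<^sup>L lborel G"
  proof (rule integral_dominated_convergence[where w = "\<lambda>z. C * indicator ({-R..T} \<times> {-R..R}) z"])
    show "G \<in> borel_measurable lborel"
      unfolding G_def[abs_def] kruzkov_flux_def by measurable
    show "g n \<in> borel_measurable lborel" for n using gh(1) by blast
    have "bounded ({-R..T} \<times> {-R..R})" by (intro bounded_Times) auto
    from emeasure_bounded_finite[OF this]
    show "integrable lborel (\<lambda>z. C * indicator ({-R..T} \<times> {-R..R}) z)"
      by (intro integrable_mult_right integrable_real_indicator) (auto intro!: borel_closed closed_Times)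
    have pz: "p z w = 0" if "z \<notin> {-R..T} \<times> {-R..R}" for z w
    proof -
      have "fst z \<ge> T - e \<or> fst z \<le> - R \<or> \<bar>snd z\<bar> \<ge> R"
        using that R(2) by (cases z) auto
      from van[OF this] show ?thesis by (simp add: p_def)
    qed
    have "\<bar>g n z\<bar> \<le> C * indicator ({-R..T} \<times> {-R..R}) z" for n z
    proof (cases "z \<in> {-R..T} \<times> {-R..R}")
      case True
      have "\<bar>g n z - 0\<bar> \<le> C"
        unfolding g_def by (rule quadrant_kernel_average[OF \<epsilon>(1) mp(1) bp1(1)]) (use C in simp)
      then show ?thesis using True by simp
    qed (simp add: g_def pz)
    then show "AE z in lborel. norm (g n z) \<le> C * indicator ({-R..T} \<times> {-R..R}) z" for n by simp
    show "AE z in lborel. (\<lambda>n. g n z) \<longlonglongrightarrow> G z"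
      using cont
    proof eventually_elim
      case (elim z)
      show ?case
      \<comment> \<open>From time \<open>T - e\<close> on both sides vanish. Before it, the support
        of the kernel stays below \<open>T\<close>, so the strip factor equals 1 there.\<close>
      proof (cases "0 < fst z \<and> fst z < T - e")
        case False
        then have "?\<Omega> z = 0 \<or> fst z \<ge> T - e" by (cases z) (auto simp: time_strip_def)
        then have "p z w = 0" "G z = 0" for w
          using van[of "fst z" "snd z"] by (auto simp: p_def G_def)
        then show ?thesis by (simp add: g_def)
      next
        case True
        then have z1: "?\<Omega> z = 1" using R(2) by (intro \<Omega>1) auto
        show ?thesis
        proof (rule LIMSEQ_I)
          fix r :: real assume r: "0 < r"
          \<comment> \<open>A Lipschitz constant of the integrand as a function of the value of
            \<open>u\<close>, increased by 1 so that it may serve as a divisor.\<close>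
          define D where "D = \<bar>\<psi>t (fst z) (snd z)\<bar> + L * \<bar>\<psi>x (fst z) (snd z)\<bar> + 1"
          have D: "D > 0" using L by (simp add: D_def add_nonneg_pos)
          have "0 < r / 2 / D" "0 < fst z \<and> fst z < T" using r D True R(2) by auto
          then obtain d where d: "d > 0" "\<And>s y. fst z < s \<and> s < fst z + d \<and> snd z < y \<and> y < snd z + d \<Longrightarrow>
              \<bar>u (s, y) - u z\<bar> \<le> r / 2 / D"
            using elim by meson
          obtain N where N: "\<And>n. n \<ge> N \<Longrightarrow> \<epsilon> n < d" using small[OF d(1)] by blast
          have "\<bar>g n z - G z\<bar> \<le> r / 2" if "n \<ge> N" for n
            unfolding g_def
          proof (rule quadrant_kernel_average[OF \<epsilon>(1) mp(1) bp1(1)])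
            fix s y assume sy: "fst z < s" "s < fst z + \<epsilon> n" "snd z < y" "y < snd z + \<epsilon> n"
            then have "?\<Omega> (s, y) = 1" using True \<epsilon>(1,2)[of n] by (intro \<Omega>1) auto
            then have "p z (s, y) - G z = (\<bar>v z - u (s, y)\<bar> - \<bar>v z - u z\<bar>) * \<psi>t (fst z) (snd z)
              + (kruzkov_flux f (v z) (u (s, y)) - kruzkov_flux f (v z) (u z)) * \<psi>x (fst z) (snd z)"
              by (simp add: p_def G_def z1 algebra_simps)
            also have "\<bar>\<dots>\<bar> \<le> \<bar>u (s, y) - u z\<bar> * \<bar>\<psi>t (fst z) (snd z)\<bar>
              + L * \<bar>u (s, y) - u z\<bar> * \<bar>\<psi>x (fst z) (snd z)\<bar>"
              using kruzkov_flux_lipschitz[OF lip vb ub ub, of z "(s, y)" z]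
              by (intro order_trans[OF abs_triangle_ineq] add_mono)
                (auto simp: abs_mult intro!: mult_right_mono)
            also have "\<dots> = \<bar>u (s, y) - u z\<bar> * (D - 1)" by (simp add: D_def algebra_simps)
            also have "\<dots> \<le> \<bar>u (s, y) - u z\<bar> * D" by (intro mult_left_mono) auto
            also have "\<dots> \<le> r / 2 / D * D"
              using d(2)[of s y] sy N[OF that] D by (intro mult_right_mono) auto
            finally show "\<bar>p z (s, y) - G z\<bar> \<le> r / 2" using D by simp
          qed
          then show "\<exists>N. \<forall>n\<ge>N. norm (g n z - G z) < r"
            using r by (intro exI[of _ N]) (fastforce intro: le_less_trans)
        qed
      qed
    qed
  qed
  moreover have "(\<lambda>n. integral\<^sup>L lborel (h n)) \<longlonglongrightarrow> integral\<^sup>L lborel (\<lambda>x::real. 0::real)"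
  proof (rule integral_dominated_convergence[where w = "\<lambda>x. C0 * indicator {-R..R} x"])
    show "h n \<in> borel_measurable lborel" for n using gh(2) by blast
    show "integrable lborel (\<lambda>x. C0 * indicator {-R..R} x)"
      using R(1) by (intro integrable_mult_right integrable_real_indicator) auto
    have pz: "p0 x w = 0" if "x \<notin> {-R..R}" for x w
    proof -
      have "\<bar>x\<bar> \<ge> R" using that by auto
      then show ?thesis using van[of 0 x] by (simp add: p0_def)
    qed
    have "\<bar>h n x\<bar> \<le> C0 * indicator {-R..R} x" for n x
    proof (cases "x \<in> {-R..R}")
      case True
      have "\<bar>h n x - 0\<bar> \<le> C0"
        unfolding h_def by (rule quadrant_kernel_average[OF \<epsilon>(1) mp(2) bp1(2)]) (use C0 in simp)
      then show ?thesis using True by simp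
    qed (simp add: h_def pz)
    then show "AE x in lborel. norm (h n x) \<le> C0 * indicator {-R..R} x" for n by simp
    show "AE x in lborel. (\<lambda>n. h n x) \<longlonglongrightarrow> 0"
      using cont0
    proof eventually_elim
      case (elim x)
      show ?case
      proof (rule LIMSEQ_I)
        fix r :: real assume r: "0 < r"
        define D where "D = \<bar>\<psi> 0 x\<bar> + 1"
        have D: "D > 0" by (simp add: D_def add_nonneg_pos)
        have "0 < r / 2 / D" using r D by simp
        then obtain d where d: "d > 0" "\<And>s y. 0 < s \<and> s < d \<and> x < y \<and> y < x + d \<Longrightarrow>
            \<bar>u (s, y) - u0 x\<bar> \<le> r / 2 / D"
          using elim by meson
        obtain N where N: "\<And>n. n \<ge> N \<Longrightarrow> \<epsilon> n < d" using small[OF d(1)] by blast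
        have "\<bar>h n x - 0\<bar> \<le> r / 2" if "n \<ge> N" for n
          unfolding h_def
        proof (rule quadrant_kernel_average[OF \<epsilon>(1) mp(2) bp1(2)])
          fix s y assume sy: "fst (0::real, x) < s" "s < fst (0::real, x) + \<epsilon> n" "snd (0::real, x) < y" "y < snd (0::real, x) + \<epsilon> n"
          have "\<bar>p0 x (s, y) - 0\<bar> \<le> \<bar>u (s, y) - u0 x\<bar> * \<bar>\<psi> 0 x\<bar>"
            by (auto simp: p0_def abs_mult time_strip_def indicator_def abs_minus_commute)
          also have "\<dots> \<le> \<bar>u (s, y) - u0 x\<bar> * D" by (intro mult_left_mono) (auto simp: D_def)
          also have "\<dots> \<le> r / 2 / D * D"
            using d(2)[of s y] sy N[OF that] D by (intro mult_right_mono) auto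
          finally show "\<bar>p0 x (s, y) - 0\<bar> \<le> r / 2" using D by simp
        qed
        then show "\<exists>N. \<forall>n\<ge>N. norm (h n x - 0) < r"
          using r by (intro exI[of _ N]) (fastforce intro: le_less_trans)
      qed
    qed
  qed simp_all
  ultimately have "(\<lambda>n. integral\<^sup>L lborel (g n) + integral\<^sup>L lborel (h n)) \<longlonglongrightarrow> integral\<^sup>L lborel G + 0"
    by (intro tendsto_add) simp_all
  then have "0 \<le> integral\<^sup>L lborel G + 0"
    by (rule LIMSEQ_le_const) (use gh(3) in blast)
  then show ?thesis by (simp add: G_def[abs_def])
qed

section \<open>From the Kato inequality to uniqueness\<close>

text \<open>The test function is supported in a cone of slope \<open>L\<close>, the maximal speed, and decreases
  in time; hence both terms of the Kato inequality are nonpositive.\<close>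

lemma cone_test_fun:
  fixes T' T L R :: real
  assumes T': "0 < T'" "T' < T" and L: "0 \<le> L"
  defines "m \<equiv> \<lambda>t x. max 0 (R - sqrt (1 + x\<^sup>2) - L * t)" and "a \<equiv> \<lambda>t. max 0 (T'\<^sup>2 - t\<^sup>2)"
  shows "test_fun T (\<lambda>t x. (a t)\<^sup>2 * (m t x)\<^sup>2)
    (\<lambda>t x. - 4 * t * a t * (m t x)\<^sup>2 - 2 * L * ((a t)\<^sup>2 * m t x))
    (\<lambda>t x. - 2 * ((a t)\<^sup>2 * m t x) * (x / sqrt (1 + x\<^sup>2)))"
  unfolding test_fun_def
proof (intro conjI allI)
  fix t x
  have pos: "0 < 1 + x\<^sup>2" for x :: real by (simp add: add_pos_nonneg)
  have "((\<lambda>t. T'\<^sup>2 - t\<^sup>2) has_real_derivative - 2 * t) (at t)"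
    by (auto intro!: derivative_eq_intros)
  from DERIV_chain2[OF max_0_square_has_derivative this]
  have 1: "((\<lambda>t. (a t)\<^sup>2) has_real_derivative 2 * a t * (- 2 * t)) (at t)" by (simp add: a_def)
  have "((\<lambda>t. R - sqrt (1 + x\<^sup>2) - L * t) has_real_derivative - L) (at t)"
    by (auto intro!: derivative_eq_intros)
  from DERIV_chain2[OF max_0_square_has_derivative this]
  have 2: "((\<lambda>t. (m t x)\<^sup>2) has_real_derivative 2 * m t x * (- L)) (at t)" by (simp add: m_def)
  \<comment> \<open>\<open>sqrt (1 + x\<^sup>2)\<close> replaces \<open>\<bar>x\<bar>\<close>: it is
    C^1 at 0 and its slope is at most 1 in modulus, so the speed \<open>L\<close> still
    dominates.\<close>
  have "((\<lambda>x. 1 + x\<^sup>2) has_real_derivative 2 * x) (at x)"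
    by (auto intro!: derivative_eq_intros)
  then have "((\<lambda>x. sqrt (1 + x\<^sup>2)) has_real_derivative inverse (sqrt (1 + x\<^sup>2)) / 2 * (2 * x)) (at x)"
    using DERIV_real_sqrt[OF pos] by (rule DERIV_chain'[where g = sqrt])
  from DERIV_diff[OF DERIV_diff[OF DERIV_const[of R] this] DERIV_const[of "L * t"]]
  have "((\<lambda>x. R - sqrt (1 + x\<^sup>2) - L * t) has_real_derivative - (x / sqrt (1 + x\<^sup>2))) (at x)"
    by (rule DERIV_cong) (simp add: field_simps)
  from DERIV_chain2[OF max_0_square_has_derivative this]
  have 3: "((\<lambda>x. (m t x)\<^sup>2) has_real_derivative 2 * m t x * (- (x / sqrt (1 + x\<^sup>2)))) (at x)" by (simp add: m_def)
  show "((\<lambda>t. (a t)\<^sup>2 * (m t x)\<^sup>2) has_real_derivative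
      - 4 * t * a t * (m t x)\<^sup>2 - 2 * L * ((a t)\<^sup>2 * m t x)) (at t)"
    by (rule DERIV_cong[OF DERIV_mult[OF 1 2]]) (simp add: algebra_simps)
  show "((\<lambda>x. (a t)\<^sup>2 * (m t x)\<^sup>2) has_real_derivative
      - 2 * ((a t)\<^sup>2 * m t x) * (x / sqrt (1 + x\<^sup>2))) (at x)"
    by (rule DERIV_cong[OF DERIV_cmult[OF 3]]) (simp add: algebra_simps)
next
  have sq: "sqrt (1 + x\<^sup>2) \<noteq> 0" for x :: real
    by (simp add: add_pos_nonneg less_imp_neq[symmetric])
  show "continuous_on UNIV (\<lambda>z. - 4 * fst z * a (fst z) * (m (fst z) (snd z))\<^sup>2
      - 2 * L * ((a (fst z))\<^sup>2 * m (fst z) (snd z)))"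
    unfolding a_def m_def by (intro continuous_intros)
  show "continuous_on UNIV (\<lambda>z. - 2 * ((a (fst z))\<^sup>2 * m (fst z) (snd z)) * (snd z / sqrt (1 + (snd z)\<^sup>2)))"
    unfolding a_def m_def by (intro continuous_intros ballI sq)
  show "\<exists>Ra e. 0 < e \<and> (\<forall>t x. T - e \<le> t \<or> t \<le> - Ra \<or> Ra \<le> \<bar>x\<bar> \<longrightarrow> (a t)\<^sup>2 * (m t x)\<^sup>2 = 0)"
  proof (intro exI conjI allI impI)
    show "0 < T - T'" using T' by simp
    \<comment> \<open>The time cutoff vanishes for \<open>\<bar>t\<bar> \<ge> T'\<close>. For
      smaller \<open>\<bar>t\<bar>\<close>, negative times included, the cone reaches no further
      than \<open>R + L * T'\<close>.\<close>
    fix t x assume *: "T - (T - T') \<le> t \<or> t \<le> - max T' (R + L * T') \<or> max T' (R + L * T') \<le> \<bar>x\<bar>"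
    show "(a t)\<^sup>2 * (m t x)\<^sup>2 = 0"
    proof (cases "\<bar>t\<bar> \<ge> T'")
      case True
      then have "T'\<^sup>2 \<le> t\<^sup>2" using T' power_mono[of T' "\<bar>t\<bar>" 2] by simp
      then show ?thesis by (simp add: a_def)
    next
      case False
      then have x: "R + L * T' \<le> \<bar>x\<bar>" using * by auto
      have "\<bar>x\<bar> \<le> sqrt (1 + x\<^sup>2)" by (rule real_le_rsqrt) simp
      moreover have "- L * t \<le> L * T'" using False L mult_left_mono[of "- t" T' L] by auto
      ultimately have "m t x = 0" using x by (simp add: m_def)
      then show ?thesis by simp
    qed
  qed
qed

text \<open>Outside the strip a solution is arbitrary and possibly not measurable. Replacing it by 0
  there leaves the integrals unchanged and gives a Borel function on the plane, as Fubini
  requires.\<close>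

lemma entropy_solution_kruzkov_inequality:
  assumes "entropy_solution f T u0 u"
  shows "kruzkov_inequality f T u0 (\<lambda>z. time_strip T z * u (fst z) (snd z))"
  unfolding kruzkov_inequality_def
proof (intro allI impI)
  fix \<phi> \<phi>t \<phi>x k assume \<phi>: "test_fun T \<phi> \<phi>t \<phi>x \<and> (\<forall>t x. 0 \<le> \<phi> t x)"
  have "0 \<le> (LINT z:{0<..<T} \<times> UNIV|lborel.
            \<bar>u (fst z) (snd z) - k\<bar> * \<phi>t (fst z) (snd z)
            + sgn (u (fst z) (snd z) - k) * (f (u (fst z) (snd z)) - f k) * \<phi>x (fst z) (snd z))
        + (LINT x|lborel. \<bar>u0 x - k\<bar> * \<phi> 0 x)"
    using assms \<phi> unfolding entropy_solution_def by blast
  also have "(LINT z:{0<..<T} \<times> UNIV|lborel.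
            \<bar>u (fst z) (snd z) - k\<bar> * \<phi>t (fst z) (snd z)
            + sgn (u (fst z) (snd z) - k) * (f (u (fst z) (snd z)) - f k) * \<phi>x (fst z) (snd z))
     = (LINT z|lborel. time_strip T z * (\<bar>time_strip T z * u (fst z) (snd z) - k\<bar> * \<phi>t (fst z) (snd z)
        + kruzkov_flux f (time_strip T z * u (fst z) (snd z)) k * \<phi>x (fst z) (snd z)))"
    unfolding set_lebesgue_integral_def time_strip_def kruzkov_flux_def
    by (intro Bochner_Integration.integral_cong refl) (auto simp: indicator_def)
  finally show "0 \<le> (LINT z|lborel. time_strip T z * (\<bar>time_strip T z * u (fst z) (snd z) - k\<bar> * \<phi>t (fst z) (snd z)
        + kruzkov_flux f (time_strip T z * u (fst z) (snd z)) k * \<phi>x (fst z) (snd z)))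
        + (LINT x|lborel. \<bar>u0 x - k\<bar> * \<phi> 0 x)" .
qed

lemma locally_lipschitz_of_C1:
  fixes f df :: "real \<Rightarrow> real"
  assumes f: "\<And>u. (f has_real_derivative df u) (at u)" and df: "continuous_on UNIV df"
  obtains L where "L \<ge> 0" "\<And>a b. \<bar>a\<bar> \<le> M \<Longrightarrow> \<bar>b\<bar> \<le> M \<Longrightarrow> \<bar>f a - f b\<bar> \<le> L * \<bar>a - b\<bar>"
proof -
  have "bounded (df ` {-M..M})"
    by (intro compact_imp_bounded compact_continuous_image continuous_on_subset[OF df]) auto
  then obtain L where "\<forall>y\<in>df ` {-M..M}. norm y \<le> L" unfolding bounded_iff by blast
  then have L: "\<bar>df x\<bar> \<le> max 0 L" if "\<bar>x\<bar> \<le> M" for x using that by (auto simp: le_max_iff_disj abs_le_iff)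
  have "\<bar>f a - f b\<bar> \<le> max 0 L * \<bar>a - b\<bar>" if ab: "\<bar>a\<bar> \<le> M" "\<bar>b\<bar> \<le> M" for a b
  proof -
    obtain \<xi> where \<xi>: "min a b \<le> \<xi>" "\<xi> \<le> max a b" "shock_speed f df a b = df \<xi>"
      using secant_slope_eq_deriv[OF f] by blast
    have "f a - f b = df \<xi> * (a - b)"
      unfolding \<xi>(3)[symmetric] by (simp add: shock_speed_def)
    moreover have "\<bar>df \<xi>\<bar> \<le> max 0 L" using \<xi> ab by (intro L) auto
    ultimately show ?thesis by (simp add: abs_mult mult_right_mono)
  qed
  then show thesis using that[of "max 0 L"] by simp
qed

text \<open>With the cone function in the Kato inequality, the term carrying \<open>L\<close> in the
  time derivative absorbs the flux term, because the flux is at most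
  \<open>L * \<bar>v - u\<bar>\<close>. What is left is the integral of
  \<open>\<bar>v - u\<bar>\<close> against a weight positive inside the cone; cones exhaust the
  strip.\<close>

lemma entropy_solution_unique:
  fixes f df u0 :: "real \<Rightarrow> real" and u v :: "real \<Rightarrow> real \<Rightarrow> real"
  assumes f: "\<And>u. (f has_real_derivative df u) (at u)" and df: "continuous_on UNIV df"
    and u: "entropy_solution f T u0 u" and v: "entropy_solution f T u0 v" and T: "T > 0"
    and u0: "u0 \<in> borel_measurable borel" "bounded (range u0)"
    and cont: "AE z in lborel. 0 < fst z \<and> fst z < T \<longrightarrow> (\<forall>\<eta>>0. \<exists>d>0. \<forall>s y.
      fst z < s \<and> s < fst z + d \<and> s < T \<and> snd z < y \<and> y < snd z + d \<longrightarrow> \<bar>u s y - u (fst z) (snd z)\<bar> \<le> \<eta>)"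
    and cont0: "AE x in lborel. \<forall>\<eta>>0. \<exists>d>0. \<forall>s y.
      0 < s \<and> s < d \<and> s < T \<and> x < y \<and> y < x + d \<longrightarrow> \<bar>u s y - u0 x\<bar> \<le> \<eta>"
  shows "AE z in lborel. 0 < fst z \<and> fst z < T \<longrightarrow> v (fst z) (snd z) = u (fst z) (snd z)"
proof -
  let ?\<Omega> = "time_strip T"
  define uu vv where "uu z = ?\<Omega> z * u (fst z) (snd z)" and "vv z = ?\<Omega> z * v (fst z) (snd z)" for z
  have \<Omega>1: "?\<Omega> z = 1" if "0 < fst z" "fst z < T" for z
    using that by (cases z) (simp add: time_strip_def)
  have \<Omega>0: "?\<Omega> z = 0" if "\<not> (0 < fst z \<and> fst z < T)" for z
    using that by (cases z) (auto simp: time_strip_def)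
  have m: "uu \<in> borel_measurable borel" "vv \<in> borel_measurable borel"
    using u v unfolding entropy_solution_def set_borel_measurable_def uu_def[abs_def] vv_def[abs_def] time_strip_def
    by simp_all
  obtain M1 where M1: "\<And>t x. 0 < t \<Longrightarrow> t < T \<Longrightarrow> \<bar>u t x\<bar> \<le> M1"
    using u unfolding entropy_solution_def by blast
  obtain M2 where M2: "\<And>t x. 0 < t \<Longrightarrow> t < T \<Longrightarrow> \<bar>v t x\<bar> \<le> M2"
    using v unfolding entropy_solution_def by blast
  define M where "M = max 0 (max M1 M2)"
  have b: "\<bar>uu z\<bar> \<le> M" "\<bar>vv z\<bar> \<le> M" for z
    using M1[of "fst z" "snd z"] M2[of "fst z" "snd z"] \<Omega>0[of z] \<Omega>1[of z]
    by (cases "0 < fst z \<and> fst z < T"; force simp: uu_def vv_def M_def)+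
  obtain L where L: "L \<ge> 0" "\<And>a b. \<bar>a\<bar> \<le> M \<Longrightarrow> \<bar>b\<bar> \<le> M \<Longrightarrow> \<bar>f a - f b\<bar> \<le> L * \<bar>a - b\<bar>"
    using locally_lipschitz_of_C1[OF f df] by blast
  have cf: "continuous_on UNIV f"
    using f by (meson DERIV_continuous_on has_field_derivative_at_within)
  have fm: "f \<in> borel_measurable borel" by (rule borel_measurable_continuous_onI[OF cf])
  have ku: "kruzkov_inequality f T u0 uu" "kruzkov_inequality f T u0 vv"
    unfolding uu_def[abs_def] vv_def[abs_def]
    by (rule entropy_solution_kruzkov_inequality[OF u] entropy_solution_kruzkov_inequality[OF v])+
  have c: "AE z in lborel. 0 < fst z \<and> fst z < T \<longrightarrow> (\<forall>\<eta>>0. \<exists>d>0. \<forall>s y.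
      fst z < s \<and> s < fst z + d \<and> snd z < y \<and> y < snd z + d \<longrightarrow> \<bar>uu (s, y) - uu z\<bar> \<le> \<eta>)"
    using cont
  proof eventually_elim
    case (elim z)
    show ?case
    proof (intro impI allI)
      fix \<eta> :: real assume z: "0 < fst z \<and> fst z < T" and \<eta>: "0 < \<eta>"
      obtain d where d: "d > 0" "\<And>s y. fst z < s \<and> s < fst z + d \<and> s < T \<and> snd z < y \<and> y < snd z + d
          \<Longrightarrow> \<bar>u s y - u (fst z) (snd z)\<bar> \<le> \<eta>"
        using elim z \<eta> by meson
      \<comment> \<open>The radius \<open>min d (T - fst z)\<close> keeps \<open>s\<close> below
        \<open>T\<close>; beyond it the truncated function is 0 and would be discontinuous.\<close>
      have "\<bar>uu (s, y) - uu z\<bar> \<le> \<eta>"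
        if "fst z < s \<and> s < fst z + min d (T - fst z) \<and> snd z < y \<and> y < snd z + min d (T - fst z)" for s y
      proof -
        have s: "0 < s" "s < T" "s < fst z + d" "y < snd z + d" using that z by auto
        then show ?thesis using d(2)[of s y] that z by (simp add: uu_def \<Omega>1)
      qed
      then show "\<exists>d>0. \<forall>s y. fst z < s \<and> s < fst z + d \<and> snd z < y \<and> y < snd z + d \<longrightarrow> \<bar>uu (s, y) - uu z\<bar> \<le> \<eta>"
        using d(1) z by (intro exI[of _ "min d (T - fst z)"]) auto
    qed
  qed
  have c0: "AE x in lborel. \<forall>\<eta>>0. \<exists>d>0. \<forall>s y.
      0 < s \<and> s < d \<and> x < y \<and> y < x + d \<longrightarrow> \<bar>uu (s, y) - u0 x\<bar> \<le> \<eta>"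
    using cont0
  proof eventually_elim
    case (elim x)
    show ?case
    proof (intro impI allI)
      fix \<eta> :: real assume \<eta>: "0 < \<eta>"
      obtain d where d: "d > 0" "\<And>s y. 0 < s \<and> s < d \<and> s < T \<and> x < y \<and> y < x + d \<Longrightarrow> \<bar>u s y - u0 x\<bar> \<le> \<eta>"
        using elim \<eta> by meson
      have "\<bar>uu (s, y) - u0 x\<bar> \<le> \<eta>" if "0 < s \<and> s < min d T \<and> x < y \<and> y < x + min d T" for s y
      proof -
        have "s < T" "s < d" "y < x + d" using that by auto
        then show ?thesis using d(2)[of s y] that by (simp add: uu_def \<Omega>1)
      qed
      then show "\<exists>d>0. \<forall>s y. 0 < s \<and> s < d \<and> x < y \<and> y < x + d \<longrightarrow> \<bar>uu (s, y) - u0 x\<bar> \<le> \<eta>"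
        using d(1) T by (intro exI[of _ "min d T"]) auto
    qed
  qed
  have cone: "AE z in lborel. 0 < fst z \<and> fst z < T' \<and> sqrt (1 + (snd z)\<^sup>2) + L * fst z < R \<longrightarrow> vv z = uu z"
    if T': "0 < T'" "T' < T" for T' R
  proof -
    define m where "m t x = max 0 (R - sqrt (1 + x\<^sup>2) - L * t)" for t x :: real
    define a where "a t = max 0 (T'\<^sup>2 - t\<^sup>2)" for t :: real
    define \<psi> where "\<psi> t x = (a t)\<^sup>2 * (m t x)\<^sup>2" for t x
    define \<psi>t where "\<psi>t t x = - 4 * t * a t * (m t x)\<^sup>2 - 2 * L * ((a t)\<^sup>2 * m t x)" for t x
    define \<psi>x where "\<psi>x t x = - 2 * ((a t)\<^sup>2 * m t x) * (x / sqrt (1 + x\<^sup>2))" for t x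
    have \<psi>: "test_fun T \<psi> \<psi>t \<psi>x" "\<And>t x. \<psi> t x \<ge> 0"
      using cone_test_fun[OF T' L(1), of R] unfolding \<psi>_def[abs_def] \<psi>t_def[abs_def] \<psi>x_def[abs_def] a_def m_def by simp_all
    \<comment> \<open>The contribution of the time cutoff to the negative time derivative; it
      remains after the cone part has absorbed the flux.\<close>
    define g where "g z = ?\<Omega> z * (\<bar>vv z - uu z\<bar> * (4 * fst z * a (fst z) * (m (fst z) (snd z))\<^sup>2))" for z
    define k where "k z = ?\<Omega> z * (\<bar>vv z - uu z\<bar> * \<psi>t (fst z) (snd z) + kruzkov_flux f (vv z) (uu z) * \<psi>x (fst z) (snd z))" for z
    have g0: "0 \<le> g z" for z
      unfolding g_def by (cases "0 < fst z \<and> fst z < T") (auto simp: \<Omega>0 \<Omega>1 a_def)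
    have kg: "k z \<le> - g z" for z
    proof (cases "0 < fst z \<and> fst z < T")
      case True
      define A where "A = 2 * ((a (fst z))\<^sup>2 * m (fst z) (snd z))"
      have A: "0 \<le> A" by (simp add: A_def m_def)
      define q where "q = snd z / sqrt (1 + (snd z)\<^sup>2)"
      have "\<bar>snd z\<bar> \<le> sqrt (1 + (snd z)\<^sup>2)" by (rule real_le_rsqrt) simp
      then have q: "\<bar>q\<bar> \<le> 1" by (simp add: q_def divide_le_eq_1 abs_divide add_pos_nonneg)
      have F: "\<bar>kruzkov_flux f (vv z) (uu z)\<bar> \<le> L * \<bar>vv z - uu z\<bar>"
        using L(2)[OF b(2)[of z] b(1)[of z]] L(1) by (auto simp: kruzkov_flux_def abs_mult sgn_if)
      have "- (kruzkov_flux f (vv z) (uu z) * q) \<le> \<bar>kruzkov_flux f (vv z) (uu z)\<bar> * \<bar>q\<bar>"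
        by (metis abs_ge_minus_self abs_mult)
      also have "\<dots> \<le> \<bar>kruzkov_flux f (vv z) (uu z)\<bar> * 1" using q by (intro mult_left_mono) auto
      also note F
      finally have "A * (- (kruzkov_flux f (vv z) (uu z) * q)) \<le> A * (L * \<bar>vv z - uu z\<bar>)"
        using A by (intro mult_left_mono) auto
      then have "- (A * (kruzkov_flux f (vv z) (uu z) * q)) - A * (L * \<bar>vv z - uu z\<bar>) \<le> 0" by simp
      moreover have "k z + g z = - (A * (kruzkov_flux f (vv z) (uu z) * q)) - A * (L * \<bar>vv z - uu z\<bar>)"
        using True by (simp add: k_def g_def \<Omega>1 \<psi>t_def \<psi>x_def A_def q_def algebra_simps)
      ultimately show ?thesis by simp
    qed (simp add: k_def g_def \<Omega>0)
    obtain B where B: "bounded B" "\<And>z. z \<notin> B \<Longrightarrow> \<psi> (fst z) (snd z) = 0 \<and> \<psi>t (fst z) (snd z) = 0 \<and> \<psi>x (fst z) (snd z) = 0"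
      using test_fun_support_bounded[OF \<psi>(1)] by blast
    have bu: "bounded (range uu)" "bounded (range vv)" using b unfolding bounded_iff by auto
    have b\<Omega>: "bounded (range ?\<Omega>)" unfolding time_strip_def by (rule bounded_range_real_intros)
    note [measurable] = m fm test_fun_measurable[OF \<psi>(1)]
    have kint: "integrable lborel k"
    proof (rule integrable_bounded_support[OF _ _ B(1)])
      show "k \<in> borel_measurable borel" unfolding k_def[abs_def] kruzkov_flux_def by measurable
      show "bounded (range k)" unfolding k_def
        by (intro bounded_range_real_intros bu b\<Omega> test_fun_bounded[OF \<psi>(1)] kruzkov_flux_bounded[OF cf])
      show "k z = 0" if "z \<notin> B" for z using B(2)[OF that] by (simp add: k_def)
    qed
    have gint: "integrable lborel g"
    proof (rule integrable_bounded_support[OF _ _ B(1)])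
      define r where "r z = 4 * fst z * a (fst z) * (m (fst z) (snd z))\<^sup>2" for z
      have cr: "continuous_on UNIV r"
        unfolding r_def a_def m_def by (intro continuous_intros)
      have r0: "r z = 0" if "z \<notin> B" for z
        using B(2)[OF that] by (auto simp: \<psi>_def r_def)
      have gr: "g z = ?\<Omega> z * (\<bar>vv z - uu z\<bar> * r z)" for z by (simp add: g_def r_def)
      have [measurable]: "r \<in> borel_measurable borel" by (rule borel_measurable_continuous_onI[OF cr])
      show "g \<in> borel_measurable borel" unfolding gr[abs_def] by measurable
      show "bounded (range g)" unfolding gr
        by (intro bounded_range_real_intros bu b\<Omega> continuous_bounded_support_bounded_range[OF cr B(1)] r0)
      show "g z = 0" if "z \<notin> B" for z using r0[OF that] by (simp add: gr)
    qed
    have "0 \<le> integral\<^sup>L lborel k"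
      using kruzkov_kato[OF cf m(1) b(1) m(2) b(2) u0 L(2,1) ku c c0 \<psi>] unfolding k_def[abs_def] by simp
    also have "\<dots> \<le> (LINT z|lborel. - g z)"
      by (intro integral_mono kint Bochner_Integration.integrable_minus gint kg)
    finally have "integral\<^sup>L lborel g \<le> 0" by simp
    moreover have "0 \<le> integral\<^sup>L lborel g" by (intro Bochner_Integration.integral_nonneg g0)
    ultimately have "integral\<^sup>L lborel g = 0" by simp
    then have "AE z in lborel. g z = 0"
      using integral_nonneg_eq_0_iff_AE[OF gint] g0 by simp
    then show ?thesis
    proof eventually_elim
      case (elim z)
      show ?case
      proof
        assume z: "0 < fst z \<and> fst z < T' \<and> sqrt (1 + (snd z)\<^sup>2) + L * fst z < R"
        then have "(fst z)\<^sup>2 < T'\<^sup>2" by (intro power_strict_mono) auto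
        then have "a (fst z) > 0" "m (fst z) (snd z) > 0" using z by (auto simp: a_def m_def)
        then show "vv z = uu z"
          using elim z T' by (auto simp: g_def \<Omega>1)
      qed
    qed
  qed
  \<comment> \<open>Countably many cones preserve the almost-everywhere statement. The summand 2
    keeps the height \<open>T - T / (n + 2)\<close> positive already for
    \<open>n = 0\<close>.\<close>
  have "AE z in lborel. \<forall>n. 0 < fst z \<and> fst z < T - T / (real n + 2) \<and>
      sqrt (1 + (snd z)\<^sup>2) + L * fst z < real n \<longrightarrow> vv z = uu z"
    unfolding AE_all_countable
  proof
    fix n
    have "T * 1 < T * (real n + 2)" using T by (intro mult_strict_left_mono) auto
    then show "AE z in lborel. 0 < fst z \<and> fst z < T - T / (real n + 2) \<and>
      sqrt (1 + (snd z)\<^sup>2) + L * fst z < real n \<longrightarrow> vv z = uu z"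
      using T by (intro cone) (simp_all add: field_simps)
  qed
  then show ?thesis
  proof eventually_elim
    case (elim z)
    show ?case
    proof
      assume z: "0 < fst z \<and> fst z < T"
      obtain n where n: "real n > max (T / (T - fst z)) (sqrt (1 + (snd z)\<^sup>2) + L * fst z)"
        using reals_Archimedean2 by blast
      then have "T < (real n) * (T - fst z)" using z by (simp add: divide_less_eq)
      also have "\<dots> \<le> (real n + 2) * (T - fst z)" using z by (intro mult_right_mono) auto
      finally have "T / (real n + 2) < T - fst z" by (simp add: divide_less_eq mult.commute)
      then have "vv z = uu z" using elim[rule_format, of n] n z by simp
      then show "v (fst z) (snd z) = u (fst z) (snd z)" using z by (simp add: vv_def uu_def \<Omega>1)
    qed
  qed
qed

section \<open>Green's formula next to a moving curve\<close>

lemma half_line_integral: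
  fixes G :: "real \<Rightarrow> real"
  assumes G: "continuous_on {c..c + B} G" and B: "\<And>x. x > c + B \<Longrightarrow> G x = 0"
  shows "(LINT x|lborel. (if c \<le> x then G x else 0)) = integral {0..B} (\<lambda>y. G (y + c))"
proof -
  have "continuous_on {0..B} (\<lambda>y. G (y + c))"
    by (rule continuous_on_compose2[OF G]) (auto intro!: continuous_intros)
  then have int: "set_integrable lborel {0..B} (\<lambda>y. G (y + c))"
    by (rule borel_integrable_atLeastAtMost')
  have "(LINT x|lborel. (if c \<le> x then G x else 0)) = (LINT y|lborel. (if c \<le> c + 1 * y then G (c + 1 * y) else 0))"
    by (subst lborel_integral_real_affine[of 1 _ c]) simp_all
  also have "\<dots> = (LINT y:{0..B}|lborel. G (y + c))"
    unfolding set_lebesgue_integral_def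
    by (intro Bochner_Integration.integral_cong refl) (auto simp: indicator_def add.commute B)
  also have "\<dots> = integral {0..B} (\<lambda>y. G (y + c))"
    by (rule set_borel_integral_eq_integral[OF int])
  finally show ?thesis .
qed

text \<open>In the moving frame \<open>y = x - X(t)\<close> the integrand \<open>\<Phi>\<^sub>x \<phi>\<^sub>t - \<Phi>\<^sub>t \<phi>\<^sub>x\<close> keeps its form. Neither factor
  has second derivatives: the time derivative of \<open>\<integral>\<Phi>\<^sub>x \<phi>\<close> is computed with separate times for both factors,
  after an integration by parts in the one where \<open>\<Phi>\<close> varies.\<close>

lemma green_right_of_curve:
  fixes \<Phi> \<Phi>t \<Phi>x :: "real \<Rightarrow> real \<Rightarrow> real" and X S :: "real \<Rightarrow> real"
  assumes T: "T > 0"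
    and \<Phi>t: "\<And>t x. t \<in> {0..T} \<Longrightarrow> ((\<lambda>s. \<Phi> s x) has_real_derivative \<Phi>t t x) (at t within {0..T})"
    and \<Phi>x: "\<And>t x. t \<in> {0..T} \<Longrightarrow> (\<Phi> t has_real_derivative \<Phi>x t x) (at x)"
    and c\<Phi>t: "continuous_on ({0..T} \<times> UNIV) (\<lambda>z. \<Phi>t (fst z) (snd z))"
    and c\<Phi>x: "continuous_on ({0..T} \<times> UNIV) (\<lambda>z. \<Phi>x (fst z) (snd z))"
    and X: "\<And>t. t \<in> {0..T} \<Longrightarrow> (X has_real_derivative S t) (at t within {0..T})"
    and cX: "continuous_on UNIV X" and cS: "continuous_on {0..T} S"
    and \<phi>: "test_fun T \<phi> \<phi>t \<phi>x"
  shows "integrable lborel (\<lambda>z. time_strip T z * (if X (fst z) \<le> snd z then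
      \<Phi>x (fst z) (snd z) * \<phi>t (fst z) (snd z) - \<Phi>t (fst z) (snd z) * \<phi>x (fst z) (snd z) else 0))" (is ?int)
    and "(LINT z|lborel. time_strip T z * (if X (fst z) \<le> snd z then
        \<Phi>x (fst z) (snd z) * \<phi>t (fst z) (snd z) - \<Phi>t (fst z) (snd z) * \<phi>x (fst z) (snd z) else 0))
      + (LINT x|lborel. (if X 0 \<le> x then \<Phi>x 0 x * \<phi> 0 x else 0))
      = integral {0..T} (\<lambda>t. (\<Phi>t t (X t) + S t * \<Phi>x t (X t)) * \<phi> t (X t))" (is ?eq)
proof -
  obtain R e where R: "R > 0" "e > 0" and van: "\<And>t x. t \<ge> T - e \<or> t \<le> - R \<or> \<bar>x\<bar> \<ge> R \<Longrightarrow>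
      \<phi> t x = 0 \<and> \<phi>t t x = 0 \<and> \<phi>x t x = 0"
    using test_fun_vanishes[OF \<phi>] by blast
  note d\<phi> = test_fun_deriv[OF \<phi>]
  have "compact (X ` {0..T})" by (intro compact_continuous_image continuous_on_subset[OF cX]) auto
  then obtain b where "\<forall>y\<in>X ` {0..T}. norm y \<le> b" using compact_imp_bounded bounded_iff by metis
  then have b: "\<bar>X t\<bar> \<le> b" if "t \<in> {0..T}" for t using that by simp
  \<comment> \<open>In the moving frame \<open>[0, B]\<close> contains the support to the right of
    the curve at every time, so all integrals run over one fixed interval.\<close>
  define B where "B = R + b"
  have B0: "B \<ge> 0" using b[of 0] T R(1) by (simp add: B_def)
  have far: "R \<le> \<bar>y + X t\<bar>" if "t \<in> {0..T}" "y \<ge> B" for t y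
    using b[OF that(1)] that(2) by (auto simp: B_def)
  define D Dt Dx where "D t y = \<Phi> t (y + X t)" and "Dt t y = \<Phi>t t (y + X t) + S t * \<Phi>x t (y + X t)"
    and "Dx t y = \<Phi>x t (y + X t)" for t y
  define p pt px where "p t y = \<phi> t (y + X t)" and "pt t y = \<phi>t t (y + X t) + S t * \<phi>x t (y + X t)"
    and "px t y = \<phi>x t (y + X t)" for t y
  have dX: "((\<lambda>s. y + X s) has_real_derivative S t) (at t within {0..T})" if "t \<in> {0..T}" for t y
    using DERIV_add[OF DERIV_const X[OF that]] by simp
  have dD: "((\<lambda>s. D s y) has_real_derivative Dt t y) (at t within {0..T})" if "t \<in> {0..T}" for t y
    unfolding D_def Dt_def
    using has_real_derivative_along_curve[where B = UNIV, OF \<Phi>t \<Phi>x c\<Phi>x convex_UNIV _ dX[OF that] that] by simp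
  have dp: "((\<lambda>s. p s y) has_real_derivative pt t y) (at t within {0..T})" if "t \<in> {0..T}" for t y
    unfolding p_def pt_def
    using has_real_derivative_along_curve[where B = UNIV and A = "{0..T}",
        OF has_field_derivative_at_within[OF d\<phi>(1)] d\<phi>(2) continuous_on_subset[OF d\<phi>(4)] convex_UNIV _ dX[OF that] that]
    by simp
  have shift: "((\<lambda>y. F (y + c)) has_real_derivative F') (at y)" if "(F has_real_derivative F') (at (y + c))"
    for F F' and c y :: real
    using that by (simp add: DERIV_shift)
  have dDx: "(D t has_real_derivative Dx t y) (at y)" if "t \<in> {0..T}" for t y
    unfolding D_def[abs_def] Dx_def by (rule shift[OF \<Phi>x[OF that]])
  have dpx: "(p t has_real_derivative px t y) (at y)" for t y
    unfolding p_def[abs_def] px_def by (rule shift[OF d\<phi>(2)])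
  have frame: "continuous_on ({0..T} \<times> UNIV) (\<lambda>z. (fst z, snd z + X (fst z)))"
    by (intro continuous_intros continuous_on_compose2[OF cX]) auto
  have mv: "continuous_on ({0..T} \<times> UNIV) (\<lambda>z. F (fst z) (snd z + X (fst z)))"
    if "continuous_on ({0..T} \<times> UNIV) (\<lambda>z. F (fst z) (snd z))" for F :: "real \<Rightarrow> real \<Rightarrow> real"
    using continuous_on_compose2[OF that frame] by force
  have cS': "continuous_on ({0..T} \<times> (UNIV::real set)) (\<lambda>z. S (fst z))"
    by (rule continuous_on_compose2[OF cS]) (auto intro!: continuous_intros)
  have c\<phi>: "continuous_on ({0..T} \<times> UNIV) (\<lambda>z. \<phi> (fst z) (snd z))"
    "continuous_on ({0..T} \<times> UNIV) (\<lambda>z. \<phi>t (fst z) (snd z))"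
    "continuous_on ({0..T} \<times> UNIV) (\<lambda>z. \<phi>x (fst z) (snd z))"
    using continuous_on_subset[OF test_fun_continuous[OF \<phi>]] continuous_on_subset[OF d\<phi>(3)]
      continuous_on_subset[OF d\<phi>(4)] by blast+
  have cont: "continuous_on ({0..T} \<times> UNIV) (\<lambda>z. Dt (fst z) (snd z))"
    "continuous_on ({0..T} \<times> UNIV) (\<lambda>z. Dx (fst z) (snd z))"
    "continuous_on ({0..T} \<times> UNIV) (\<lambda>z. p (fst z) (snd z))"
    "continuous_on ({0..T} \<times> UNIV) (\<lambda>z. pt (fst z) (snd z))"
    "continuous_on ({0..T} \<times> UNIV) (\<lambda>z. px (fst z) (snd z))"
    unfolding Dt_def Dx_def p_def pt_def px_def
    by (intro continuous_intros cS' mv[OF c\<Phi>t] mv[OF c\<Phi>x] mv[OF c\<phi>(1)] mv[OF c\<phi>(2)] mv[OF c\<phi>(3)])+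
  have cD: "continuous_on ({0..T} \<times> UNIV) (\<lambda>z. D (fst z) (snd z))"
  proof -
    have "continuous_on ({0..T} \<times> UNIV) (\<lambda>z. \<Phi> (fst z) (snd z))"
      unfolding continuous_on_eq_continuous_within
      using has_derivative_continuous[OF C1_partials_has_derivative[where A = "{0..T}" and B = UNIV, OF \<Phi>t \<Phi>x c\<Phi>x]]
      by auto
    then show ?thesis unfolding D_def by (rule mv)
  qed
  have comp: "continuous_on U (\<lambda>w. F (a w) (c w))"
    if "continuous_on ({0..T} \<times> UNIV) (\<lambda>z. F (fst z) (snd z))" "continuous_on U a" "continuous_on U c"
      "a ` U \<subseteq> {0..T}" for F :: "real \<Rightarrow> real \<Rightarrow> real" and U :: "'x::topological_space set" and a c
    using continuous_on_compose2[OF that(1) continuous_on_Pair[OF that(2,3)]] that(4) by force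
  \<comment> \<open>Time is split in two: \<open>\<tau>\<close> moves the potential and
    \<open>t\<close> the test function.\<close>
  define Bf where "Bf t \<tau> = integral {0..B} (\<lambda>y. Dx \<tau> y * p t y)" for t \<tau>
  have Bft: "((\<lambda>t. Bf t \<tau>) has_real_derivative integral {0..B} (\<lambda>y. Dx \<tau> y * pt t y)) (at t within {0..T})"
    if t: "t \<in> {0..T}" and \<tau>: "\<tau> \<in> {0..T}" for t \<tau>
    unfolding Bf_def interval_cbox[of 0 B]
  proof (rule leibniz_rule_field_derivative[where fx = "\<lambda>t y. Dx \<tau> y * pt t y"])
    show "((\<lambda>x. Dx \<tau> y * p x y) has_real_derivative Dx \<tau> y * pt x y) (at x within {0..T})"
      if "x \<in> {0..T}" for x y by (rule DERIV_cmult[OF dp[OF that]])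
    show "(\<lambda>y. Dx \<tau> y * p x y) integrable_on cbox 0 B" if "x \<in> {0..T}" for x
      using \<tau> that by (intro integrable_continuous continuous_intros comp[OF cont(2)] comp[OF cont(3)]) auto
    show "continuous_on ({0..T} \<times> cbox 0 B) (\<lambda>(x, y). Dx \<tau> y * pt x y)"
      unfolding case_prod_beta
      using \<tau> by (intro continuous_intros comp[OF cont(2)] comp[OF cont(4)]) auto
  qed (use t in auto)
  \<comment> \<open>The mixed second derivative that \<open>\<tau>\<close> would produce from
    \<open>Dx\<close> is avoided: after integration by parts only \<open>D\<close> carries
    \<open>\<tau>\<close>, and \<open>D\<close> is differentiable in time. The boundary value at
    \<open>0\<close> becomes the term on the curve.\<close>
  have parts: "Bf t \<tau> = - (D \<tau> 0 * p t 0) - integral {0..B} (\<lambda>y. D \<tau> y * px t y)"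
    if t: "t \<in> {0..T}" and \<tau>: "\<tau> \<in> {0..T}" for t \<tau>
  proof -
    have i1: "(\<lambda>y. Dx \<tau> y * p t y) integrable_on {0..B}"
      using t \<tau> by (intro integrable_continuous_interval continuous_intros comp[OF cont(2)] comp[OF cont(3)]) auto
    have i2: "(\<lambda>y. D \<tau> y * px t y) integrable_on {0..B}"
      using t \<tau> by (intro integrable_continuous_interval continuous_intros comp[OF cD] comp[OF cont(5)]) auto
    have "((\<lambda>y. Dx \<tau> y * p t y + px t y * D \<tau> y) has_integral D \<tau> B * p t B - D \<tau> 0 * p t 0) {0..B}"
    proof (rule fundamental_theorem_of_calculus[OF B0])
      show "((\<lambda>y. D \<tau> y * p t y) has_vector_derivative Dx \<tau> y * p t y + px t y * D \<tau> y) (at y within {0..B})" for y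
        using DERIV_mult[OF dDx[OF \<tau>, of y] dpx[of t y]]
        by (simp add: has_real_derivative_iff_has_vector_derivative has_vector_derivative_at_within)
    qed
    moreover have "p t B = 0" using van[of t "B + X t"] far[OF t order_refl] by (simp add: p_def)
    ultimately have "integral {0..B} (\<lambda>y. Dx \<tau> y * p t y + D \<tau> y * px t y) = - (D \<tau> 0 * p t 0)"
      by (simp add: mult.commute[of "px t _"] integral_unique)
    then show ?thesis using integral_add[OF i1 i2] by (simp add: Bf_def)
  qed
  have Bf\<tau>: "((\<lambda>\<tau>. Bf t \<tau>) has_real_derivative - (Dt \<tau> 0 * p t 0) - integral {0..B} (\<lambda>y. Dt \<tau> y * px t y)) (at \<tau> within {0..T})"
    if t: "t \<in> {0..T}" and \<tau>: "\<tau> \<in> {0..T}" for t \<tau>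
  proof -
    have "((\<lambda>\<tau>. integral (cbox 0 B) (\<lambda>y. D \<tau> y * px t y)) has_real_derivative
        integral (cbox 0 B) (\<lambda>y. Dt \<tau> y * px t y)) (at \<tau> within {0..T})"
    proof (rule leibniz_rule_field_derivative[where fx = "\<lambda>\<tau> y. Dt \<tau> y * px t y"])
      show "((\<lambda>x. D x y * px t y) has_real_derivative Dt x y * px t y) (at x within {0..T})"
        if "x \<in> {0..T}" for x y by (rule DERIV_cmult_right[OF dD[OF that]])
      show "(\<lambda>y. D x y * px t y) integrable_on cbox 0 B" if "x \<in> {0..T}" for x
        using t that by (intro integrable_continuous continuous_intros comp[OF cD] comp[OF cont(5)]) auto
      show "continuous_on ({0..T} \<times> cbox 0 B) (\<lambda>(x, y). Dt x y * px t y)"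
        unfolding case_prod_beta
        using t by (intro continuous_intros comp[OF cont(1)] comp[OF cont(5)]) auto
    qed (use \<tau> in auto)
    then have "((\<lambda>\<tau>. - (D \<tau> 0 * p t 0) - integral {0..B} (\<lambda>y. D \<tau> y * px t y)) has_real_derivative
        - (Dt \<tau> 0 * p t 0) - integral {0..B} (\<lambda>y. Dt \<tau> y * px t y)) (at \<tau> within {0..T})"
      by (intro DERIV_diff DERIV_minus DERIV_cmult_right dD \<tau>) simp
    then show ?thesis
      by (rule has_field_derivative_transform_within[OF _ zero_less_one \<tau>]) (use parts[OF t] in simp)
  qed
  define I where "I t = integral {0..B} (\<lambda>y. Dx t y * pt t y - Dt t y * px t y)" for t
  have dA: "((\<lambda>t. Bf t t) has_real_derivative I t - Dt t 0 * p t 0) (at t within {0..T})" if t: "t \<in> {0..T}" for t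
  proof -
    have c\<tau>: "continuous_on ({0..T} \<times> {0..T}) (\<lambda>z. - (Dt (snd z) 0 * p (fst z) 0)
        - integral {0..B} (\<lambda>y. Dt (snd z) y * px (fst z) y))"
    proof -
      have "continuous_on ({0..T} \<times> {0..T}) (\<lambda>z. integral (cbox 0 B) (\<lambda>y. Dt (snd z) y * px (fst z) y))"
      proof (rule integral_continuous_on_param)
        show "continuous_on (({0..T} \<times> {0..T}) \<times> cbox 0 B) (\<lambda>(z, y). Dt (snd z) y * px (fst z) y)"
          unfolding case_prod_beta by (intro continuous_intros comp[OF cont(1)] comp[OF cont(5)]) auto
      qed
      moreover have "continuous_on ({0..T} \<times> {0..T}) (\<lambda>z. Dt (snd z) 0 * p (fst z) 0)"
        by (intro continuous_intros comp[OF cont(1)] comp[OF cont(3)]) auto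
      ultimately show ?thesis by (intro continuous_on_diff continuous_on_minus) simp_all
    qed
    \<comment> \<open>The chain rule along the curve \<open>t\<close>, \<open>\<tau> = t\<close>; it
      relies on the joint continuity of the derivative in \<open>\<tau>\<close> shown just
      before.\<close>
    have "((\<lambda>t. Bf t t) has_real_derivative integral {0..B} (\<lambda>y. Dx t y * pt t y)
        + 1 * (- (Dt t 0 * p t 0) - integral {0..B} (\<lambda>y. Dt t y * px t y))) (at t within {0..T})"
      by (rule has_real_derivative_along_curve[where B = "{0..T}" and c = "\<lambda>t. t", OF Bft Bf\<tau> c\<tau>])
        (use t in \<open>auto intro!: derivative_eq_intros\<close>)
    moreover have "I t = integral {0..B} (\<lambda>y. Dx t y * pt t y) - integral {0..B} (\<lambda>y. Dt t y * px t y)"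
      unfolding I_def
      by (intro integral_diff integrable_continuous_interval continuous_intros
          comp[OF cont(1)] comp[OF cont(2)] comp[OF cont(4)] comp[OF cont(5)]) (use t in auto)
    ultimately show ?thesis by (elim DERIV_cong) simp
  qed
  have cI: "continuous_on {0..T} I"
    unfolding I_def interval_cbox[of 0 B]
    by (rule integral_continuous_on_param, unfold case_prod_beta)
      (intro continuous_intros comp[OF cont(1)] comp[OF cont(2)] comp[OF cont(4)] comp[OF cont(5)]; force)
  have cb: "continuous_on {0..T} (\<lambda>t. Dt t 0 * p t 0)"
    by (intro continuous_intros comp[OF cont(1)] comp[OF cont(3)]) auto
  have "((\<lambda>t. I t - Dt t 0 * p t 0) has_integral Bf T T - Bf 0 0) {0..T}"
    by (rule fundamental_theorem_of_calculus)
      (use T dA in \<open>auto simp: has_real_derivative_iff_has_vector_derivative[symmetric]\<close>)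
  moreover have "Bf T T = 0"
    using van[of T] R(2) by (simp add: Bf_def p_def)
  ultimately have I: "integral {0..T} I + Bf 0 0 = integral {0..T} (\<lambda>t. Dt t 0 * p t 0)"
    using integral_diff[OF integrable_continuous_interval[OF cI] integrable_continuous_interval[OF cb]]
    by (simp add: integral_unique)
  define q where "q t x = \<Phi>x t x * \<phi>t t x - \<Phi>t t x * \<phi>x t x" for t x
  define F where "F z = time_strip T z * (if X (fst z) \<le> snd z then q (fst z) (snd z) else 0)" for z
  have cq: "continuous_on ({0..T} \<times> UNIV) (\<lambda>z. q (fst z) (snd z))"
    unfolding q_def by (intro continuous_intros c\<Phi>t c\<Phi>x c\<phi>)
  have q0: "q t x = 0" if "\<bar>x\<bar> \<ge> R" for t x using van[of t x] that by (simp add: q_def)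
  have Fint: "integrable lborel F"
  proof (rule integrable_bounded_support[where B = "{0..T} \<times> {-R..R}"])
    have "(\<lambda>z. indicator ({0..T} \<times> UNIV) z *\<^sub>R q (fst z) (snd z)) \<in> borel_measurable borel"
      by (intro borel_measurable_continuous_on_indicator cq borel_closed closed_Times) auto
    moreover have "{z. X (fst z) \<le> snd z} \<in> sets borel"
      by (intro borel_closed closed_Collect_le continuous_intros continuous_on_compose2[OF cX]) auto
    moreover have "{0<..<T} \<times> (UNIV :: real set) \<in> sets borel" by (intro borel_open open_Times) auto
    ultimately have "(\<lambda>z. indicator ({0<..<T} \<times> UNIV) z * (indicator {z. X (fst z) \<le> snd z} z
        * (indicator ({0..T} \<times> UNIV) z *\<^sub>R q (fst z) (snd z)))) \<in> borel_measurable borel"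
      by (intro borel_measurable_times borel_measurable_indicator)
    moreover have "F = (\<lambda>z. indicator ({0<..<T} \<times> UNIV) z * (indicator {z. X (fst z) \<le> snd z} z
        * (indicator ({0..T} \<times> UNIV) z *\<^sub>R q (fst z) (snd z))))"
      by (rule ext) (auto simp: F_def time_strip_def indicator_def)
    ultimately show "F \<in> borel_measurable borel" by simp
    have "compact ((\<lambda>z. q (fst z) (snd z)) ` ({0..T} \<times> {-R..R}))"
      by (intro compact_continuous_image continuous_on_subset[OF cq] compact_Times) auto
    then have "bounded (insert 0 ((\<lambda>z. q (fst z) (snd z)) ` ({0..T} \<times> {-R..R})))"
      by (simp add: compact_imp_bounded)
    moreover have "range F \<subseteq> insert 0 ((\<lambda>z. q (fst z) (snd z)) ` ({0..T} \<times> {-R..R}))"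
    proof
      fix w assume "w \<in> range F"
      then obtain z where w: "w = F z" by blast
      show "w \<in> insert 0 ((\<lambda>z. q (fst z) (snd z)) ` ({0..T} \<times> {-R..R}))"
      proof (cases "z \<in> {0<..<T} \<times> {-R..R} \<and> X (fst z) \<le> snd z")
        case True
        then have "z \<in> {0..T} \<times> {-R..R}" "F z = q (fst z) (snd z)"
          by (auto simp: F_def time_strip_def indicator_def mem_Times_iff)
        then show ?thesis using w by blast
      next
        case False
        then have "F z = 0"
          using q0[of "snd z" "fst z"] by (auto simp: F_def time_strip_def indicator_def mem_Times_iff)
        then show ?thesis using w by simp
      qed
    qed
    ultimately show "bounded (range F)" by (rule bounded_subset)
    show "bounded ({0..T} \<times> {-R..R})" by (intro bounded_Times) auto
    show "F z = 0" if "z \<notin> {0..T} \<times> {-R..R}" for z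
      using that q0[of "snd z" "fst z"] by (auto simp: F_def time_strip_def indicator_def mem_Times_iff)
  qed
  then show ?int unfolding F_def[abs_def] q_def .
  have inner: "(LINT x|lborel. (if X t \<le> x then q t x else 0)) = I t" if t: "t \<in> {0..T}" for t
  proof -
    have "(LINT x|lborel. (if X t \<le> x then q t x else 0)) = integral {0..B} (\<lambda>y. q t (y + X t))"
    proof (rule half_line_integral)
      show "continuous_on {X t..X t + B} (q t)"
        using t by (intro comp[OF cq]) (auto intro!: continuous_intros)
      show "q t x = 0" if "x > X t + B" for x
        using q0[of x t] far[OF t, of "x - X t"] that by simp
    qed
    \<comment> \<open>The contributions of the frame velocity \<open>S\<close> to \<open>pt\<close>
      and \<open>Dt\<close> cancel in the antisymmetric expression.\<close>
    also have "(\<lambda>y. q t (y + X t)) = (\<lambda>y. Dx t y * pt t y - Dt t y * px t y)"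
      by (rule ext) (simp add: q_def Dx_def pt_def Dt_def px_def algebra_simps)
    finally show ?thesis by (simp add: I_def)
  qed
  have "integral\<^sup>L lborel F = (LINT t|lborel. LINT x|lborel. F (t, x))"
    by (rule lborel_Fubini(1)[OF Fint, symmetric])
  also have "\<dots> = (LINT t:{0<..<T}|lborel. I t)"
    unfolding set_lebesgue_integral_def
  proof (intro Bochner_Integration.integral_cong refl)
    fix t
    show "(LINT x|lborel. F (t, x)) = indicator {0<..<T} t *\<^sub>R I t"
      using inner[of t] by (cases "t \<in> {0<..<T}") (simp_all add: F_def time_strip_def cong: if_cong)
  qed
  also have "\<dots> = integral {0<..<T} I"
  proof (rule set_borel_integral_eq_integral)
    have "set_integrable lborel {0..T} I" by (rule borel_integrable_atLeastAtMost'[OF cI])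
    then show "set_integrable lborel {0<..<T} I" by (rule set_integrable_subset) auto
  qed
  also have "\<dots> = integral {0..T} I" by (rule integral_open_interval_real[symmetric])
  finally have 1: "integral\<^sup>L lborel F = integral {0..T} I" .
  have 2: "(LINT x|lborel. (if X 0 \<le> x then \<Phi>x 0 x * \<phi> 0 x else 0)) = Bf 0 0"
  proof -
    have "(LINT x|lborel. (if X 0 \<le> x then \<Phi>x 0 x * \<phi> 0 x else 0)) = integral {0..B} (\<lambda>y. \<Phi>x 0 (y + X 0) * \<phi> 0 (y + X 0))"
    proof (rule half_line_integral)
      show "continuous_on {X 0..X 0 + B} (\<lambda>x. \<Phi>x 0 x * \<phi> 0 x)"
        using T by (intro continuous_intros comp[OF c\<Phi>x] comp[OF c\<phi>(1)]) auto
      show "\<Phi>x 0 x * \<phi> 0 x = 0" if "x > X 0 + B" for x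
        using van[of 0 x] far[of 0 "x - X 0"] that T by simp
    qed
    then show ?thesis by (simp add: Bf_def Dx_def p_def)
  qed
  have "(\<lambda>t. Dt t 0 * p t 0) = (\<lambda>t. (\<Phi>t t (X t) + S t * \<Phi>x t (X t)) * \<phi> t (X t))"
    by (simp add: Dt_def p_def)
  then show ?eq using I 1 2 unfolding F_def[abs_def] q_def by simp
qed

section \<open>Piecewise solutions separated by shock fronts\<close>

text \<open>Strips are numbered from 0 to \<open>n\<close>, strip \<open>i\<close> lying between the
  paths \<open>i\<close> and \<open>i + 1\<close>. The equations for \<open>\<alpha>\<close> and
  \<open>\<beta>\<close> say that \<open>W = \<alpha> + \<beta> * x\<close> solves
  \<open>W_t + W * W_x = 0\<close>. Paths and coefficients are continuous for all real times, which
  gives globally measurable formulas; the differential equations hold on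
  \<open>[0, T]\<close>.\<close>

locale shock_fronts =
  fixes f df ddf g :: "real \<Rightarrow> real" and T c d :: real and n :: nat
    and X S \<alpha> \<beta> :: "nat \<Rightarrow> real \<Rightarrow> real"
  assumes T: "0 < T"
    and f_deriv: "\<And>u. (f has_real_derivative df u) (at u)"
    and df_deriv: "\<And>u. (df has_real_derivative ddf u) (at u)"
    and cd: "c \<le> d"
    and g_cont: "continuous_on UNIV g"
    and g_range: "\<And>z. g z \<in> {c..d}"
    and g_inverse: "\<And>w. w \<in> {c..d} \<Longrightarrow> g (df w) = w"
    and X_cont: "\<And>i. continuous_on UNIV (X i)"
    and X_deriv: "\<And>i t. i \<in> {1..n} \<Longrightarrow> t \<in> {0..T} \<Longrightarrow> (X i has_real_derivative S i t) (at t within {0..T})"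
    and S_cont: "\<And>i. i \<in> {1..n} \<Longrightarrow> continuous_on {0..T} (S i)"
    and X_ordered: "\<And>i t. 1 \<le> i \<Longrightarrow> i < n \<Longrightarrow> t \<in> {0..T} \<Longrightarrow> X i t < X (Suc i) t"
    and \<alpha>_cont: "\<And>i. continuous_on UNIV (\<alpha> i)" and \<beta>_cont: "\<And>i. continuous_on UNIV (\<beta> i)"
    and \<alpha>_deriv: "\<And>i t. i \<le> n \<Longrightarrow> t \<in> {0..T} \<Longrightarrow> (\<alpha> i has_real_derivative - \<alpha> i t * \<beta> i t) (at t within {0..T})"
    and \<beta>_deriv: "\<And>i t. i \<le> n \<Longrightarrow> t \<in> {0..T} \<Longrightarrow> (\<beta> i has_real_derivative - (\<beta> i t)\<^sup>2) (at t within {0..T})"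
    and strip_range: "\<And>i t x. i \<le> n \<Longrightarrow> t \<in> {0..T} \<Longrightarrow> (1 \<le> i \<Longrightarrow> X i t \<le> x) \<Longrightarrow> (i < n \<Longrightarrow> x \<le> X (Suc i) t) \<Longrightarrow>
        \<alpha> i t + \<beta> i t * x \<in> df ` {c..d}"
    and rankine_hugoniot: "\<And>i t. i \<in> {1..n} \<Longrightarrow> t \<in> {0..T} \<Longrightarrow>
        S i t * (g (\<alpha> i t + \<beta> i t * X i t) - g (\<alpha> (i - 1) t + \<beta> (i - 1) t * X i t))
        = f (g (\<alpha> i t + \<beta> i t * X i t)) - f (g (\<alpha> (i - 1) t + \<beta> (i - 1) t * X i t))"
    and dissipation: "\<And>i t k. i \<in> {1..n} \<Longrightarrow> t \<in> {0..T} \<Longrightarrow>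
        0 \<le> S i t * (\<bar>g (\<alpha> i t + \<beta> i t * X i t) - k\<bar> - \<bar>g (\<alpha> (i - 1) t + \<beta> (i - 1) t * X i t) - k\<bar>)
        - (kruzkov_flux f (g (\<alpha> i t + \<beta> i t * X i t)) k - kruzkov_flux f (g (\<alpha> (i - 1) t + \<beta> (i - 1) t * X i t)) k)"
begin

definition W :: "nat \<Rightarrow> real \<Rightarrow> real \<Rightarrow> real" where
  "W i t x = \<alpha> i t + \<beta> i t * x"

text \<open>As the paths are ordered, counting those at or to the left of \<open>x\<close> yields
  the index of the strip containing \<open>x\<close>; a point on a path is assigned to the strip on
  its right.\<close>

definition passed :: "real \<Rightarrow> real \<Rightarrow> nat" where
  "passed t x = card {i \<in> {1..n}. X i t \<le> x}"

definition fan :: "real \<Rightarrow> real \<Rightarrow> real" where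
  "fan t x = g (W (passed t x) t x)"

lemma X_strict_mono: "t \<in> {0..T} \<Longrightarrow> 1 \<le> i \<Longrightarrow> i < j \<Longrightarrow> j \<le> n \<Longrightarrow> X i t < X j t"
  by (rule stepwise_increasing_less[of n "\<lambda>i. X i t"]) (auto intro: X_ordered)

lemma X_mono: "t \<in> {0..T} \<Longrightarrow> 1 \<le> i \<Longrightarrow> i \<le> j \<Longrightarrow> j \<le> n \<Longrightarrow> X i t \<le> X j t"
  using X_strict_mono[of t i j] by (cases "i = j") auto

lemma passed_le: "passed t x \<le> n"
proof -
  have "{i \<in> {1..n}. X i t \<le> x} \<subseteq> {1..n}" by blast
  from card_mono[OF _ this] show ?thesis unfolding passed_def by simp
qed

lemma passed_set:
  assumes t: "t \<in> {0..T}"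
  shows "{i \<in> {1..n}. X i t \<le> x} = {1..passed t x}"
proof -
  let ?A = "{i \<in> {1..n}. X i t \<le> x}"
  have fin: "finite ?A" by simp
  \<comment> \<open>The inserted 0 is the value when no path lies to the left, in accordance with
    the number of the leftmost strip.\<close>
  have "?A = {1..Max (insert 0 ?A)}"
  proof (cases "?A = {}")
    case True
    then show ?thesis by (simp only: True) simp
  next
    case False
    then have M: "Max (insert 0 ?A) = Max ?A" "Max ?A \<in> ?A" using fin by (simp_all del: mem_Collect_eq)
    show ?thesis
    proof
      show "?A \<subseteq> {1..Max (insert 0 ?A)}" using fin by (auto intro!: Max_ge)
      show "{1..Max (insert 0 ?A)} \<subseteq> ?A"
      proof
        fix i assume i: "i \<in> {1..Max (insert 0 ?A)}"
        then have "1 \<le> i" "i \<le> Max ?A" using M by auto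
        moreover have "Max ?A \<le> n" "X (Max ?A) t \<le> x" using M(2) by auto
        ultimately show "i \<in> ?A" using X_mono[OF t, of i "Max ?A"] by auto
      qed
    qed
  qed
  moreover from this have "passed t x = Max (insert 0 ?A)"
    unfolding passed_def by (metis card_atLeastAtMost diff_Suc_1 One_nat_def)
  ultimately show ?thesis by simp
qed

lemma passed_bounds:
  assumes t: "t \<in> {0..T}"
  shows "1 \<le> passed t x \<Longrightarrow> X (passed t x) t \<le> x" "passed t x < n \<Longrightarrow> x < X (Suc (passed t x)) t"
proof -
  show "X (passed t x) t \<le> x" if "1 \<le> passed t x"
  proof -
    have "passed t x \<in> {i \<in> {1..n}. X i t \<le> x}" unfolding passed_set[OF t] using that by simp
    then show ?thesis by simp
  qed
  show "x < X (Suc (passed t x)) t" if "passed t x < n"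
  proof -
    have "Suc (passed t x) \<notin> {i \<in> {1..n}. X i t \<le> x}" unfolding passed_set[OF t] by simp
    then show ?thesis using that by (simp add: not_le)
  qed
qed

lemma W_fan:
  assumes t: "t \<in> {0..T}"
  shows "df (fan t x) = W (passed t x) t x"
proof -
  have "W (passed t x) t x \<in> df ` {c..d}"
    unfolding W_def using passed_bounds[OF t, of x]
    by (intro strip_range passed_le t) auto
  then show ?thesis unfolding fan_def using g_inverse by auto
qed

lemma trace_range:
  assumes i: "i \<in> {1..n}" and t: "t \<in> {0..T}"
  shows "W i t (X i t) \<in> df ` {c..d}" "W (i - 1) t (X i t) \<in> df ` {c..d}"
proof -
  show "W i t (X i t) \<in> df ` {c..d}"
    unfolding W_def using i by (intro strip_range t) (auto intro: less_imp_le[OF X_ordered] t)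
  show "W (i - 1) t (X i t) \<in> df ` {c..d}"
    unfolding W_def using i by (intro strip_range t) (auto intro!: X_mono t)
qed

text \<open>Decouples the strips: each summand depends only on the side of a single path, so a
  function defined strip by strip becomes a sum of functions on half planes.\<close>

lemma sum_passed_telescope:
  fixes a :: "nat \<Rightarrow> real"
  assumes t: "t \<in> {0..T}"
  shows "a 0 + (\<Sum>i\<in>{1..n}. if X i t \<le> x then a i - a (i - 1) else 0) = a (passed t x)"
proof -
  have "(\<Sum>i\<in>{1..n}. if X i t \<le> x then a i - a (i - 1) else 0)
      = (\<Sum>i\<in>{i \<in> {1..n}. X i t \<le> x}. a i - a (i - 1))"
    by (rule sum.inter_filter[symmetric]) simp
  also have "\<dots> = (\<Sum>i\<in>{1..passed t x}. a i - a (i - 1))" by (simp only: passed_set[OF t])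
  also have "\<dots> = (\<Sum>i\<in>{Suc 0..passed t x}. a i - a (i - 1))" by simp
  also have "\<dots> = a (passed t x) - a 0" by (rule sum_telescope'') simp
  finally show ?thesis by simp
qed

lemma fan_range: "fan t x \<in> {c..d}"
  unfolding fan_def by (rule g_range)

lemma f_cont: "continuous_on UNIV f"
  using f_deriv by (meson DERIV_continuous_on has_field_derivative_at_within)

lemma df_cont: "continuous_on UNIV df"
  using df_deriv by (meson DERIV_continuous_on has_field_derivative_at_within)

text \<open>The integrand is the continuation of strip 0 plus, for each path, the difference of the
  two adjacent continued strips on the half plane to its right. Green's formula on each half plane
  leaves an integral along the path, where the difference of potentials gives the Rankine-Hugoniot
  defect of the pair.\<close>

lemma entropy_balance:
  fixes \<eta> \<eta>' q :: "real \<Rightarrow> real"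
  assumes \<eta>: "\<And>w. w \<noteq> k \<Longrightarrow> (\<eta> has_real_derivative \<eta>' w) (at w)" "continuous_on UNIV \<eta>"
    and q: "\<And>w. w \<noteq> k \<Longrightarrow> (q has_real_derivative \<eta>' w * df w) (at w)" "continuous_on UNIV q"
    and \<phi>: "test_fun T \<phi> \<phi>t \<phi>x"
  shows "(LINT z|lborel. time_strip T z * (\<eta> (fan (fst z) (snd z)) * \<phi>t (fst z) (snd z)
        + q (fan (fst z) (snd z)) * \<phi>x (fst z) (snd z)))
      + (LINT x|lborel. \<eta> (fan 0 x) * \<phi> 0 x)
    = (\<Sum>i\<in>{1..n}. integral {0..T} (\<lambda>t.
        (S i t * (\<eta> (g (W i t (X i t))) - \<eta> (g (W (i - 1) t (X i t))))
          - (q (g (W i t (X i t))) - q (g (W (i - 1) t (X i t))))) * \<phi> t (X i t)))"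
proof -
  define h where "h z = \<eta> (g z)" for z
  have h: "continuous_on UNIV h" unfolding h_def
    by (rule continuous_on_compose2[OF \<eta>(2) g_cont]) simp
  have hdf: "h (df w) = \<eta> w" if "w \<in> {c..d}" for w using g_inverse[OF that] by (simp add: h_def)
  obtain H where H: "\<And>z. (H has_real_derivative h z) (at z)"
    and Hq: "\<And>w. w \<in> {c..d} \<Longrightarrow> df w * h (df w) - H (df w) = q w"
    using entropy_flux_legendre[OF df_deriv \<eta> q h hdf cd] by blast
  have cH: "continuous_on UNIV H" using H by (meson DERIV_continuous_on has_field_derivative_at_within)
  have range_h: "h z = \<eta> (g z)" "H z - z * h z = - q (g z)" if "z \<in> df ` {c..d}" for z
  proof -
    from that obtain w where w: "w \<in> {c..d}" "z = df w" by blast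
    show "h z = \<eta> (g z)" by (simp add: h_def)
    show "H z - z * h z = - q (g z)" using Hq[OF w(1)] g_inverse[OF w(1)] by (simp add: w(2))
  qed
  have "\<exists>\<Phi>. (\<forall>t\<in>{0..T}. \<forall>x. ((\<lambda>s. \<Phi> s x) has_real_derivative H (W i t x) - W i t x * h (W i t x)) (at t within {0..T}))
      \<and> (\<forall>t\<in>{0..T}. \<forall>x. (\<Phi> t has_real_derivative h (W i t x)) (at x))" if "i \<le> n" for i
    using affine_burgers_potential[OF \<alpha>_deriv[OF that] \<beta>_deriv[OF that] H] unfolding W_def by metis
  then obtain \<Phi> where \<Phi>t: "\<And>i t x. i \<le> n \<Longrightarrow> t \<in> {0..T} \<Longrightarrow>
      ((\<lambda>s. \<Phi> i s x) has_real_derivative H (W i t x) - W i t x * h (W i t x)) (at t within {0..T})"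
    and \<Phi>x: "\<And>i t x. i \<le> n \<Longrightarrow> t \<in> {0..T} \<Longrightarrow> (\<Phi> i t has_real_derivative h (W i t x)) (at x)"
    by metis
  \<comment> \<open>The time derivative of the potential. It equals \<open>- q\<close> of the state
    while \<open>W\<close> stays in the range of \<open>df\<close> on \<open>[c, d]\<close>, and is
    merely some continuation elsewhere.\<close>
  define P where "P i t x = H (W i t x) - W i t x * h (W i t x)" for i t x
  have cW: "continuous_on A (\<lambda>z. W i (fst z) (snd z))" for A i
    unfolding W_def
    by (intro continuous_intros continuous_on_compose2[OF \<alpha>_cont] continuous_on_compose2[OF \<beta>_cont]) auto
  have ch: "continuous_on A (\<lambda>z. h (W i (fst z) (snd z)))" for A i
    by (rule continuous_on_compose2[OF h cW]) simp
  have cP: "continuous_on A (\<lambda>z. P i (fst z) (snd z))" for A i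
    unfolding P_def by (intro continuous_intros ch cW continuous_on_compose2[OF cH cW]) simp
  obtain R where R: "R > 0" and van: "\<And>t x. \<bar>x\<bar> \<ge> R \<Longrightarrow> \<phi> t x = 0 \<and> \<phi>t t x = 0 \<and> \<phi>x t x = 0"
    using test_fun_vanishes[OF \<phi>] by metis
  define E where "E i z = h (W i (fst z) (snd z)) * \<phi>t (fst z) (snd z) - P i (fst z) (snd z) * \<phi>x (fst z) (snd z)" for i z
  define F0 where "F0 z = time_strip T z * (if - R \<le> snd z then E 0 z else 0)" for z
  define F where "F i z = time_strip T z * (if X i (fst z) \<le> snd z then E i z - E (i - 1) z else 0)" for i z
  define B0 where "B0 x = (if - R \<le> x then h (W 0 0 x) * \<phi> 0 x else 0)" for x
  define B where "B i x = (if X i 0 \<le> x then (h (W i 0 x) - h (W (i - 1) 0 x)) * \<phi> 0 x else 0)" for i x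
  have F0: "integrable lborel F0" "integral\<^sup>L lborel F0 + integral\<^sup>L lborel B0 = 0"
  proof -
    \<comment> \<open>The leftmost summand has no path. A vertical line at \<open>- R\<close>, where
      the test function vanishes, takes its place and produces no boundary term.\<close>
    note * = green_right_of_curve[where X = "\<lambda>_. - R" and S = "\<lambda>_. 0", OF T \<Phi>t[OF le0, folded P_def]
        \<Phi>x[OF le0] cP ch DERIV_const continuous_on_const continuous_on_const \<phi>]
    from * show "integrable lborel F0" "integral\<^sup>L lborel F0 + integral\<^sup>L lborel B0 = 0"
      unfolding F0_def[abs_def] E_def B0_def[abs_def] using van[of "- R"] R by simp_all
  qed
  define J where "J i t = (S i t * (\<eta> (g (W i t (X i t))) - \<eta> (g (W (i - 1) t (X i t))))
          - (q (g (W i t (X i t))) - q (g (W (i - 1) t (X i t))))) * \<phi> t (X i t)" for i t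
  have F: "integrable lborel (F i)" "integral\<^sup>L lborel (F i) + integral\<^sup>L lborel (B i) = integral {0..T} (J i)"
    if i: "i \<in> {1..n}" for i
  proof -
    have i': "i \<le> n" "i - 1 \<le> n" using i by auto
    note * = green_right_of_curve[where \<Phi> = "\<lambda>t x. \<Phi> i t x - \<Phi> (i - 1) t x"
        and \<Phi>t = "\<lambda>t x. P i t x - P (i - 1) t x" and \<Phi>x = "\<lambda>t x. h (W i t x) - h (W (i - 1) t x)",
        OF T DERIV_diff[OF \<Phi>t[OF i'(1), folded P_def] \<Phi>t[OF i'(2), folded P_def]]
          DERIV_diff[OF \<Phi>x[OF i'(1)] \<Phi>x[OF i'(2)]] continuous_on_diff[OF cP cP] continuous_on_diff[OF ch ch]
          X_deriv[OF i] X_cont S_cont[OF i] \<phi>]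
    have E: "E i z - E (i - 1) z = (h (W i (fst z) (snd z)) - h (W (i - 1) (fst z) (snd z))) * \<phi>t (fst z) (snd z)
        - (P i (fst z) (snd z) - P (i - 1) (fst z) (snd z)) * \<phi>x (fst z) (snd z)" for z
      by (simp add: E_def algebra_simps)
    show "integrable lborel (F i)" using *(1) unfolding F_def[abs_def] E by simp
    \<comment> \<open>On the path both adjacent continuations still take values in the range of
      \<open>df\<close>, so the potentials may be replaced by entropy and flux of the
      traces.\<close>
    have "integral {0..T} (\<lambda>t. (P i t (X i t) - P (i - 1) t (X i t)
        + S i t * (h (W i t (X i t)) - h (W (i - 1) t (X i t)))) * \<phi> t (X i t)) = integral {0..T} (J i)"
    proof (rule integral_cong)
      fix t assume t: "t \<in> {0..T}"
      show "(P i t (X i t) - P (i - 1) t (X i t)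
        + S i t * (h (W i t (X i t)) - h (W (i - 1) t (X i t)))) * \<phi> t (X i t) = J i t"
        using range_h[OF trace_range(1)[OF i t], folded P_def] range_h[OF trace_range(2)[OF i t], folded P_def]
        by (simp add: J_def)
    qed
    then show "integral\<^sup>L lborel (F i) + integral\<^sup>L lborel (B i) = integral {0..T} (J i)"
      using *(2) unfolding F_def[abs_def] E B_def[abs_def] by simp
  qed
  have fan_h: "h (W (passed t x) t x) = \<eta> (fan t x)" "P (passed t x) t x = - q (fan t x)"
    if "t \<in> {0..T}" for t x
    using range_h[of "W (passed t x) t x"] W_fan[OF that, of x] fan_range[of t x]
    unfolding P_def fan_def by (metis imageI)+
  have "time_strip T z * (\<eta> (fan (fst z) (snd z)) * \<phi>t (fst z) (snd z)
        + q (fan (fst z) (snd z)) * \<phi>x (fst z) (snd z)) = F0 z + (\<Sum>i\<in>{1..n}. F i z)" for z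
  proof (cases "z \<in> {0<..<T} \<times> UNIV")
    case True
    then have t: "fst z \<in> {0..T}" by auto
    have "F0 z + (\<Sum>i\<in>{1..n}. F i z) = E 0 z + (\<Sum>i\<in>{1..n}. if X i (fst z) \<le> snd z then E i z - E (i - 1) z else 0)"
      using True van[of "snd z" "fst z"] by (simp add: F0_def F_def time_strip_def E_def)
    also have "\<dots> = E (passed (fst z) (snd z)) z" by (rule sum_passed_telescope[OF t])
    also have "\<dots> = \<eta> (fan (fst z) (snd z)) * \<phi>t (fst z) (snd z)
        + q (fan (fst z) (snd z)) * \<phi>x (fst z) (snd z)"
      by (simp add: E_def fan_h[OF t])
    finally show ?thesis using True by (simp add: time_strip_def)
  qed (simp add: F0_def F_def time_strip_def)
  moreover have "(LINT z|lborel. F0 z + (\<Sum>i\<in>{1..n}. F i z))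
      = integral\<^sup>L lborel F0 + (\<Sum>i\<in>{1..n}. integral\<^sup>L lborel (F i))"
    by (subst Bochner_Integration.integral_add)
      (use F(1) F0(1) in \<open>auto intro!: Bochner_Integration.integral_sum Bochner_Integration.integrable_sum\<close>)
  ultimately have 1: "(LINT z|lborel. time_strip T z * (\<eta> (fan (fst z) (snd z)) * \<phi>t (fst z) (snd z)
        + q (fan (fst z) (snd z)) * \<phi>x (fst z) (snd z)))
      = integral\<^sup>L lborel F0 + (\<Sum>i\<in>{1..n}. integral\<^sup>L lborel (F i))"
    by simp
  have slice: "continuous_on UNIV (\<lambda>x :: real. (0 :: real, x))"
    by (intro continuous_on_Pair continuous_on_const continuous_on_id)
  have Bint: "integrable lborel (\<lambda>x. if b \<le> x then p x * \<phi> 0 x else 0)" if p: "continuous_on UNIV p" for p and b :: real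
  proof (rule integrable_bounded_support[where B = "{-R..R}"])
    have c\<phi>: "continuous_on UNIV (\<lambda>x. \<phi> 0 x)"
      using continuous_on_compose2[OF test_fun_continuous[OF \<phi>] slice] by simp
    have cp: "continuous_on UNIV (\<lambda>x. p x * \<phi> 0 x)" by (intro continuous_intros p c\<phi>)
    then have [measurable]: "(\<lambda>x. p x * \<phi> 0 x) \<in> borel_measurable borel"
      by (rule borel_measurable_continuous_onI)
    show "(\<lambda>x. if b \<le> x then p x * \<phi> 0 x else 0) \<in> borel_measurable borel" by measurable
    have "bounded (range (\<lambda>x. p x * \<phi> 0 x))"
      by (rule continuous_bounded_support_bounded_range[OF cp, where B = "{-R..R}"]) (use van[of _ 0] in force)+
    then have "bounded (insert 0 (range (\<lambda>x. p x * \<phi> 0 x)))" by simp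
    then show "bounded (range (\<lambda>x. if b \<le> x then p x * \<phi> 0 x else 0))"
      by (rule bounded_subset) auto
    show "(if b \<le> x then p x * \<phi> 0 x else 0) = 0" if "x \<notin> {-R..R}" for x
      using van[of x 0] that by force
  qed simp
  have chx: "continuous_on UNIV (\<lambda>x. h (W i 0 x))" for i
    using continuous_on_compose2[OF ch[of UNIV i] slice] by simp
  have B0int: "integrable lborel B0" unfolding B0_def by (rule Bint[OF chx])
  have Bi: "integrable lborel (B i)" for i
    unfolding B_def by (rule Bint[OF continuous_on_diff[OF chx chx]])
  have "\<eta> (fan 0 x) * \<phi> 0 x = B0 x + (\<Sum>i\<in>{1..n}. B i x)" for x
  proof -
    have t: "0 \<in> {0..T}" using T by simp
    have "B0 x + (\<Sum>i\<in>{1..n}. B i x) = h (W 0 0 x) * \<phi> 0 x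
        + (\<Sum>i\<in>{1..n}. if X i 0 \<le> x then h (W i 0 x) * \<phi> 0 x - h (W (i - 1) 0 x) * \<phi> 0 x else 0)"
      using van[of x 0] by (auto simp: B0_def B_def left_diff_distrib intro!: sum.cong)
    also have "\<dots> = h (W (passed 0 x) 0 x) * \<phi> 0 x"
      by (rule sum_passed_telescope[OF t, of "\<lambda>i. h (W i 0 x) * \<phi> 0 x"])
    finally show ?thesis by (simp add: fan_h[OF t])
  qed
  moreover have "(LINT x|lborel. B0 x + (\<Sum>i\<in>{1..n}. B i x))
      = integral\<^sup>L lborel B0 + (\<Sum>i\<in>{1..n}. integral\<^sup>L lborel (B i))"
    by (subst Bochner_Integration.integral_add)
      (use B0int Bi in \<open>auto intro!: Bochner_Integration.integral_sum Bochner_Integration.integrable_sum\<close>)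
  ultimately have 2: "(LINT x|lborel. \<eta> (fan 0 x) * \<phi> 0 x) = integral\<^sup>L lborel B0 + (\<Sum>i\<in>{1..n}. integral\<^sup>L lborel (B i))"
    by simp
  have "(LINT z|lborel. time_strip T z * (\<eta> (fan (fst z) (snd z)) * \<phi>t (fst z) (snd z)
        + q (fan (fst z) (snd z)) * \<phi>x (fst z) (snd z)))
      + (LINT x|lborel. \<eta> (fan 0 x) * \<phi> 0 x) = (\<Sum>i\<in>{1..n}. integral\<^sup>L lborel (F i) + integral\<^sup>L lborel (B i))"
    using F0(2) by (simp add: 1 2 sum.distrib)
  also have "\<dots> = (\<Sum>i\<in>{1..n}. integral {0..T} (J i))" using F(2) by (intro sum.cong) auto
  finally show ?thesis unfolding J_def[abs_def] .
qed

end

section \<open>Changes of a solution on null sets\<close>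

lemma strip_integral_cong_AE:
  fixes u u' :: "real \<Rightarrow> real \<Rightarrow> real" and E Q :: "real \<Rightarrow> real" and p q :: "real \<times> real \<Rightarrow> real"
  assumes u: "set_borel_measurable lborel ({0<..<T} \<times> UNIV) (\<lambda>z. u (fst z) (snd z))"
    and u': "set_borel_measurable lborel ({0<..<T} \<times> UNIV) (\<lambda>z. u' (fst z) (snd z))"
    and eq: "AE z in lborel. 0 < fst z \<and> fst z < T \<longrightarrow> u' (fst z) (snd z) = u (fst z) (snd z)"
    and m [measurable]: "E \<in> borel_measurable borel" "Q \<in> borel_measurable borel"
      "p \<in> borel_measurable borel" "q \<in> borel_measurable borel"
  shows "(LINT z:{0<..<T} \<times> UNIV|lborel. E (u' (fst z) (snd z)) * p z + Q (u' (fst z) (snd z)) * q z)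
    = (LINT z:{0<..<T} \<times> UNIV|lborel. E (u (fst z) (snd z)) * p z + Q (u (fst z) (snd z)) * q z)"
proof -
  have *: "(LINT z:{0<..<T} \<times> UNIV|lborel. E (w (fst z) (snd z)) * p z + Q (w (fst z) (snd z)) * q z)
    = (LINT z|lborel. time_strip T z * (E (time_strip T z * w (fst z) (snd z)) * p z
        + Q (time_strip T z * w (fst z) (snd z)) * q z))" for w :: "real \<Rightarrow> real \<Rightarrow> real"
    unfolding set_lebesgue_integral_def time_strip_def
    by (intro Bochner_Integration.integral_cong refl) (auto simp: indicator_def)
  have [measurable]: "(\<lambda>z. time_strip T z * u (fst z) (snd z)) \<in> borel_measurable borel"
    "(\<lambda>z. time_strip T z * u' (fst z) (snd z)) \<in> borel_measurable borel"
    using u u' by (simp_all add: set_borel_measurable_def time_strip_def)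
  have "AE z in lborel. time_strip T z * u' (fst z) (snd z) = time_strip T z * u (fst z) (snd z)"
    using eq by eventually_elim (auto simp: time_strip_def indicator_def)
  then show ?thesis unfolding *
    by (intro integral_cong_AE) (auto elim!: eventually_mono)
qed

text \<open>For passing between the strip solution and the interpolant, which may differ on the
  paths. Measurability and the pointwise bound are hypotheses on the new function because they do
  not follow from equality almost everywhere.\<close>

lemma entropy_solution_cong_AE:
  assumes sol: "entropy_solution f T u0 u" and f: "continuous_on UNIV f"
    and u0 [measurable]: "u0 \<in> borel_measurable borel" "u0' \<in> borel_measurable borel"
    and eq0: "AE x in lborel. u0' x = u0 x"
    and u': "set_borel_measurable lborel ({0<..<T} \<times> UNIV) (\<lambda>z. u' (fst z) (snd z))"
    and bound: "\<And>t x. 0 < t \<Longrightarrow> t < T \<Longrightarrow> \<bar>u' t x\<bar> \<le> M"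
    and eq: "AE z in lborel. 0 < fst z \<and> fst z < T \<longrightarrow> u' (fst z) (snd z) = u (fst z) (snd z)"
  shows "entropy_solution f T u0' u'"
proof -
  have [measurable]: "f \<in> borel_measurable borel" by (rule borel_measurable_continuous_onI[OF f])
  have u: "set_borel_measurable lborel ({0<..<T} \<times> UNIV) (\<lambda>z. u (fst z) (snd z))"
    using sol unfolding entropy_solution_def by blast
  note cong = strip_integral_cong_AE[OF u u' eq]
  have slice: "(\<lambda>x. \<phi> 0 x) \<in> borel_measurable borel" if "test_fun T \<phi> \<phi>t \<phi>x" for \<phi> \<phi>t \<phi>x
  proof -
    have "continuous_on UNIV (\<lambda>x :: real. (0 :: real, x))"
      by (intro continuous_on_Pair continuous_on_const continuous_on_id)
    from continuous_on_compose2[OF test_fun_continuous[OF that] this]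
    have "continuous_on UNIV (\<lambda>x. \<phi> 0 x)" by simp
    then show ?thesis by (rule borel_measurable_continuous_onI)
  qed
  show ?thesis
    unfolding entropy_solution_def
  proof (intro conjI allI impI)
    show "\<exists>M. \<forall>t x. 0 < t \<and> t < T \<longrightarrow> \<bar>u' t x\<bar> \<le> M" using bound by blast
    fix \<phi> \<phi>t \<phi>x assume \<phi>: "test_fun T \<phi> \<phi>t \<phi>x"
    note [measurable] = test_fun_measurable[OF \<phi>] slice[OF \<phi>]
    have "(LINT x|lborel. u0' x * \<phi> 0 x) = (LINT x|lborel. u0 x * \<phi> 0 x)"
      using eq0 by (intro integral_cong_AE) (auto elim!: eventually_mono)
    then show "(LINT z:{0<..<T} \<times> UNIV|lborel. u' (fst z) (snd z) * \<phi>t (fst z) (snd z)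
        + f (u' (fst z) (snd z)) * \<phi>x (fst z) (snd z)) + (LINT x|lborel. u0' x * \<phi> 0 x) = 0"
      using sol \<phi> cong[of "\<lambda>w. w" f "\<lambda>z. \<phi>t (fst z) (snd z)" "\<lambda>z. \<phi>x (fst z) (snd z)"]
      unfolding entropy_solution_def by simp
  next
    fix \<phi> \<phi>t \<phi>x k assume \<phi>: "test_fun T \<phi> \<phi>t \<phi>x \<and> (\<forall>t x. \<phi> t x \<ge> 0)"
    then have \<phi>': "test_fun T \<phi> \<phi>t \<phi>x" by blast
    note [measurable] = test_fun_measurable[OF \<phi>'] slice[OF \<phi>']
    have "(LINT x|lborel. \<bar>u0' x - k\<bar> * \<phi> 0 x) = (LINT x|lborel. \<bar>u0 x - k\<bar> * \<phi> 0 x)"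
      using eq0 by (intro integral_cong_AE) (auto elim!: eventually_mono)
    moreover have "0 \<le> (LINT z:{0<..<T} \<times> UNIV|lborel. \<bar>u (fst z) (snd z) - k\<bar> * \<phi>t (fst z) (snd z)
        + sgn (u (fst z) (snd z) - k) * (f (u (fst z) (snd z)) - f k) * \<phi>x (fst z) (snd z))
      + (LINT x|lborel. \<bar>u0 x - k\<bar> * \<phi> 0 x)"
      using sol \<phi> unfolding entropy_solution_def by blast
    ultimately show "0 \<le> (LINT z:{0<..<T} \<times> UNIV|lborel. \<bar>u' (fst z) (snd z) - k\<bar> * \<phi>t (fst z) (snd z)
        + sgn (u' (fst z) (snd z) - k) * (f (u' (fst z) (snd z)) - f k) * \<phi>x (fst z) (snd z))
      + (LINT x|lborel. \<bar>u0' x - k\<bar> * \<phi> 0 x)"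
      by (subst cong[of "\<lambda>w. \<bar>w - k\<bar>" "\<lambda>w. sgn (w - k) * (f w - f k)" "\<lambda>z. \<phi>t (fst z) (snd z)" "\<lambda>z. \<phi>x (fst z) (snd z)"])
        simp_all
  qed (rule u')
qed

text \<open>The graph is closed and meets every time slice in one point, so Fubini makes it a null
  set.\<close>

lemma AE_off_graph:
  fixes X :: "real \<Rightarrow> real"
  assumes "continuous_on UNIV X"
  shows "AE z in lborel. snd z \<noteq> X (fst z)"
proof -
  have "closed {z :: real \<times> real. snd z = X (fst z)}"
    by (intro closed_Collect_eq continuous_intros continuous_on_compose2[OF assms]) auto
  then have "{z :: real \<times> real. snd z \<noteq> X (fst z)} \<in> sets borel"
    by (auto simp: Collect_neg_eq)
  then have "{z \<in> space (lborel \<Otimes>\<^sub>M lborel). snd z \<noteq> X (fst z)} \<in> sets (lborel \<Otimes>\<^sub>M (lborel :: real measure))"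
    unfolding lborel_prod by simp
  then have "AE z in lborel \<Otimes>\<^sub>M lborel. snd z \<noteq> X (fst z)"
    by (rule lborel_pair.AE_pair_measure) (simp add: AE_lborel_singleton)
  then show ?thesis unfolding lborel_prod .
qed

section \<open>The strip solution: measurability, entropy inequalities, uniqueness\<close>

context shock_fronts begin

lemma W_cont: "continuous_on A (\<lambda>z. W i (fst z) (snd z))"
  unfolding W_def
  by (intro continuous_intros continuous_on_compose2[OF \<alpha>_cont] continuous_on_compose2[OF \<beta>_cont]) auto

lemma gW_cont: "continuous_on A (\<lambda>z. g (W i (fst z) (snd z)))"
  by (rule continuous_on_compose2[OF g_cont W_cont]) simp

lemma fan_eq_sum:
  assumes "t \<in> {0..T}"
  shows "fan t x = g (W 0 t x) + (\<Sum>i\<in>{1..n}. if X i t \<le> x then g (W i t x) - g (W (i - 1) t x) else 0)"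
  unfolding fan_def by (rule sum_passed_telescope[OF assms, of "\<lambda>i. g (W i t x)", symmetric])

text \<open>The telescoped sum consists of continuous functions cut off by closed conditions. It is
  Borel on the whole plane, although its identification with \<open>fan\<close> is made only for
  times in \<open>[0, T]\<close>.\<close>

lemma fan_sum_measurable:
  "(\<lambda>z. g (W 0 (fst z) (snd z)) + (\<Sum>i\<in>{1..n}. if X i (fst z) \<le> snd z
      then g (W i (fst z) (snd z)) - g (W (i - 1) (fst z) (snd z)) else 0)) \<in> borel_measurable borel"
proof -
  have [measurable]: "(\<lambda>z. g (W i (fst z) (snd z))) \<in> borel_measurable borel" for i
    by (rule borel_measurable_continuous_onI[OF gW_cont])
  have [measurable]: "X i \<in> borel_measurable borel" for i
    by (rule borel_measurable_continuous_onI[OF X_cont])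
  show ?thesis by measurable
qed

lemma fan_measurable: "set_borel_measurable lborel ({0<..<T} \<times> UNIV) (\<lambda>z. fan (fst z) (snd z))"
proof -
  have "(\<lambda>z. time_strip T z * (g (W 0 (fst z) (snd z)) + (\<Sum>i\<in>{1..n}. if X i (fst z) \<le> snd z
      then g (W i (fst z) (snd z)) - g (W (i - 1) (fst z) (snd z)) else 0))) \<in> borel_measurable borel"
    by (intro borel_measurable_times time_strip_measurable fan_sum_measurable)
  also have "(\<lambda>z. time_strip T z * (g (W 0 (fst z) (snd z)) + (\<Sum>i\<in>{1..n}. if X i (fst z) \<le> snd z
      then g (W i (fst z) (snd z)) - g (W (i - 1) (fst z) (snd z)) else 0)))
      = (\<lambda>z. indicator ({0<..<T} \<times> UNIV) z *\<^sub>R fan (fst z) (snd z))"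
  proof
    fix z
    show "time_strip T z * (g (W 0 (fst z) (snd z)) + (\<Sum>i\<in>{1..n}. if X i (fst z) \<le> snd z
      then g (W i (fst z) (snd z)) - g (W (i - 1) (fst z) (snd z)) else 0))
      = indicator ({0<..<T} \<times> UNIV) z *\<^sub>R fan (fst z) (snd z)"
    proof (cases "z \<in> {0<..<T} \<times> UNIV")
      case True
      then have "fst z \<in> {0..T}" by auto
      from fan_eq_sum[OF this, of "snd z"] show ?thesis by (simp add: time_strip_def)
    qed (simp add: time_strip_def)
  qed
  finally show ?thesis by (simp add: set_borel_measurable_def)
qed

lemma fan_initial_measurable: "fan 0 \<in> borel_measurable borel"
proof -
  have "(\<lambda>x :: real. (0 :: real, x)) \<in> borel_measurable borel"
    by (intro borel_measurable_continuous_onI continuous_on_Pair continuous_on_const continuous_on_id)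
  from measurable_compose[OF this fan_sum_measurable] show ?thesis
    using T fan_eq_sum[of 0] by (simp cong: if_cong measurable_cong)
qed

lemma fan_bounded: "\<bar>fan t x\<bar> \<le> max \<bar>c\<bar> \<bar>d\<bar>"
  using fan_range[of t x] by auto

text \<open>Two instances of the balance law. For the identity entropy the path integrands vanish by
  Rankine-Hugoniot; for the Kruzkov entropies they are nonnegative by dissipation and the sign of
  the test function.\<close>

lemma fan_entropy_solution: "entropy_solution f T (fan 0) fan"
  unfolding entropy_solution_def
proof (intro conjI allI impI)
  show "\<exists>M. \<forall>t x. 0 < t \<and> t < T \<longrightarrow> \<bar>fan t x\<bar> \<le> M" using fan_bounded by blast
  fix \<phi> \<phi>t \<phi>x assume \<phi>: "test_fun T \<phi> \<phi>t \<phi>x"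
  have "integral {0..T} (\<lambda>t. (S i t * (g (W i t (X i t)) - g (W (i - 1) t (X i t)))
      - (f (g (W i t (X i t))) - f (g (W (i - 1) t (X i t))))) * \<phi> t (X i t)) = 0" if "i \<in> {1..n}" for i
    by (rule integral_unique, rule has_integral_is_0) (use rankine_hugoniot[OF that, folded W_def] in auto)
  then have "(\<Sum>i\<in>{1..n}. integral {0..T} (\<lambda>t. (S i t * (g (W i t (X i t)) - g (W (i - 1) t (X i t)))
      - (f (g (W i t (X i t))) - f (g (W (i - 1) t (X i t))))) * \<phi> t (X i t))) = 0"
    by (rule sum.neutral[rule_format])
  \<comment> \<open>The identity has no kink; 0 merely fills the place of the exceptional
    point.\<close>
  with entropy_balance[of 0 "\<lambda>w. w" "\<lambda>_. 1" f, OF _ _ _ f_cont \<phi>] f_deriv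
  show "(LINT z:{0<..<T} \<times> UNIV|lborel. fan (fst z) (snd z) * \<phi>t (fst z) (snd z)
        + f (fan (fst z) (snd z)) * \<phi>x (fst z) (snd z)) + (LINT x|lborel. fan 0 x * \<phi> 0 x) = 0"
    by (simp add: set_lebesgue_integral_def time_strip_def)
next
  fix \<phi> \<phi>t \<phi>x k assume \<phi>: "test_fun T \<phi> \<phi>t \<phi>x \<and> (\<forall>t x. \<phi> t x \<ge> 0)"
  have abs_deriv: "((\<lambda>w. \<bar>w - k\<bar>) has_real_derivative sgn (w - k)) (at w)" if "w \<noteq> k" for w :: real
    using kruzkov_flux_has_derivative[of "\<lambda>w. w" "\<lambda>_. 1" w k] that
    by (simp add: kruzkov_flux_def mult.commute[of "sgn _"] abs_sgn)
  have "0 \<le> integral {0..T} (\<lambda>t. (S i t * (\<bar>g (W i t (X i t)) - k\<bar> - \<bar>g (W (i - 1) t (X i t)) - k\<bar>)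
      - (kruzkov_flux f (g (W i t (X i t))) k - kruzkov_flux f (g (W (i - 1) t (X i t))) k)) * \<phi> t (X i t))"
    (is "0 \<le> integral _ ?J") if i: "i \<in> {1..n}" for i
  \<comment> \<open>A non-integrable function has integral 0 by convention, so the sign is right in
    either case.\<close>
  proof (cases "?J integrable_on {0..T}")
    case True
    then show ?thesis
      using dissipation[OF i, folded W_def] \<phi> by (intro integral_nonneg) auto
  qed (simp add: not_integrable_integral)
  then have "0 \<le> (\<Sum>i\<in>{1..n}. integral {0..T} (\<lambda>t. (S i t * (\<bar>g (W i t (X i t)) - k\<bar> - \<bar>g (W (i - 1) t (X i t)) - k\<bar>)
      - (kruzkov_flux f (g (W i t (X i t))) k - kruzkov_flux f (g (W (i - 1) t (X i t))) k)) * \<phi> t (X i t)))"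
    by (rule sum_nonneg)
  also have "\<dots> = (LINT z|lborel. time_strip T z * (\<bar>fan (fst z) (snd z) - k\<bar> * \<phi>t (fst z) (snd z)
        + kruzkov_flux f (fan (fst z) (snd z)) k * \<phi>x (fst z) (snd z)))
      + (LINT x|lborel. \<bar>fan 0 x - k\<bar> * \<phi> 0 x)"
    using entropy_balance[OF abs_deriv _ kruzkov_flux_has_derivative[OF f_deriv] kruzkov_flux_continuous[OF f_cont], of k \<phi> \<phi>t \<phi>x] \<phi>
    by (simp add: continuous_intros)
  finally show "0 \<le> (LINT z:{0<..<T} \<times> UNIV|lborel. \<bar>fan (fst z) (snd z) - k\<bar> * \<phi>t (fst z) (snd z)
        + sgn (fan (fst z) (snd z) - k) * (f (fan (fst z) (snd z)) - f k) * \<phi>x (fst z) (snd z))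
      + (LINT x|lborel. \<bar>fan 0 x - k\<bar> * \<phi> 0 x)"
    by (simp add: set_lebesgue_integral_def time_strip_def kruzkov_flux_def)
qed (rule fan_measurable)

text \<open>Near a point off all paths the set of passed paths is constant, so the solution
  coincides there with the continuation of a single strip.\<close>

lemma fan_locally_continuous:
  assumes off: "\<And>i. i \<in> {1..n} \<Longrightarrow> x \<noteq> X i t" and \<eta>: "0 < \<eta>"
  obtains \<delta> where "0 < \<delta>" "\<And>s y. \<bar>s - t\<bar> < \<delta> \<Longrightarrow> \<bar>y - x\<bar> < \<delta> \<Longrightarrow> \<bar>fan s y - fan t x\<bar> < \<eta>"
proof -
  have lim: "((\<lambda>z. F (fst z) (snd z)) \<longlongrightarrow> F t x) (nhds (t, x))"
    if "continuous_on UNIV (\<lambda>z. F (fst z) (snd z))" for F :: "real \<Rightarrow> real \<Rightarrow> real"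
  proof -
    have "isCont (\<lambda>z. F (fst z) (snd z)) (t, x)"
      using that by (simp add: continuous_on_eq_continuous_at)
    then show ?thesis
      using tendsto_at_iff_tendsto_nhds[of "\<lambda>z. F (fst z) (snd z)" "(t, x)"] by (simp add: isCont_def)
  qed
  have "\<forall>\<^sub>F z in nhds (t, x). X i (fst z) \<le> snd z \<longleftrightarrow> X i t \<le> x" if i: "i \<in> {1..n}" for i
  proof -
    have "continuous_on UNIV (\<lambda>z :: real \<times> real. snd z - X i (fst z))"
      by (intro continuous_intros continuous_on_compose2[OF X_cont]) auto
    note l = lim[OF this]
    show ?thesis
    proof (cases "X i t < x")
      case True
      then have "\<forall>\<^sub>F z in nhds (t, x). 0 < snd z - X i (fst z)"
        by (intro order_tendstoD(1)[OF l]) simp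
      then show ?thesis by eventually_elim (use True in auto)
    next
      case False
      then have "x < X i t" using off[OF i] by simp
      then have "\<forall>\<^sub>F z in nhds (t, x). snd z - X i (fst z) < 0"
        by (intro order_tendstoD(2)[OF l]) simp
      then show ?thesis by eventually_elim (use \<open>x < X i t\<close> in auto)
    qed
  qed
  then have "\<forall>\<^sub>F z in nhds (t, x). \<forall>i\<in>{1..n}. X i (fst z) \<le> snd z \<longleftrightarrow> X i t \<le> x"
    by (intro eventually_ball_finite) auto
  moreover have "\<forall>\<^sub>F z in nhds (t, x). dist (g (W (passed t x) (fst z) (snd z))) (g (W (passed t x) t x)) < \<eta>"
    by (rule tendstoD[OF lim[OF gW_cont] \<eta>])
  ultimately have "\<forall>\<^sub>F z in nhds (t, x). \<bar>fan (fst z) (snd z) - fan t x\<bar> < \<eta>"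
  proof eventually_elim
    case (elim z)
    have "{i \<in> {1..n}. X i (fst z) \<le> snd z} = {i \<in> {1..n}. X i t \<le> x}"
      using elim(1) by blast
    then have "passed (fst z) (snd z) = passed t x" by (simp only: passed_def)
    then show ?case using elim(2) by (simp add: fan_def dist_real_def)
  qed
  then obtain e where e: "e > 0" "\<And>z. dist z (t, x) < e \<Longrightarrow> \<bar>fan (fst z) (snd z) - fan t x\<bar> < \<eta>"
    unfolding eventually_nhds_metric by blast
  show thesis
  proof (rule that[of "e / 2"])
    fix s y assume "\<bar>s - t\<bar> < e / 2" "\<bar>y - x\<bar> < e / 2"
    then have "dist (s, y) (t, x) < e"
      using sqrt_sum_squares_le_sum_abs[of "dist s t" "dist y x"] by (simp add: dist_Pair_Pair dist_real_def)
    from e(2)[OF this] show "\<bar>fan s y - fan t x\<bar> < \<eta>" by simp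
  qed (use e(1) in simp)
qed

lemma fan_unique:
  assumes v: "entropy_solution f T (fan 0) v"
  shows "AE z in lborel. 0 < fst z \<and> fst z < T \<longrightarrow> v (fst z) (snd z) = fan (fst z) (snd z)"
proof (rule entropy_solution_unique[OF f_deriv df_cont fan_entropy_solution v T fan_initial_measurable])
  show "bounded (range (fan 0))" using fan_bounded unfolding bounded_iff by auto
  have local: "\<exists>d>0. \<forall>s y. t < s \<and> s < t + d \<and> s < T \<and> x < y \<and> y < x + d \<longrightarrow> \<bar>fan s y - fan t x\<bar> \<le> \<eta>"
    if off: "\<And>i. i \<in> {1..n} \<Longrightarrow> x \<noteq> X i t" and \<eta>: "0 < \<eta>" for t x \<eta>
  proof -
    obtain \<delta> where "0 < \<delta>" "\<And>s y. \<bar>s - t\<bar> < \<delta> \<Longrightarrow> \<bar>y - x\<bar> < \<delta> \<Longrightarrow> \<bar>fan s y - fan t x\<bar> < \<eta>"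
      using fan_locally_continuous[OF off \<eta>] by blast
    then show ?thesis by (intro exI[of _ \<delta>]) (auto intro: less_imp_le)
  qed
  have "AE z in lborel. \<forall>i\<in>{1..n}. snd z \<noteq> X i (fst z)"
    by (rule AE_finite_allI) (auto intro: AE_off_graph X_cont)
  then show "AE z in lborel. 0 < fst z \<and> fst z < T \<longrightarrow> (\<forall>\<eta>>0. \<exists>d>0. \<forall>s y. fst z < s \<and> s < fst z + d \<and> s < T
      \<and> snd z < y \<and> y < snd z + d \<longrightarrow> \<bar>fan s y - fan (fst z) (snd z)\<bar> \<le> \<eta>)"
    by eventually_elim (intro impI allI local, blast+)
  have "AE x in lborel. \<forall>i\<in>{1..n}. x \<noteq> X i 0"
    by (rule AE_finite_allI) (auto intro: AE_lborel_singleton)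
  then show "AE x in lborel. \<forall>\<eta>>0. \<exists>d>0. \<forall>s y. 0 < s \<and> s < d \<and> s < T \<and> x < y \<and> y < x + d
      \<longrightarrow> \<bar>fan s y - fan 0 x\<bar> \<le> \<eta>"
  proof eventually_elim
    case (elim x)
    then show ?case using local[of x 0] by simp
  qed
qed

end

section \<open>Shock particles\<close>

text \<open>The inverse is continuous on the compact interval \<open>F\<close> followed by the image
  of \<open>[c, d]\<close>; clipping the argument to that interval makes it total without leaving
  \<open>[c, d]\<close>. Affine profiles can thus be evaluated far outside their own strips.\<close>

lemma continuous_inverse_extension:
  fixes F :: "real \<Rightarrow> real"
  assumes F: "continuous_on {c..d} F" "inj_on F {c..d}" and cd: "c \<le> d"
  obtains g where "continuous_on UNIV g" "\<And>z. g z \<in> {c..d}" "\<And>w. w \<in> {c..d} \<Longrightarrow> g (F w) = w"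
proof -
  define g0 where "g0 = inv_into {c..d} F"
  have g0: "g0 (F w) = w" if "w \<in> {c..d}" for w
    unfolding g0_def using F(2) that by (rule inv_into_f_f)
  have cg0: "continuous_on (F ` {c..d}) g0"
    using g0 by (intro continuous_on_inv F) auto
  have "compact (F ` {c..d})" "connected (F ` {c..d})"
    using F(1) by (auto intro: compact_continuous_image connected_continuous_image)
  then obtain a b where ab: "F ` {c..d} = {a..b}"
    using connected_compact_interval_1 by metis
  have "F c \<in> {a..b}" using cd unfolding ab[symmetric] by simp
  then have "a \<le> b" by simp
  define clip where "clip z = max a (min b z)" for z
  have clip: "clip z \<in> {a..b}" for z using \<open>a \<le> b\<close> by (auto simp: clip_def)
  show thesis
  proof (rule that[of "\<lambda>z. g0 (clip z)"])
    have "continuous_on UNIV clip" unfolding clip_def by (intro continuous_intros)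
    then show "continuous_on UNIV (\<lambda>z. g0 (clip z))"
      by (rule continuous_on_compose2[OF cg0]) (use clip ab in auto)
    show "g0 (clip z) \<in> {c..d}" for z
    proof -
      obtain w where "w \<in> {c..d}" "clip z = F w" using clip[of z] unfolding ab[symmetric] by blast
      then show ?thesis using g0 by simp
    qed
    show "g0 (clip (F w)) = w" if "w \<in> {c..d}" for w
    proof -
      have "F w \<in> {a..b}" using that unfolding ab[symmetric] by blast
      then have "clip (F w) = F w" by (auto simp: clip_def)
      then show ?thesis using g0[OF that] by simp
    qed
  qed
qed

lemma strict_monotone_on_interval_of_deriv_sign:
  fixes df ddf :: "real \<Rightarrow> real"
  assumes df: "\<And>u. (df has_real_derivative ddf u) (at u)" and I: "is_interval I"
    and sign: "(\<forall>u\<in>I. ddf u > 0) \<or> (\<forall>u\<in>I. ddf u < 0)"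
  shows "strict_mono_on I df \<or> strict_antimono_on I df"
proof -
  have sub: "z \<in> I" if "x \<in> I" "y \<in> I" "x \<le> z" "z \<le> y" for x y z
    using I that unfolding is_interval_1 by blast
  from sign show ?thesis
  proof
    assume pos: "\<forall>u\<in>I. ddf u > 0"
    have "strict_mono_on I df"
    proof (rule monotone_onI)
      fix x y assume xy: "x \<in> I" "y \<in> I" "x < y"
      show "df x < df y"
        using DERIV_pos_imp_increasing[OF xy(3), of df] df pos sub[OF xy(1,2)] by blast
    qed
    then show ?thesis ..
  next
    assume neg: "\<forall>u\<in>I. ddf u < 0"
    have "strict_antimono_on I df"
    proof (rule monotone_onI)
      fix x y assume xy: "x \<in> I" "y \<in> I" "x < y"
      show "df x > df y"
        using DERIV_neg_imp_decreasing[OF xy(3), of df] df neg sub[OF xy(1,2)] by blast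
    qed
    then show ?thesis ..
  qed
qed

text \<open>The hypotheses of the theorem on a closed time interval, with strict order at all times.
  Compactness then bounds slopes and states; Oleinik's condition is still imposed at time 0
  only.\<close>

locale particle_system =
  fixes f df ddf :: "real \<Rightarrow> real" and I :: "real set" and n :: nat and T :: real
    and X Um Up :: "nat \<Rightarrow> real \<Rightarrow> real"
  assumes f_deriv: "\<And>u. (f has_real_derivative df u) (at u)"
    and df_deriv: "\<And>u. (df has_real_derivative ddf u) (at u)"
    and I_interval: "is_interval I"
    and ddf_sign: "(\<forall>u\<in>I. ddf u > 0) \<or> (\<forall>u\<in>I. ddf u < 0)"
    and n_pos: "1 \<le> n" and T: "0 < T"
    and states: "\<And>i t. i \<in> {1..n} \<Longrightarrow> t \<in> {0..T} \<Longrightarrow> Um i t \<in> I"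
      "\<And>i t. i \<in> {1..n} \<Longrightarrow> t \<in> {0..T} \<Longrightarrow> Up i t \<in> I"
    and ordered: "\<And>i t. 1 \<le> i \<Longrightarrow> i < n \<Longrightarrow> t \<in> {0..T} \<Longrightarrow> X i t < X (Suc i) t"
    and oleinik0: "\<And>i. i \<in> {1..n} \<Longrightarrow> df (Up i 0) \<le> df (Um i 0)"
    and ode_x: "\<And>i t. i \<in> {1..n} \<Longrightarrow> t \<in> {0..T} \<Longrightarrow>
        (X i has_real_derivative shock_speed f df (Um i t) (Up i t)) (at t within {0..T})"
    and ode_um: "\<And>i t. i \<in> {1..n} \<Longrightarrow> t \<in> {0..T} \<Longrightarrow>
        (Um i has_real_derivative
          (if i = 1 then 0
           else (shock_speed f df (Um i t) (Up i t) - df (Um i t))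
                * ((df (Up (i - 1) t) - df (Um i t)) / (X (i - 1) t - X i t))
                * (1 / ddf (Um i t)))) (at t within {0..T})"
    and ode_up: "\<And>i t. i \<in> {1..n} \<Longrightarrow> t \<in> {0..T} \<Longrightarrow>
        (Up i has_real_derivative
          (if i = n then 0
           else (shock_speed f df (Um i t) (Up i t) - df (Up i t))
                * ((df (Um (Suc i) t) - df (Up i t)) / (X (Suc i) t - X i t))
                * (1 / ddf (Up i t)))) (at t within {0..T})"
begin

definition s :: "nat \<Rightarrow> real \<Rightarrow> real" where
  "s i t = shock_speed f df (Um i t) (Up i t)"

text \<open>The spatial slope of the characteristic speed between the particles \<open>i\<close> and
  \<open>i + 1\<close>. The indices 0 and \<open>n\<close> denote the outer regions, where the state
  is continued as a constant.\<close>

definition slope :: "nat \<Rightarrow> real \<Rightarrow> real" where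
  "slope i t = (if 1 \<le> i \<and> i < n then (df (Um (Suc i) t) - df (Up i t)) / (X (Suc i) t - X i t) else 0)"

definition intercept :: "nat \<Rightarrow> real \<Rightarrow> real" where
  "intercept i t = (if i = 0 then df (Um 1 t) else df (Up i t)) - slope i t * X i t"

section \<open>Evolution of the characteristic speeds and persistence of the shock structure\<close>

lemma particles_strict_mono: "t \<in> {0..T} \<Longrightarrow> 1 \<le> i \<Longrightarrow> i < j \<Longrightarrow> j \<le> n \<Longrightarrow> X i t < X j t"
  by (rule stepwise_increasing_less[of n "\<lambda>i. X i t"]) (auto intro: ordered)

lemma df_monotone: "strict_mono_on I df \<or> strict_antimono_on I df"
  by (rule strict_monotone_on_interval_of_deriv_sign[OF df_deriv I_interval ddf_sign])

lemma df_inj: "inj_on df I"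
  using df_monotone unfolding inj_on_def monotone_on_def by (metis linorder_neq_iff)

lemma ddf_nonzero: "u \<in> I \<Longrightarrow> ddf u \<noteq> 0"
  using ddf_sign by fastforce

text \<open>The chain rule multiplies the equation by \<open>ddf\<close> and so removes its last
  factor. The result is the rate of change seen along the path by an affine Burgers profile:
  \<open>W_t + s * W_x = (s - W) * W_x\<close>.\<close>

lemma left_speed_deriv:
  assumes i: "i \<in> {1..n}" and t: "t \<in> {0..T}"
  shows "((\<lambda>t. df (Um i t)) has_real_derivative (s i t - df (Um i t)) * slope (i - 1) t) (at t within {0..T})"
proof -
  have nz: "ddf (Um i t) \<noteq> 0" by (rule ddf_nonzero[OF states(1)[OF i t]])
  have "(df (Up (i - 1) t) - df (Um i t)) / (X (i - 1) t - X i t) = slope (i - 1) t" if "i \<noteq> 1"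
  proof -
    have "1 \<le> i - 1 \<and> i - 1 < n" "Suc (i - 1) = i" using that i by auto
    then show ?thesis
      using minus_divide_divide[of "df (Um i t) - df (Up (i - 1) t)" "X i t - X (i - 1) t"]
      by (simp add: slope_def)
  qed
  moreover have "slope (i - 1) t = 0" if "i = 1" using that by (simp add: slope_def)
  ultimately show ?thesis
    using DERIV_chain2[OF df_deriv ode_um[OF i t], folded s_def] nz
    by (cases "i = 1") (simp_all add: mult.commute)
qed

lemma right_speed_deriv:
  assumes i: "i \<in> {1..n}" and t: "t \<in> {0..T}"
  shows "((\<lambda>t. df (Up i t)) has_real_derivative (s i t - df (Up i t)) * slope i t) (at t within {0..T})"
proof -
  have nz: "ddf (Up i t) \<noteq> 0" by (rule ddf_nonzero[OF states(2)[OF i t]])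
  have "(df (Um (Suc i) t) - df (Up i t)) / (X (Suc i) t - X i t) = slope i t" if "i \<noteq> n"
    using that i by (simp add: slope_def)
  moreover have "slope i t = 0" if "i = n" using that by (simp add: slope_def)
  ultimately show ?thesis
    using DERIV_chain2[OF df_deriv ode_up[OF i t], folded s_def] nz
    by (cases "i = n") (simp_all add: mult.commute)
qed

text \<open>Let \<open>l\<close> be the length of the interval and \<open>a\<close> the slope. The
  rise \<open>a * l\<close> changes at the rate \<open>a * (l' - a * l)\<close>, so in the quotient
  rule the terms with \<open>l'\<close>, that is with the shock speeds, cancel and
  \<open>- a\<^sup>2\<close> remains.\<close>

lemma slope_deriv:
  assumes i: "i \<le> n" and t: "t \<in> {0..T}"
  shows "(slope i has_real_derivative - (slope i t)\<^sup>2) (at t within {0..T})"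
proof (cases "1 \<le> i \<and> i < n")
  case True
  then have i': "i \<in> {1..n}" "Suc i \<in> {1..n}" by auto
  have nz: "X (Suc i) t - X i t \<noteq> 0" using ordered[of i t] True t by auto
  have e: "df (Um (Suc i) t) - df (Up i t) = slope i t * (X (Suc i) t - X i t)"
    using True nz by (simp add: slope_def)
  have "((\<lambda>t. (df (Um (Suc i) t) - df (Up i t)) / (X (Suc i) t - X i t)) has_real_derivative
     ((((s (Suc i) t - df (Um (Suc i) t)) * slope i t - (s i t - df (Up i t)) * slope i t)) * (X (Suc i) t - X i t)
      - (df (Um (Suc i) t) - df (Up i t)) * (s (Suc i) t - s i t)) / ((X (Suc i) t - X i t) * (X (Suc i) t - X i t)))
     (at t within {0..T})"
    using DERIV_divide[OF DERIV_diff[OF left_speed_deriv[OF i'(2) t] right_speed_deriv[OF i'(1) t]]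
        DERIV_diff[OF ode_x[OF i'(2) t] ode_x[OF i'(1) t]] nz] by (simp add: s_def)
  moreover have "((((s (Suc i) t - df (Um (Suc i) t)) * slope i t - (s i t - df (Up i t)) * slope i t)) * (X (Suc i) t - X i t)
      - (df (Um (Suc i) t) - df (Up i t)) * (s (Suc i) t - s i t)) = - (slope i t * (X (Suc i) t - X i t)) * (slope i t * (X (Suc i) t - X i t))"
    unfolding e[symmetric] using e by (simp add: algebra_simps) algebra
  ultimately have "((\<lambda>t. (df (Um (Suc i) t) - df (Up i t)) / (X (Suc i) t - X i t)) has_real_derivative
     - (slope i t)\<^sup>2) (at t within {0..T})"
    using nz by (elim DERIV_cong) (simp add: power2_eq_square)
  then show ?thesis using True by (simp add: slope_def[abs_def])
next
  case False
  then show ?thesis by (auto simp: slope_def[abs_def])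
qed

lemma intercept_deriv:
  assumes i: "i \<le> n" and t: "t \<in> {0..T}"
  shows "(intercept i has_real_derivative - intercept i t * slope i t) (at t within {0..T})"
proof (cases "i = 0")
  case True
  then have "slope i = (\<lambda>_. 0)" by (auto simp: slope_def)
  moreover have "((\<lambda>t. df (Um 1 t)) has_real_derivative 0) (at t within {0..T})"
    using left_speed_deriv[of 1 t] n_pos t by (simp add: slope_def)
  ultimately show ?thesis using True by (simp add: intercept_def[abs_def])
next
  case False
  then have i': "i \<in> {1..n}" using i by auto
  have "((\<lambda>t. df (Up i t) - slope i t * X i t) has_real_derivative
     (s i t - df (Up i t)) * slope i t - (- (slope i t)\<^sup>2 * X i t + s i t * slope i t)) (at t within {0..T})"
    by (intro DERIV_diff right_speed_deriv[OF i' t] DERIV_mult slope_deriv[OF i t])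
      (use ode_x[OF i' t] in \<open>simp add: s_def\<close>)
  moreover have "(s i t - df (Up i t)) * slope i t - (- (slope i t)\<^sup>2 * X i t + s i t * slope i t)
      = - (df (Up i t) - slope i t * X i t) * slope i t" by algebra
  moreover have "intercept i = (\<lambda>t. df (Up i t) - slope i t * X i t)"
    using False by (simp add: intercept_def[abs_def])
  ultimately show ?thesis by simp
qed

lemma X_cont: "i \<in> {1..n} \<Longrightarrow> continuous_on {0..T} (X i)"
  using ode_x by (rule DERIV_continuous_on)

lemma Um_cont: "i \<in> {1..n} \<Longrightarrow> continuous_on {0..T} (Um i)"
  using ode_um by (rule DERIV_continuous_on)

lemma Up_cont: "i \<in> {1..n} \<Longrightarrow> continuous_on {0..T} (Up i)"
  using ode_up by (rule DERIV_continuous_on)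

lemma slope_cont: "i \<le> n \<Longrightarrow> continuous_on {0..T} (slope i)"
  using slope_deriv by (rule DERIV_continuous_on)

lemma intercept_cont: "i \<le> n \<Longrightarrow> continuous_on {0..T} (intercept i)"
  using intercept_deriv by (rule DERIV_continuous_on)

lemma f_cont: "continuous_on A f"
  using f_deriv by (meson DERIV_continuous_on has_field_derivative_at_within)

lemma df_cont: "continuous_on A df"
  using df_deriv by (meson DERIV_continuous_on has_field_derivative_at_within)

text \<open>Since the shock speed lies between the characteristic speeds, the jump of the characteristic speed
  satisfies a linear growth bound, so characteristic particles stay characteristic and shocks stay shocks.\<close>

lemma speed_jump_zero_persists:
  assumes i: "i \<in> {1..n}" and t: "t0 \<in> {0..T}" "t \<in> {0..T}" and zero: "df (Um i t0) = df (Up i t0)"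
  shows "df (Um i t) = df (Up i t)"
proof -
  have i': "i \<le> n" "i - 1 \<le> n" using i by auto
  have "continuous_on {0..T} (\<lambda>t. \<bar>slope (i - 1) t\<bar> + \<bar>slope i t\<bar>)"
    by (intro continuous_intros slope_cont i')
  then have "compact ((\<lambda>t. \<bar>slope (i - 1) t\<bar> + \<bar>slope i t\<bar>) ` {0..T})"
    by (intro compact_continuous_image) auto
  then obtain C where "\<forall>y\<in>(\<lambda>t. \<bar>slope (i - 1) t\<bar> + \<bar>slope i t\<bar>) ` {0..T}. norm y \<le> C"
    using compact_imp_bounded bounded_iff by metis
  then have C: "\<bar>slope (i - 1) t\<bar> + \<bar>slope i t\<bar> \<le> C" if "t \<in> {0..T}" for t using that by auto
  have "df (Um i t) - df (Up i t) = 0"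
  proof (rule linear_growth_zero_persists[OF _ _ t(1) _ t(2), where C = C])
    fix t assume t: "t \<in> {0..T}"
    show "((\<lambda>t. df (Um i t) - df (Up i t)) has_real_derivative
        (s i t - df (Um i t)) * slope (i - 1) t - (s i t - df (Up i t)) * slope i t) (at t within {0..T})"
      by (intro DERIV_diff left_speed_deriv right_speed_deriv i t)
    let ?d = "\<bar>df (Um i t) - df (Up i t)\<bar>"
    have "\<bar>s i t - df (Um i t)\<bar> \<le> ?d"
      unfolding s_def by (rule shock_speed_between[OF f_deriv I_interval states(1)[OF i t] states(2)[OF i t] df_monotone])
    moreover have "\<bar>s i t - df (Up i t)\<bar> \<le> ?d"
      using shock_speed_between[OF f_deriv I_interval states(2)[OF i t] states(1)[OF i t] df_monotone]
      by (simp add: s_def shock_speed_commute abs_minus_commute)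
    ultimately have "\<bar>(s i t - df (Um i t)) * slope (i - 1) t\<bar> + \<bar>(s i t - df (Up i t)) * slope i t\<bar>
        \<le> ?d * \<bar>slope (i - 1) t\<bar> + ?d * \<bar>slope i t\<bar>"
      unfolding abs_mult by (intro add_mono mult_right_mono) auto
    also have "\<dots> = (\<bar>slope (i - 1) t\<bar> + \<bar>slope i t\<bar>) * ?d" by (simp add: algebra_simps)
    also have "\<dots> \<le> C * ?d" using C[OF t] by (intro mult_right_mono) auto
    finally show "\<bar>(s i t - df (Um i t)) * slope (i - 1) t - (s i t - df (Up i t)) * slope i t\<bar> \<le> C * ?d"
      by (rule order_trans[OF abs_triangle_ineq4])
  qed (use zero in simp)
  then show ?thesis by simp
qed

text \<open>A wrong sign at time \<open>t\<close> would give, by the intermediate value theorem, an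
  earlier time of zero jump. Zero jumps persist, so the jump would vanish at \<open>t\<close> as
  well.\<close>

lemma oleinik:
  assumes i: "i \<in> {1..n}" and t: "t \<in> {0..T}"
  shows "df (Up i t) \<le> df (Um i t)"
proof (rule ccontr)
  assume neg: "\<not> df (Up i t) \<le> df (Um i t)"
  have 0: "0 \<in> {0..T}" using T by simp
  have "continuous_on {0..t} (\<lambda>t. df (Um i t) - df (Up i t))"
    by (intro continuous_intros continuous_on_compose2[OF df_cont] continuous_on_subset[OF Um_cont[OF i]]
        continuous_on_subset[OF Up_cont[OF i]]) (use t in auto)
  then obtain r where r: "0 \<le> r" "r \<le> t" "df (Um i r) - df (Up i r) = 0"
    using IVT2'[of "\<lambda>t. df (Um i t) - df (Up i t)" t 0 0] neg oleinik0[OF i] t by auto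
  then have "df (Um i t) = df (Up i t)"
    using speed_jump_zero_persists[OF i _ t, of r] t by auto
  then show False using neg by simp
qed

text \<open>The quotient in the shock speed would be delicate where two states merge. Persistence
  excludes this: a particle is characteristic at all times or at none, and each case has its own
  continuous formula.\<close>

lemma s_cont:
  assumes i: "i \<in> {1..n}"
  shows "continuous_on {0..T} (s i)"
proof (cases "\<exists>t0\<in>{0..T}. Um i t0 = Up i t0")
  case True
  then have "Um i t = Up i t" if "t \<in> {0..T}" for t
    using speed_jump_zero_persists[OF i _ that] states[OF i that] df_inj unfolding inj_on_def by metis
  then have "continuous_on {0..T} (s i) \<longleftrightarrow> continuous_on {0..T} (\<lambda>t. df (Um i t))"
    by (intro continuous_on_cong) (auto simp: s_def shock_speed_def)
  then show ?thesis
    using continuous_on_compose2[OF df_cont Um_cont[OF i]] by blast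
next
  case False
  then have "continuous_on {0..T} (s i) \<longleftrightarrow> continuous_on {0..T} (\<lambda>t. (f (Um i t) - f (Up i t)) / (Um i t - Up i t))"
    by (intro continuous_on_cong) (auto simp: s_def shock_speed_def)
  moreover have "continuous_on {0..T} (\<lambda>t. (f (Um i t) - f (Up i t)) / (Um i t - Up i t))"
    using False
    by (intro continuous_intros continuous_on_compose2[OF f_cont] Um_cont[OF i] Up_cont[OF i]) auto
  ultimately show ?thesis by blast
qed

text \<open>\<open>I\<close> may be unbounded or open, so the inverse of \<open>df\<close> is built
  on the hull of the states attained up to time \<open>T\<close>.\<close>

lemma states_compact_hull:
  obtains c d where "c \<le> d" "{c..d} \<subseteq> I"
    "\<And>i t. i \<in> {1..n} \<Longrightarrow> t \<in> {0..T} \<Longrightarrow> Um i t \<in> {c..d} \<and> Up i t \<in> {c..d}"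
proof -
  define K where "K = (\<Union>i\<in>{1..n}. Um i ` {0..T} \<union> Up i ` {0..T})"
  have "compact K"
    unfolding K_def by (intro compact_UN compact_Un compact_continuous_image Um_cont Up_cont) auto
  have K: "Um i t \<in> K" "Up i t \<in> K" if "i \<in> {1..n}" "t \<in> {0..T}" for i t
    using that unfolding K_def by blast+
  have "K \<noteq> {}" using K(1)[of 1 0] n_pos T by auto
  obtain c where c: "c \<in> K" "\<And>w. w \<in> K \<Longrightarrow> c \<le> w"
    using compact_attains_inf[OF \<open>compact K\<close> \<open>K \<noteq> {}\<close>] by blast
  obtain d where d: "d \<in> K" "\<And>w. w \<in> K \<Longrightarrow> w \<le> d"
    using compact_attains_sup[OF \<open>compact K\<close> \<open>K \<noteq> {}\<close>] by blast
  have "K \<subseteq> I" using states unfolding K_def by blast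
  then have "{c..d} \<subseteq> I"
    using I_interval c(1) d(1) unfolding is_interval_1 by (meson atLeastAtMost_iff subsetD subsetI)
  then show thesis using that[of c d] c(2)[OF d(1)] c(2)[OF K(1)] c(2)[OF K(2)] d(2)[OF K(1)] d(2)[OF K(2)] by auto
qed

section \<open>The affine profile and the interpolant\<close>

lemma left_trace: "i \<in> {1..n} \<Longrightarrow> t \<in> {0..T} \<Longrightarrow> intercept (i - 1) t + slope (i - 1) t * X i t = df (Um i t)"
  using ordered[of "i - 1" t]
  by (cases "i = 1") (auto simp: intercept_def slope_def field_simps)

lemma right_trace: "i \<in> {1..n} \<Longrightarrow> t \<in> {0..T} \<Longrightarrow> intercept i t + slope i t * X i t = df (Up i t)"
  by (auto simp: intercept_def)

lemma strip_between:
  assumes i: "1 \<le> i" "i < n" and t: "t \<in> {0..T}" and x: "X i t \<le> x" "x \<le> X (Suc i) t"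
  shows "min (df (Up i t)) (df (Um (Suc i) t)) \<le> intercept i t + slope i t * x"
    "intercept i t + slope i t * x \<le> max (df (Up i t)) (df (Um (Suc i) t))"
proof -
  have l: "X i t < X (Suc i) t" using ordered i t by blast
  define \<theta> where "\<theta> = (x - X i t) / (X (Suc i) t - X i t)"
  have \<theta>: "0 \<le> \<theta>" "\<theta> \<le> 1" using l x by (simp_all add: \<theta>_def)
  define a b where "a = df (Up i t)" and "b = df (Um (Suc i) t)"
  have e: "intercept i t + slope i t * x = (1 - \<theta>) * a + \<theta> * b"
    using i l by (simp add: intercept_def slope_def \<theta>_def a_def b_def field_simps)
  have "(1 - \<theta>) * min a b + \<theta> * min a b \<le> (1 - \<theta>) * a + \<theta> * b"
    using \<theta> by (intro add_mono mult_left_mono) auto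
  moreover have "(1 - \<theta>) * a + \<theta> * b \<le> (1 - \<theta>) * max a b + \<theta> * max a b"
    using \<theta> by (intro add_mono mult_left_mono) auto
  ultimately show "min (df (Up i t)) (df (Um (Suc i) t)) \<le> intercept i t + slope i t * x"
    "intercept i t + slope i t * x \<le> max (df (Up i t)) (df (Um (Suc i) t))"
    unfolding e a_def[symmetric] b_def[symmetric] by (simp_all add: algebra_simps)
qed

lemma strip_range:
  assumes i: "i \<le> n" and t: "t \<in> {0..T}" and x: "1 \<le> i \<Longrightarrow> X i t \<le> x" "i < n \<Longrightarrow> x \<le> X (Suc i) t"
    and cd: "\<And>i t. i \<in> {1..n} \<Longrightarrow> t \<in> {0..T} \<Longrightarrow> Um i t \<in> {c..d} \<and> Up i t \<in> {c..d}"
  shows "intercept i t + slope i t * x \<in> df ` {c..d}"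
proof (cases "1 \<le> i \<and> i < n")
  case True
  have "is_interval (df ` {c..d})"
    by (simp add: is_interval_connected_1 connected_continuous_image df_cont)
  moreover have "df (Up i t) \<in> df ` {c..d}" "df (Um (Suc i) t) \<in> df ` {c..d}"
    using cd[OF _ t, of i] cd[OF _ t, of "Suc i"] True by auto
  moreover note strip_between[of i t x] True t x
  ultimately show ?thesis unfolding is_interval_1
    by (smt (verit, ccfv_threshold) max_def min_def)
next
  case False
  then have "intercept i t + slope i t * x = (if i = 0 then df (Um 1 t) else df (Up i t))"
    by (auto simp: intercept_def slope_def)
  then show ?thesis using cd[OF _ t, of 1] cd[OF _ t, of n] n_pos False i by auto
qed

text \<open>The defining equation of the interpolant says that \<open>df\<close> of the value is
  affine in \<open>x\<close>, and injectivity of \<open>df\<close> on \<open>I\<close> leaves one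
  value. A particle shared by two intervals belongs to the left one through \<open>LEAST\<close>,
  whence the strict inequality for \<open>i\<close> other than 1.\<close>

lemma interpolant_eq:
  assumes i: "1 \<le> i" "i < n" and t: "t \<in> {0..T}" and x: "i = 1 \<or> X i t < x" "X i t \<le> x" "x \<le> X (Suc i) t"
    and v: "v \<in> I" "df v = intercept i t + slope i t * x"
  shows "interpolant df n (\<lambda>i. X i t) (\<lambda>i. Um i t) (\<lambda>i. Up i t) x = v"
proof -
  have l: "X i t < X (Suc i) t" using ordered i t by blast
  have mono: "X j t \<le> X k t" if "1 \<le> j" "j \<le> k" "k \<le> n" for j k
    using particles_strict_mono[OF t, of j k] that by (cases "j = k") auto
  have least: "(LEAST i. 1 \<le> i \<and> i < n \<and> X i t \<le> x \<and> x \<le> X (Suc i) t) = i"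
  proof (rule Least_equality)
    show "1 \<le> i \<and> i < n \<and> X i t \<le> x \<and> x \<le> X (Suc i) t" using i x by blast
    fix j assume j: "1 \<le> j \<and> j < n \<and> X j t \<le> x \<and> x \<le> X (Suc j) t"
    show "i \<le> j"
    proof (rule ccontr)
      assume "\<not> i \<le> j"
      then have "i \<noteq> 1" "X (Suc j) t \<le> X i t" using j i mono[of "Suc j" i] by auto
      then show False using x(1) j by auto
    qed
  qed
  have mem: "Up i t \<in> I" "Um (Suc i) t \<in> I" using states i t by auto
  have ex: "\<exists>i. 1 \<le> i \<and> i < n \<and> X i t \<le> x \<and> x \<le> X (Suc i) t" using i x by blast
  note unfold = interpolant_def if_P[OF ex] Let_def least
  show ?thesis
  proof (cases "Up i t = Um (Suc i) t")
    case True
    then have "df v = df (Up i t)" using v(2) i by (simp add: intercept_def slope_def)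
    then have "v = Up i t" using df_inj v(1) mem unfolding inj_on_def by blast
    then show ?thesis unfolding unfold using True by simp
  next
    case False
    then have nz: "df (Um (Suc i) t) \<noteq> df (Up i t)" using df_inj mem unfolding inj_on_def by metis
    let ?P = "\<lambda>w. min (Up i t) (Um (Suc i) t) \<le> w \<and> w \<le> max (Up i t) (Um (Suc i) t) \<and>
        (x - X i t) / (X (Suc i) t - X i t) = (df w - df (Up i t)) / (df (Um (Suc i) t) - df (Up i t))"
    \<comment> \<open>Multiplying out the normalised ratio turns the defining equation into equality
      of characteristic speeds.\<close>
    have eq: "(x - X i t) / (X (Suc i) t - X i t) = (df w - df (Up i t)) / (df (Um (Suc i) t) - df (Up i t)) \<longleftrightarrow> df w = df v" for w
    proof -
      have "df v - df (Up i t) = slope i t * (x - X i t)"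
        using i by (simp add: v(2) intercept_def algebra_simps)
      also have "\<dots> = (x - X i t) / (X (Suc i) t - X i t) * (df (Um (Suc i) t) - df (Up i t))"
        using i by (simp add: slope_def)
      finally have "(x - X i t) / (X (Suc i) t - X i t) * (df (Um (Suc i) t) - df (Up i t)) = df v - df (Up i t)" ..
      moreover have "df (Um (Suc i) t) - df (Up i t) \<noteq> 0" using nz by simp
      ultimately show ?thesis by (metis diff_add_cancel nonzero_eq_divide_eq)
    qed
    have "(THE w. ?P w) = v"
    proof (rule the_equality)
      \<comment> \<open>The affine profile lies between its end values; strict monotonicity of
        \<open>df\<close>, in either direction, carries this back to the states.\<close>
      have "min (Up i t) (Um (Suc i) t) \<le> v \<and> v \<le> max (Up i t) (Um (Suc i) t)"
        using strip_between[OF i t x(2,3), folded v(2)] df_monotone v(1) mem nz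
        unfolding monotone_on_def min_def max_def
        by (smt (verit))
      then show "?P v" by (simp add: eq)
      fix w assume w: "?P w"
      then have "w \<in> I"
        using I_interval mem unfolding is_interval_1 by (metis max_def min_def)
      moreover have "df w = df v" using w eq by blast
      ultimately show "w = v" using df_inj v(1) unfolding inj_on_def by blast
    qed
    then show ?thesis unfolding unfold using False by simp
  qed
qed

end

section \<open>The interpolant continued to the whole line, compared with the strip solution\<close>

context particle_system begin

definition extension :: "real \<Rightarrow> real \<Rightarrow> real" where
  "extension t x = (if x < X 1 t then Um 1 t else if X n t < x then Up n t
     else interpolant df n (\<lambda>i. X i t) (\<lambda>i. Um i t) (\<lambda>i. Up i t) x)"

text \<open>Measurability and boundedness involve the values on the paths. A single particle leaves
  no interval, so the interpolant there is the fixed but unknown real number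
  \<open>undefined\<close>.\<close>

lemma extension_at_particle:
  assumes t: "t \<in> {0..T}" and i: "i \<in> {1..n}"
  shows "extension t (X i t) = (if n = 1 then undefined else if i = 1 then Up 1 t else Um i t)"
proof -
  have "X 1 t \<le> X i t" "X i t \<le> X n t"
    using particles_strict_mono[OF t, of 1 i] particles_strict_mono[OF t, of i n] i
    by (cases "i = 1"; force; cases "i = n"; force)+
  then have e: "extension t (X i t) = interpolant df n (\<lambda>i. X i t) (\<lambda>i. Um i t) (\<lambda>i. Up i t) (X i t)"
    by (simp add: extension_def)
  consider "n = 1" | "n \<noteq> 1" "i = 1" | "n \<noteq> 1" "i \<noteq> 1" by blast
  then show ?thesis
  proof cases
    case 1
    then have none: "\<not> (\<exists>j. 1 \<le> j \<and> j < n \<and> X j t \<le> X i t \<and> X i t \<le> X (Suc j) t)" by simp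
    show ?thesis unfolding e interpolant_def if_not_P[OF none] using 1 by simp
  next
    case 2
    then have n: "1 < n" using n_pos by simp
    have "interpolant df n (\<lambda>i. X i t) (\<lambda>i. Um i t) (\<lambda>i. Up i t) (X 1 t) = Up 1 t"
      by (rule interpolant_eq[of 1])
        (use n t states(2)[of 1 t] right_trace[of 1 t] ordered[of 1 t] in auto)
    then show ?thesis using 2 e by simp
  next
    case 3
    then have i': "1 \<le> i - 1" "i - 1 < n" "Suc (i - 1) = i" using i by auto
    have "interpolant df n (\<lambda>i. X i t) (\<lambda>i. Um i t) (\<lambda>i. Up i t) (X i t) = Um i t"
      by (rule interpolant_eq[OF i'(1,2) t])
        (use i i' t states(1)[OF i t] left_trace[OF i t] ordered[OF i'(1,2) t] in auto)
    then show ?thesis using 3 e by simp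
  qed
qed

text \<open>The particle data form an instance of \<open>shock_fronts\<close>, whose solution equals
  \<open>extension\<close> off the paths. Both existence and uniqueness are then transferred across
  this null set, for the initial values as well.\<close>

theorem extension_entropy_solution_unique:
  "entropy_solution f T (extension 0) extension"
  "entropy_solution f T (extension 0) v \<Longrightarrow>
    AE z in lborel. 0 < fst z \<and> fst z < T \<and> X 1 (fst z) \<le> snd z \<and> snd z \<le> X n (fst z) \<longrightarrow>
      v (fst z) (snd z) = interpolant df n (\<lambda>i. X i (fst z)) (\<lambda>i. Um i (fst z)) (\<lambda>i. Up i (fst z)) (snd z)"
proof -
  obtain c d where cd: "c \<le> d" "{c..d} \<subseteq> I"
    and hull: "\<And>i t. i \<in> {1..n} \<Longrightarrow> t \<in> {0..T} \<Longrightarrow> Um i t \<in> {c..d} \<and> Up i t \<in> {c..d}"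
    using states_compact_hull by blast
  obtain g where g: "continuous_on UNIV g" "\<And>z. g z \<in> {c..d}" "\<And>w. w \<in> {c..d} \<Longrightarrow> g (df w) = w"
    using continuous_inverse_extension[OF df_cont inj_on_subset[OF df_inj cd(2)] cd(1)] by blast
  \<comment> \<open>Freezing the data before time 0 and after \<open>T\<close> yields the continuous
    functions on all of time that \<open>shock_fronts\<close> requires, without changing derivatives
    within \<open>[0, T]\<close>.\<close>
  define clip where "clip t = max 0 (min T t)" for t
  have clip: "clip t \<in> {0..T}" "t \<in> {0..T} \<Longrightarrow> clip t = t" for t
    using T by (auto simp: clip_def)
  have clip_cont: "continuous_on UNIV (\<lambda>t. h (clip t))" if "continuous_on {0..T} h" for h :: "real \<Rightarrow> real"
    by (rule continuous_on_compose2[OF that]) (use clip(1) in \<open>auto simp: clip_def intro!: continuous_intros\<close>)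
  have clip_deriv: "((\<lambda>t. h (clip t)) has_real_derivative D) (at t within {0..T})"
    if "(h has_real_derivative D) (at t within {0..T})" "t \<in> {0..T}" for h D t
    using that(1) by (rule has_field_derivative_transform_within[OF _ zero_less_one that(2)]) (simp add: clip(2))
  define X' where "X' i t = (if i \<in> {1..n} then X i (clip t) else 0)" for i t
  define \<alpha> where "\<alpha> i t = (if i \<le> n then intercept i (clip t) else 0)" for i t
  define \<beta> where "\<beta> i t = (if i \<le> n then slope i (clip t) else 0)" for i t
  have X': "X' i t = X i t" if "i \<in> {1..n}" "t \<in> {0..T}" for i t using that by (simp add: X'_def clip(2))
  have \<alpha>\<beta>: "\<alpha> i t = intercept i t" "\<beta> i t = slope i t" if "i \<le> n" "t \<in> {0..T}" for i t
    using that by (simp_all add: \<alpha>_def \<beta>_def clip(2))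
  have traces: "g (\<alpha> i t + \<beta> i t * X' i t) = Up i t" "g (\<alpha> (i - 1) t + \<beta> (i - 1) t * X' i t) = Um i t"
    if i: "i \<in> {1..n}" and t: "t \<in> {0..T}" for i t
  proof -
    have i': "i \<le> n" "i - 1 \<le> n" using i by auto
    show "g (\<alpha> i t + \<beta> i t * X' i t) = Up i t" "g (\<alpha> (i - 1) t + \<beta> (i - 1) t * X' i t) = Um i t"
      unfolding X'[OF i t] \<alpha>\<beta>[OF i'(1) t] \<alpha>\<beta>[OF i'(2) t] right_trace[OF i t] left_trace[OF i t]
      using g(3) hull[OF i t] by blast+
  qed
  interpret F: shock_fronts f df ddf g T c d n X' s \<alpha> \<beta>
  proof
    show "continuous_on UNIV (X' i)" for i
    proof (cases "i \<in> {1..n}")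
      case True
      then show ?thesis using clip_cont[OF X_cont[OF True]] by (simp add: X'_def[abs_def])
    next
      case False
      then have "X' i = (\<lambda>_. 0)" by (intro ext) (simp only: X'_def if_False)
      then show ?thesis by simp
    qed
    show "continuous_on UNIV (\<alpha> i)" for i
      using clip_cont[OF intercept_cont[of i]] by (cases "i \<le> n") (simp_all add: \<alpha>_def[abs_def])
    show "continuous_on UNIV (\<beta> i)" for i
      using clip_cont[OF slope_cont[of i]] by (cases "i \<le> n") (simp_all add: \<beta>_def[abs_def])
    show "(X' i has_real_derivative s i t) (at t within {0..T})" if "i \<in> {1..n}" "t \<in> {0..T}" for i t
      using clip_deriv[OF ode_x[OF that] that(2)] that(1) by (simp add: X'_def[abs_def] s_def)
    show "(\<alpha> i has_real_derivative - \<alpha> i t * \<beta> i t) (at t within {0..T})" if "i \<le> n" "t \<in> {0..T}" for i t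
      using clip_deriv[OF intercept_deriv[OF that] that(2)] that by (simp add: \<alpha>_def[abs_def] \<beta>_def clip(2))
    show "(\<beta> i has_real_derivative - (\<beta> i t)\<^sup>2) (at t within {0..T})" if "i \<le> n" "t \<in> {0..T}" for i t
      using clip_deriv[OF slope_deriv[OF that] that(2)] that by (simp add: \<beta>_def[abs_def] clip(2))
    show "X' i t < X' (Suc i) t" if "1 \<le> i" "i < n" "t \<in> {0..T}" for i t
      using ordered[OF that] that by (simp add: X')
    show "\<alpha> i t + \<beta> i t * x \<in> df ` {c..d}"
      if "i \<le> n" "t \<in> {0..T}" "1 \<le> i \<Longrightarrow> X' i t \<le> x" "i < n \<Longrightarrow> x \<le> X' (Suc i) t" for i t x
      unfolding \<alpha>\<beta>[OF that(1,2)]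
      by (rule strip_range[OF that(1,2) _ _ hull]) (use that in \<open>simp_all add: X'\<close>)
    show "s i t * (g (\<alpha> i t + \<beta> i t * X' i t) - g (\<alpha> (i - 1) t + \<beta> (i - 1) t * X' i t))
        = f (g (\<alpha> i t + \<beta> i t * X' i t)) - f (g (\<alpha> (i - 1) t + \<beta> (i - 1) t * X' i t))"
      if "i \<in> {1..n}" "t \<in> {0..T}" for i t
      unfolding traces[OF that] by (simp add: s_def shock_speed_def divide_simps) (simp add: algebra_simps)
    show "0 \<le> s i t * (\<bar>g (\<alpha> i t + \<beta> i t * X' i t) - k\<bar> - \<bar>g (\<alpha> (i - 1) t + \<beta> (i - 1) t * X' i t) - k\<bar>)
        - (kruzkov_flux f (g (\<alpha> i t + \<beta> i t * X' i t)) k - kruzkov_flux f (g (\<alpha> (i - 1) t + \<beta> (i - 1) t * X' i t)) k)"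
      if "i \<in> {1..n}" "t \<in> {0..T}" for i t k
      unfolding traces[OF that] s_def
      by (rule shock_entropy_production_nonneg[OF f_deriv I_interval states(1)[OF that] states(2)[OF that]
            df_monotone oleinik[OF that]])
  qed (use T f_deriv df_deriv cd(1) g s_cont in auto)
  have 0: "0 \<in> {0..T}" using T by simp
  \<comment> \<open>By injectivity of \<open>df\<close> it suffices to compare characteristic
    speeds. The strips 0 and \<open>n\<close> correspond to the two outer constants, the others to
    the interpolant.\<close>
  have off: "extension t x = F.fan t x" if t: "t \<in> {0..T}" and x: "\<And>i. i \<in> {1..n} \<Longrightarrow> x \<noteq> X i t" for t x
  proof -
    define m where "m = F.passed t x"
    have m: "m \<le> n" unfolding m_def by (rule F.passed_le)
    have df_fan: "df (F.fan t x) = intercept m t + slope m t * x"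
      using F.W_fan[OF t, of x] by (simp add: F.W_def m_def[symmetric] \<alpha>\<beta>[OF m t])
    have fan_I: "F.fan t x \<in> I" using F.fan_range[of t x] cd(2) by blast
    have eqI: "w = F.fan t x" if "w \<in> I" "df w = df (F.fan t x)" for w
      using df_inj fan_I that unfolding inj_on_def by blast
    have lo: "X m t \<le> x" if "1 \<le> m" using F.passed_bounds(1)[OF t, of x] that m X'[OF _ t, of m] by (simp add: m_def)
    have hi: "x < X (Suc m) t" if "m < n"
      using F.passed_bounds(2)[OF t, of x] that X'[OF _ t, of "Suc m"] by (simp add: m_def)
    consider "x < X 1 t" | "\<not> x < X 1 t" "X n t < x" | "\<not> x < X 1 t" "\<not> X n t < x" by blast
    then show ?thesis
    proof cases
      case 1
      have "m = 0"
      proof (rule ccontr)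
        assume "m \<noteq> 0"
        then show False using 1 lo particles_strict_mono[OF t, of 1 m] m by (cases "m = 1") force+
      qed
      then have "df (Um 1 t) = df (F.fan t x)" by (simp add: df_fan intercept_def slope_def)
      then have "Um 1 t = F.fan t x" by (rule eqI[rotated]) (use states(1)[OF _ t] n_pos in simp)
      then show ?thesis using 1 by (simp add: extension_def)
    next
      case 2
      have "m = n"
      proof (rule ccontr)
        assume "m \<noteq> n"
        then show False using 2 hi particles_strict_mono[OF t, of "Suc m" n] m by (cases "Suc m = n") force+
      qed
      then have "df (Up n t) = df (F.fan t x)" using n_pos by (simp add: df_fan intercept_def slope_def)
      then have "Up n t = F.fan t x" by (rule eqI[rotated]) (use states(2)[OF _ t] n_pos in simp)
      then show ?thesis using 2 by (simp add: extension_def)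
    next
      case 3
      then have x1: "X 1 t < x" "x < X n t" using x[of 1] x[of n] n_pos by auto
      have m1: "1 \<le> m" using hi x1(1) n_pos by (cases "m = 0") auto
      have mn: "m < n" using lo[OF m1] x1(2) m by (cases "m = n") auto
      have "X m t < x" using lo[OF m1] x[of m] m1 m by force
      then have "interpolant df n (\<lambda>i. X i t) (\<lambda>i. Um i t) (\<lambda>i. Up i t) x = F.fan t x"
        using hi[OF mn] by (intro interpolant_eq[OF m1 mn t _ _ _ fan_I df_fan]) auto
      then show ?thesis using 3 by (simp add: extension_def)
    qed
  qed
  \<comment> \<open>The values on the paths. For \<open>n = 1\<close> this is
    \<open>undefined\<close>, which is why its modulus enters the bounds.\<close>
  define val where "val i t = (if n = 1 then undefined else if i = 1 then Up 1 (clip t) else Um i (clip t))" for i t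
  have val_range: "\<bar>val i t\<bar> \<le> max \<bar>undefined\<bar> (max \<bar>c\<bar> \<bar>d\<bar>)" if "i \<in> {1..n}" for i t
    using hull[OF that clip(1)[of t]] hull[OF _ clip(1)[of t], of 1] n_pos by (auto simp: val_def)
  \<comment> \<open>A Borel formula equal to \<open>extension\<close> everywhere on
    \<open>[0, T]\<close>, paths included; equality almost everywhere would not transfer Borel
    measurability. Strict order leaves at most one nonzero choice of path in the first sum.\<close>
  define G where "G z = (if \<exists>i\<in>{1..n}. snd z = X' i (fst z)
      then \<Sum>i\<in>{1..n}. if snd z = X' i (fst z) then val i (fst z) else 0
      else g (F.W 0 (fst z) (snd z)) + (\<Sum>i\<in>{1..n}. if X' i (fst z) \<le> snd z
        then g (F.W i (fst z) (snd z)) - g (F.W (i - 1) (fst z) (snd z)) else 0))" for z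
  have on: "extension t (X i t) = val i t" if "i \<in> {1..n}" "t \<in> {0..T}" for i t
    using extension_at_particle[OF that(2,1)] that by (simp add: val_def clip(2))
  have G: "extension t x = G (t, x)" if t: "t \<in> {0..T}" for t x
  proof (cases "\<exists>i\<in>{1..n}. x = X' i t")
    case True
    then obtain i where i: "i \<in> {1..n}" "x = X' i t" by blast
    have "x = X' j t \<longleftrightarrow> i = j" if "j \<in> {1..n}" for j
      using that i particles_strict_mono[OF t, of i j] particles_strict_mono[OF t, of j i] X'[OF _ t]
      by (cases i j rule: linorder_cases) force+
    then have "(\<Sum>j\<in>{1..n}. if x = X' j t then val j t else 0) = (\<Sum>j\<in>{1..n}. if i = j then val j t else 0)"
      by (intro sum.cong) auto
    also have "\<dots> = val i t" using i(1) by simp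
    finally have "G (t, x) = val i t" using True by (simp add: G_def cong: if_cong)
    then show ?thesis using on[OF i(1) t] X'[OF i(1) t] i(2) by simp
  next
    case False
    then have "extension t x = F.fan t x" using off[OF t, of x] X'[OF _ t] by metis
    then show ?thesis using False F.fan_eq_sum[OF t, of x] by (simp add: G_def cong: if_cong)
  qed
  have G_meas: "G \<in> borel_measurable borel"
  proof -
    have [measurable]: "val i \<in> borel_measurable borel" if "i \<in> {1..n}" for i
      unfolding val_def[abs_def]
      using borel_measurable_continuous_onI[OF clip_cont[OF Um_cont[OF that]]]
        borel_measurable_continuous_onI[OF clip_cont[OF Up_cont[of 1]]] n_pos
      by (cases "n = 1"; cases "i = 1") simp_all
    have [measurable]: "X' i \<in> borel_measurable borel" for i
      by (rule borel_measurable_continuous_onI[OF F.X_cont])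
    note [measurable] = F.fan_sum_measurable
    show ?thesis unfolding G_def[abs_def] by measurable
  qed
  have meas: "set_borel_measurable lborel ({0<..<T} \<times> UNIV) (\<lambda>z. extension (fst z) (snd z))"
  proof -
    have "(\<lambda>z. indicator ({0<..<T} \<times> UNIV) z *\<^sub>R extension (fst z) (snd z)) = (\<lambda>z. time_strip T z * G z)"
      by (rule ext) (auto simp: time_strip_def indicator_def G)
    moreover have "(\<lambda>z. time_strip T z * G z) \<in> borel_measurable borel"
      by (intro borel_measurable_times time_strip_measurable G_meas)
    ultimately show ?thesis by (simp add: set_borel_measurable_def)
  qed
  have meas0: "extension 0 \<in> borel_measurable borel"
  proof -
    have "(\<lambda>x :: real. (0 :: real, x)) \<in> borel_measurable borel"
      by (intro borel_measurable_continuous_onI continuous_on_Pair continuous_on_const continuous_on_id)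
    from measurable_compose[OF this G_meas] show ?thesis by (simp add: G[OF 0, symmetric])
  qed
  have bound: "\<bar>extension t x\<bar> \<le> max \<bar>undefined\<bar> (max \<bar>c\<bar> \<bar>d\<bar>)" if "0 < t" "t < T" for t x
  proof -
    have t: "t \<in> {0..T}" using that by simp
    show ?thesis
    proof (cases "\<exists>i\<in>{1..n}. x = X i t")
      case True
      then obtain i where i: "i \<in> {1..n}" "x = X i t" by blast
      then show ?thesis using on[OF i(1) t] val_range[OF i(1), of t] by simp
    next
      case False
      then have "extension t x = F.fan t x" using off[OF t] by metis
      then show ?thesis using F.fan_bounded[of t x] by (simp only: max.coboundedI2)
    qed
  qed
  have ae: "AE z in lborel. \<forall>i\<in>{1..n}. snd z \<noteq> X' i (fst z)"
    by (rule AE_finite_allI) (auto intro: AE_off_graph F.X_cont)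
  then have ae_eq: "AE z in lborel. 0 < fst z \<and> fst z < T \<longrightarrow> extension (fst z) (snd z) = F.fan (fst z) (snd z)"
  proof eventually_elim
    case (elim z)
    show ?case
    proof
      assume "0 < fst z \<and> fst z < T"
      then have t: "fst z \<in> {0..T}" by simp
      show "extension (fst z) (snd z) = F.fan (fst z) (snd z)"
        by (rule off[OF t]) (use elim X'[OF _ t] in metis)
    qed
  qed
  have "AE x in lborel. \<forall>i\<in>{1..n}. x \<noteq> X i 0"
    by (rule AE_finite_allI) (auto intro: AE_lborel_singleton)
  then have ae0: "AE x in lborel. extension 0 x = F.fan 0 x"
    by eventually_elim (rule off[OF 0], blast)
  show "entropy_solution f T (extension 0) extension"
    by (rule entropy_solution_cong_AE[OF F.fan_entropy_solution f_cont F.fan_initial_measurable meas0 ae0 meas bound ae_eq])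
  assume v: "entropy_solution f T (extension 0) v"
  obtain M where M: "\<And>t x. 0 < t \<Longrightarrow> t < T \<Longrightarrow> \<bar>v t x\<bar> \<le> M"
    using v unfolding entropy_solution_def by blast
  \<comment> \<open>The competitor is unchanged; only its initial function is replaced by one equal
    to it almost everywhere.\<close>
  have "entropy_solution f T (F.fan 0) v"
  proof (rule entropy_solution_cong_AE[OF v f_cont meas0 F.fan_initial_measurable])
    show "AE x in lborel. F.fan 0 x = extension 0 x" using ae0 by eventually_elim simp
    show "set_borel_measurable lborel ({0<..<T} \<times> UNIV) (\<lambda>z. v (fst z) (snd z))"
      using v unfolding entropy_solution_def by blast
  qed (use M in auto)
  from F.fan_unique[OF this] ae_eq
  show "AE z in lborel. 0 < fst z \<and> fst z < T \<and> X 1 (fst z) \<le> snd z \<and> snd z \<le> X n (fst z) \<longrightarrow>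
      v (fst z) (snd z) = interpolant df n (\<lambda>i. X i (fst z)) (\<lambda>i. Um i (fst z)) (\<lambda>i. Up i (fst z)) (snd z)"
    by eventually_elim (auto simp: extension_def)
qed

end

text \<open>Continuity at time 0 keeps the finitely many particles in strict order for a while. On a
  closed interval within that period the data form a \<open>particle_system\<close>.\<close>

theorem theorem1:
  fixes f df ddf :: "real \<Rightarrow> real"
    and I :: "real set"
    and n :: nat
    and T0 :: real
    and X Um Up :: "nat \<Rightarrow> real \<Rightarrow> real"
  assumes f_deriv: "\<forall>u. (f has_real_derivative df u) (at u)"
    and df_deriv: "\<forall>u. (df has_real_derivative ddf u) (at u)"
    and I_interval: "is_interval I"
    and convex_or_concave: "(\<forall>u\<in>I. ddf u > 0) \<or> (\<forall>u\<in>I. ddf u < 0)"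
    and n_pos: "n \<ge> 1"
    and T0_pos: "T0 > 0"
    and states_in_I: "\<forall>i\<in>{1..n}. \<forall>t\<in>{0..<T0}. Um i t \<in> I \<and> Up i t \<in> I"
    and ordered: "\<forall>i. 1 \<le> i \<and> i < n \<longrightarrow> X i 0 < X (Suc i) 0"
    and oleinik: "\<forall>i\<in>{1..n}. df (Um i 0) \<ge> df (Up i 0)"
    and ode_x: "\<forall>i\<in>{1..n}. \<forall>t\<in>{0..<T0}.
        (X i has_real_derivative shock_speed f df (Um i t) (Up i t)) (at t within {0..<T0})"
    and ode_um: "\<forall>i\<in>{1..n}. \<forall>t\<in>{0..<T0}.
        (Um i has_real_derivative
          (if i = 1 then 0
           else (shock_speed f df (Um i t) (Up i t) - df (Um i t))
                * ((df (Up (i - 1) t) - df (Um i t)) / (X (i - 1) t - X i t))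
                * (1 / ddf (Um i t)))) (at t within {0..<T0})"
    and ode_up: "\<forall>i\<in>{1..n}. \<forall>t\<in>{0..<T0}.
        (Up i has_real_derivative
          (if i = n then 0
           else (shock_speed f df (Um i t) (Up i t) - df (Up i t))
                * ((df (Um (Suc i) t) - df (Up i t)) / (X (Suc i) t - X i t))
                * (1 / ddf (Up i t)))) (at t within {0..<T0})"
  shows "\<exists>T>0. T \<le> T0 \<and>
    (let ubar = (\<lambda>t x. if x < X 1 t then Um 1 t
                        else if X n t < x then Up n t
                        else interpolant df n (\<lambda>i. X i t) (\<lambda>i. Um i t) (\<lambda>i. Up i t) x)
     in entropy_solution f T (ubar 0) ubar \<and>
        (\<forall>v. entropy_solution f T (ubar 0) v \<longrightarrow>
           (AE z in lborel. (0 < fst z \<and> fst z < T \<and> X 1 (fst z) \<le> snd z \<and> snd z \<le> X n (fst z))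
              \<longrightarrow> v (fst z) (snd z) =
                  interpolant df n (\<lambda>i. X i (fst z)) (\<lambda>i. Um i (fst z)) (\<lambda>i. Up i (fst z)) (snd z))))"
proof -
  have half: "{0..T0 / 2} \<subseteq> {0..<T0}" using T0_pos by auto
  have "\<forall>\<^sub>F t in at_right 0. X i t < X (Suc i) t" if i: "i \<in> {1..<n}" for i
  proof -
    have "(X j \<longlongrightarrow> X j 0) (at_right 0)" if "j \<in> {1..n}" for j
    proof -
      have "(X j has_real_derivative shock_speed f df (Um j 0) (Up j 0)) (at 0 within {0..T0 / 2})"
        using ode_x that T0_pos by (intro has_field_derivative_subset[OF _ half]) auto
      then have "continuous (at 0 within {0..T0 / 2}) (X j)" by (rule DERIV_continuous)
      then show ?thesis using T0_pos by (simp add: continuous_within at_within_Icc_at_right)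
    qed
    then have "((\<lambda>t. X (Suc i) t - X i t) \<longlongrightarrow> X (Suc i) 0 - X i 0) (at_right 0)"
      using i by (intro tendsto_diff) auto
    then have "\<forall>\<^sub>F t in at_right 0. 0 < X (Suc i) t - X i t"
      by (rule order_tendstoD(1)) (use ordered i in simp)
    then show ?thesis by eventually_elim simp
  qed
  then have "\<forall>\<^sub>F t in at_right 0. \<forall>i\<in>{1..<n}. X i t < X (Suc i) t"
    by (intro eventually_ball_finite) auto
  then obtain b where b: "b > 0" "\<And>t i. 0 < t \<Longrightarrow> t < b \<Longrightarrow> i \<in> {1..<n} \<Longrightarrow> X i t < X (Suc i) t"
    unfolding eventually_at_right_field by blast
  \<comment> \<open>Order is known for \<open>0 < t < b\<close> and the equations on
    \<open>[0, T0)\<close>; halving both places the closed interval \<open>[0, T]\<close>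
    inside.\<close>
  define T where "T = min (b / 2) (T0 / 2)"
  have T: "0 < T" "T < b" "T \<le> T0 / 2" using b(1) T0_pos by (auto simp: T_def)
  have sub: "{0..T} \<subseteq> {0..<T0}" using half T(3) by auto
  have T_le: "T \<le> T0" using T(3) T0_pos by simp
  interpret particle_system f df ddf I n T X Um Up
  proof
    show "X i t < X (Suc i) t" if "1 \<le> i" "i < n" "t \<in> {0..T}" for i t
      using that ordered b(2)[of t i] T(2) by (cases "t = 0") auto
  qed (use f_deriv df_deriv I_interval convex_or_concave n_pos T(1) states_in_I oleinik sub in blast
    | use ode_x ode_um ode_up sub in \<open>blast intro: has_field_derivative_subset\<close>)+
  have ext: "(\<lambda>t x. if x < X 1 t then Um 1 t
                        else if X n t < x then Up n t
                        else interpolant df n (\<lambda>i. X i t) (\<lambda>i. Um i t) (\<lambda>i. Up i t) x) = extension"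
    by (intro ext) (simp only: extension_def)
  show ?thesis
    unfolding ext unfolding Let_def
    using extension_entropy_solution_unique T T_le by (intro exI[of _ T]) simp
qed

end
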